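(* Let $\kappa$ be a singular cardinal of cofinality $\lambda>\omega$ such that $\tau^\lambda<\kappa$ for all $\tau<\kappa$, and let $\mathbb{P}$ be ${}^{\mathrm{scl}}\mathbb{M}^{\mathrm{club}}_\kappa$ or $\mathbb{L}^{\mathrm{club}}_\kappa$. Let $p\in\mathbb{P}$ force that $\dot f$ is a function from $\lambda$ into $\kappa^+$. Then there are a set $x$ of size at most $\kappa$ and a condition $q\le p$ such that $q\Vdash\mathrm{rge}(\dot f)\subseteq\check x$.
   Context: Fix a strictly increasing sequence $\langle\kappa_\alpha:\alpha<\lambda\rangle$ of regular infinite cardinals with supremum $\kappa$. Let $N=\bigcup_{\alpha<\lambda}\prod_{\beta<\alpha}\kappa_\beta$ (functions $t$ with $\mathrm{dom}(t)$ an ordinal $<\lambda$ and $t(\beta)<\kappa_\beta$), ordered by end-extension $\sqsubseteq$. A tree is a nonempty $T\subseteq N$ closed under initial segments; $\mathrm{Succ}_T(t)$ is the set of immediate successors of $t$ and $\mathrm{OSucc}_T(t)=\{\beta:t^\frown\langle\beta\rangle\in T\}$. $T$ is $(<\lambda)$-closed if every node has a proper extension in $T$ and whenever $\delta<\lambda$ is a limit and $f$ has domain $\delta$ with $f\restriction\beta\in T$ for all $\beta<\delta$, then $f\in T$. Call $t\in p$ $\kappa_\alpha$-splitting (club sense) if $\mathrm{OSucc}_p(t)$ contains a club subset of $\kappa_\alpha$. $\mathbb{M}^{\mathrm{club}}_\kappa$: $(<\lambda)$-closed trees $p$ such that for every $s\in p$ and $\alpha<\lambda$ there is $t\in p$,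 $s\sqsubseteq t$, with $|\mathrm{Succ}_p(t)|\ge\kappa_\alpha$, and every node has an extension $t\in p$ with $\mathrm{OSucc}_p(t)$ containing a club subset of $\kappa_{\mathrm{dom}(t)}$. ${}^{\mathrm{scl}}\mathbb{M}^{\mathrm{club}}_\kappa$: those $p\in\mathbb{M}^{\mathrm{club}}_\kappa$ such that for every $\delta<\lambda$ and every $\sqsubseteq$-increasing $\langle t_\alpha:\alpha<\delta\rangle$ of nodes of $p$ with $t_\alpha$ $\kappa_\alpha$-splitting, $\bigcup_\alpha t_\alpha$ is a $\kappa_\delta$-splitting node of $p$. $\mathbb{L}^{\mathrm{club}}_\kappa$: $(<\lambda)$-closed trees $p$ with a node $s$ (the stem) comparable with every node of $p$ such that every $t\in p$ with $s\sqsubseteq t$ has $|\mathrm{Succ}_p(t)|=\kappa_{\mathrm{dom}(t)}$ and $\mathrm{OSucc}_p(t)$ containing a club of $\kappa_{\mathrm{dom}(t)}$. Both ordered by inclusion.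
   Formalization: In the definition of the scl Miller forcing, δ is taken to be a limit and the indices α of the splitting nodes range over any unbounded subset of δ; read literally (δ = 0, 1 allowed) the root would have to be κ_1-splitting, so the forcing would be empty. *)

theory Defs
  imports Main
begin

unbundle cardinal_syntax

text \<open>
  Ordinals are the elements of an arbitrary well-ordered type \<open>'o\<close>; an ordinal \<open>a\<close> is identified
  with its set of predecessors \<open>{..<a}\<close>, and cardinalities are compared with the library's
  order on cardinals. Statements over \<open>'o\<close> are polymorphic, so \<open>'o\<close> may be taken as long as needed.
\<close>

definition is_cardinal :: "'o::wellorder \<Rightarrow> bool" where
  "is_cardinal k \<longleftrightarrow> (\<forall>a<k. |{..<a}| <o |{..<k}| )"

definition is_card_succ :: "'o::wellorder \<Rightarrow> 'o \<Rightarrow> bool" where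
  "is_card_succ k k' \<longleftrightarrow>
     is_cardinal k' \<and> k < k' \<and> (\<forall>c. is_cardinal c \<and> k < c \<longrightarrow> k' \<le> c)"

definition limit_ordinal :: "'o::wellorder \<Rightarrow> bool" where
  "limit_ordinal d \<longleftrightarrow> (\<exists>a. a < d) \<and> (\<forall>a<d. \<exists>b<d. a < b)"

definition unbounded_in :: "'o::wellorder set \<Rightarrow> 'o \<Rightarrow> bool" where
  "unbounded_in A d \<longleftrightarrow> (\<forall>a<d. \<exists>b\<in>A. a \<le> b \<and> b < d)"

definition cof :: "'o::wellorder \<Rightarrow> 'o" where
  "cof k = (LEAST c. \<exists>f. f ` {..<c} \<subseteq> {..<k} \<and> unbounded_in (f ` {..<c}) k)"

definition regular_cardinal :: "'o::wellorder \<Rightarrow> bool" where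
  "regular_cardinal k \<longleftrightarrow> is_cardinal k \<and> infinite {..<k} \<and> cof k = k"

definition singular_cardinal :: "'o::wellorder \<Rightarrow> bool" where
  "singular_cardinal k \<longleftrightarrow> is_cardinal k \<and> infinite {..<k} \<and> cof k < k"

definition club_in :: "'o::wellorder set \<Rightarrow> 'o \<Rightarrow> bool" where
  "club_in C k \<longleftrightarrow> C \<subseteq> {..<k} \<and> unbounded_in C k \<and>
     (\<forall>d<k. limit_ordinal d \<and> unbounded_in C d \<longrightarrow> d \<in> C)"


section \<open>Trees\<close>

text \<open>
  A node is a partial map whose domain is (the set of predecessors of) an ordinal; for such maps
  end-extension is the library's \<^term>\<open>(\<subseteq>\<^sub>m)\<close>.
\<close>

type_synonym 'o node = "'o \<Rightarrow> 'o option"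

definition len :: "'o::wellorder node \<Rightarrow> 'o" where
  "len t = (THE a. dom t = {..<a})"

definition all_nodes :: "'o::wellorder \<Rightarrow> ('o \<Rightarrow> 'o) \<Rightarrow> 'o node set" where
  "all_nodes lam ks = {t. \<exists>a<lam. dom t = {..<a} \<and> (\<forall>b<a. \<exists>c<ks b. t b = Some c)}"

definition is_tree :: "'o::wellorder \<Rightarrow> ('o \<Rightarrow> 'o) \<Rightarrow> 'o node set \<Rightarrow> bool" where
  "is_tree lam ks T \<longleftrightarrow> T \<noteq> {} \<and> T \<subseteq> all_nodes lam ks \<and>
     (\<forall>t\<in>T. \<forall>s\<in>all_nodes lam ks. s \<subseteq>\<^sub>m t \<longrightarrow> s \<in> T)"

definition Succ :: "'o::wellorder node set \<Rightarrow> 'o node \<Rightarrow> 'o node set" where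
  "Succ T t = {u\<in>T. t \<subseteq>\<^sub>m u \<and> u \<noteq> t \<and>
     \<not> (\<exists>v\<in>T. t \<subseteq>\<^sub>m v \<and> v \<subseteq>\<^sub>m u \<and> v \<noteq> t \<and> v \<noteq> u)}"

definition OSucc :: "'o::wellorder node set \<Rightarrow> 'o node \<Rightarrow> 'o set" where
  "OSucc T t = {b. t(len t \<mapsto> b) \<in> T}"

definition lt_closed :: "'o::wellorder \<Rightarrow> 'o node set \<Rightarrow> bool" where
  "lt_closed lam T \<longleftrightarrow>
     (\<forall>t\<in>T. \<exists>u\<in>T. t \<subseteq>\<^sub>m u \<and> u \<noteq> t) \<and>
     (\<forall>d<lam. \<forall>f. limit_ordinal d \<and> dom f = {..<d} \<and> (\<forall>b<d. f |` {..<b} \<in> T) \<longrightarrow> f \<in> T)"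

definition club_splitting ::
    "('o::wellorder \<Rightarrow> 'o) \<Rightarrow> 'o node set \<Rightarrow> 'o \<Rightarrow> 'o node \<Rightarrow> bool" where
  "club_splitting ks p a t \<longleftrightarrow> (\<exists>C. club_in C (ks a) \<and> C \<subseteq> OSucc p t)"

definition M_club :: "'o::wellorder \<Rightarrow> ('o \<Rightarrow> 'o) \<Rightarrow> 'o node set set" where
  "M_club lam ks = {p. is_tree lam ks p \<and> lt_closed lam p \<and>
     (\<forall>s\<in>p. \<forall>a<lam. \<exists>t\<in>p. s \<subseteq>\<^sub>m t \<and> |{..<ks a}| \<le>o |Succ p t| ) \<and>
     (\<forall>s\<in>p. \<exists>t\<in>p. s \<subseteq>\<^sub>m t \<and> club_splitting ks p (len t) t)}"

text \<open>
  Closure of splitting under limits of length \<open>d\<close>: \<open>t a\<close> is \<open>\<kappa>\<^sub>a\<close>-splitting and the union has to be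
  \<open>\<kappa>\<^sub>d\<close>-splitting. Here \<open>d\<close> is a limit ordinal and the indices \<open>a\<close> run through an unbounded subset
  \<open>I\<close> of \<open>d\<close>, not necessarily all of \<open>d\<close>. If \<open>d = 0\<close> and \<open>d = 1\<close> were admitted, the root would have to
  be \<open>\<kappa>\<^sub>0\<close>-splitting and hence \<open>\<kappa>\<^sub>1\<close>-splitting, so no tree would qualify. If only \<open>I = {..<d}\<close> were
  admitted, the clause would be void for every \<open>p\<close> without \<open>\<kappa>\<^sub>0\<close>-splitting nodes, and such \<open>p\<close> are
  dense in \<open>M_club\<close> (delete the successors below \<open>\<kappa>\<^sub>0\<close> wherever others exist, and keep only one
  successor elsewhere); splitting nodes of a member of \<open>M_club\<close> are only guaranteed to be
  \<open>\<kappa>\<close>-splitting for the index \<open>len t\<close>, so the indices along a branch have gaps.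
\<close>

definition scl_M_club :: "'o::wellorder \<Rightarrow> ('o \<Rightarrow> 'o) \<Rightarrow> 'o node set set" where
  "scl_M_club lam ks = {p \<in> M_club lam ks.
     \<forall>d<lam. \<forall>I t. limit_ordinal d \<and> I \<subseteq> {..<d} \<and> unbounded_in I d \<and>
       (\<forall>a\<in>I. t a \<in> p \<and> club_splitting ks p a (t a)) \<and>
       (\<forall>a\<in>I. \<forall>b\<in>I. a < b \<longrightarrow> t a \<subseteq>\<^sub>m t b) \<longrightarrow>
       (\<exists>u\<in>p. Map.graph u = (\<Union>a\<in>I. Map.graph (t a)) \<and> club_splitting ks p d u)}"

definition L_club :: "'o::wellorder \<Rightarrow> ('o \<Rightarrow> 'o) \<Rightarrow> 'o node set set" where
  "L_club lam ks = {p. is_tree lam ks p \<and> lt_closed lam p \<and>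
     (\<exists>s\<in>p. (\<forall>t\<in>p. s \<subseteq>\<^sub>m t \<or> t \<subseteq>\<^sub>m s) \<and>
        (\<forall>t\<in>p. s \<subseteq>\<^sub>m t \<longrightarrow>
           |Succ p t| =o |{..<ks (len t)}| \<and> club_splitting ks p (len t) t))}"


section \<open>Names and the forcing relation\<close>

text \<open>
  A name is a set of pairs (name, condition), indexed by a subset of the type \<open>'i\<close>. Every name in the
  set-theoretic sense is represented once \<open>'i\<close> is at least as large as its transitive closure.
\<close>

datatype ('i, 'p) pname = PName "'i \<Rightarrow> (('i, 'p) pname \<times> 'p) option"

fun elts :: "('i, 'p) pname \<Rightarrow> (('i, 'p) pname \<times> 'p) set" where
  "elts (PName F) = ran F"

inductive is_name :: "'p set \<Rightarrow> ('i, 'p) pname \<Rightarrow> bool" for P where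
  "(\<And>y s. (y, s) \<in> elts x \<Longrightarrow> s \<in> P \<and> is_name P y) \<Longrightarrow> is_name P x"

text \<open>
  Recursion on names: \<open>p\<close> forces \<open>x = y\<close> iff every \<open>q \<le> p, s\<close> with \<open>(x', s) \<in> x\<close> forces
  \<open>x' \<in> y\<close>, and symmetrically. As names are well-founded, the least fixed point is the only one.
\<close>

inductive forces_eq ::
    "'p set \<Rightarrow> ('p \<Rightarrow> 'p \<Rightarrow> bool) \<Rightarrow> 'p \<Rightarrow> ('i, 'p) pname \<Rightarrow> ('i, 'p) pname \<Rightarrow> bool"
  for P le where
  "\<lbrakk>\<forall>x' s q. (x', s) \<in> elts x \<and> q \<in> P \<and> le q p \<and> le q s \<longrightarrow>
      (\<exists>r y' u. r \<in> P \<and> le r q \<and> (y', u) \<in> elts y \<and> le r u \<and> forces_eq P le r x' y');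
    \<forall>y' u q. (y', u) \<in> elts y \<and> q \<in> P \<and> le q p \<and> le q u \<longrightarrow>
      (\<exists>r x' s. r \<in> P \<and> le r q \<and> (x', s) \<in> elts x \<and> le r s \<and> forces_eq P le r x' y')\<rbrakk>
   \<Longrightarrow> forces_eq P le p x y"

text \<open>The language of set theory, with names as parameters and as bound variables.\<close>

datatype 'n fm =
    FEq 'n 'n
  | FMem 'n 'n
  | FNot "'n fm"
  | FAnd "'n fm" "'n fm"
  | FAll "'n \<Rightarrow> 'n fm"

primrec forces ::
    "'p set \<Rightarrow> ('p \<Rightarrow> 'p \<Rightarrow> bool) \<Rightarrow> ('i, 'p) pname fm \<Rightarrow> 'p \<Rightarrow> bool" where
  "forces P le (FEq x y) = (\<lambda>p. forces_eq P le p x y)"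
| "forces P le (FMem x y) = (\<lambda>p. \<forall>q\<in>P. le q p \<longrightarrow>
     (\<exists>r y' u. r \<in> P \<and> le r q \<and> (y', u) \<in> elts y \<and> le r u \<and> forces_eq P le r x y'))"
| "forces P le (FNot A) = (\<lambda>p. \<forall>q\<in>P. le q p \<longrightarrow> \<not> forces P le A q)"
| "forces P le (FAnd A B) = (\<lambda>p. forces P le A p \<and> forces P le B p)"
| "forces P le (FAll A) = (\<lambda>p. \<forall>x. is_name P x \<longrightarrow> forces P le (A x) p)"

definition FOr :: "'n fm \<Rightarrow> 'n fm \<Rightarrow> 'n fm" where
  "FOr A B = FNot (FAnd (FNot A) (FNot B))"

definition FImp :: "'n fm \<Rightarrow> 'n fm \<Rightarrow> 'n fm" where
  "FImp A B = FNot (FAnd A (FNot B))"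

definition FIff :: "'n fm \<Rightarrow> 'n fm \<Rightarrow> 'n fm" where
  "FIff A B = FAnd (FImp A B) (FImp B A)"

definition FEx :: "('n \<Rightarrow> 'n fm) \<Rightarrow> 'n fm" where
  "FEx A = FNot (FAll (\<lambda>x. FNot (A x)))"

definition FUpair :: "'n \<Rightarrow> 'n \<Rightarrow> 'n \<Rightarrow> 'n fm" where
  "FUpair z a b = FAll (\<lambda>w. FIff (FMem w z) (FOr (FEq w a) (FEq w b)))"

text \<open>\<open>z\<close> is the Kuratowski pair \<open>{{a}, {a, b}}\<close>.\<close>

definition FPair :: "'n \<Rightarrow> 'n \<Rightarrow> 'n \<Rightarrow> 'n fm" where
  "FPair z a b = FAll (\<lambda>w. FIff (FMem w z) (FOr (FUpair w a a) (FUpair w a b)))"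

definition FPairMem :: "'n \<Rightarrow> 'n \<Rightarrow> 'n \<Rightarrow> 'n fm" where
  "FPairMem a b f = FEx (\<lambda>z. FAnd (FPair z a b) (FMem z f))"

definition FFunction :: "'n \<Rightarrow> 'n \<Rightarrow> 'n \<Rightarrow> 'n fm" where
  "FFunction f A B =
     FAnd (FAll (\<lambda>z. FImp (FMem z f)
             (FEx (\<lambda>a. FEx (\<lambda>b. FAnd (FMem a A) (FAnd (FMem b B) (FPair z a b)))))))
    (FAnd (FAll (\<lambda>a. FImp (FMem a A) (FEx (\<lambda>b. FPairMem a b f))))
          (FAll (\<lambda>a. FAll (\<lambda>b. FAll (\<lambda>c.
             FImp (FAnd (FPairMem a b f) (FPairMem a c f)) (FEq b c))))))"

definition FRangeSubset :: "'n \<Rightarrow> 'n \<Rightarrow> 'n fm" where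
  "FRangeSubset f X = FAll (\<lambda>b. FImp (FEx (\<lambda>a. FPairMem a b f)) (FMem b X))"

text \<open>
  Check names of ordinals and of sets of ordinals, with \<open>one\<close> the largest condition. The summand
  \<open>'o\<close> of the index type makes room for them; the summand \<open>'i\<close> stays arbitrary.
\<close>

function check :: "'p \<Rightarrow> 'o::wellorder \<Rightarrow> ('o + 'i, 'p) pname" where
  "check one a = PName (\<lambda>j. case j of
     Inl b \<Rightarrow> if b < a then Some (check one b, one) else None
   | Inr _ \<Rightarrow> None)"
  by pat_completeness auto
termination
  by (relation "inv_image {(b, a). b < a} snd") (auto simp: wf wf_inv_image)

declare check.simps [simp del]

definition check_set :: "'p \<Rightarrow> 'o::wellorder set \<Rightarrow> ('o + 'i, 'p) pname" where
  "check_set one X = PName (\<lambda>j. case j of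
     Inl b \<Rightarrow> if b \<in> X then Some (check one b, one) else None
   | Inr _ \<Rightarrow> None)"

end

theory Submission
  imports Defs
begin

text \<open>
  There are only \<open>\<kappa>\<close> nodes, because \<open>\<tau>\<^sup>\<lambda> < \<kappa>\<close> for all \<open>\<tau> < \<kappa>\<close>. Hence it suffices to index the
  possible values of the function by pairs of an argument and a node.

  For Laver trees no fusion is needed: two conditions with the same nonempty stem are compatible, so
  for each argument and each stem at most one value can be decided, and \<open>q = p\<close> works.

  For Miller trees, normal trees (every node either splits into a club or has a unique successor) are
  dense, and they are closed under intersections of fewer than \<open>\<lambda>\<close> many decreasing conditions: the
  first splitting nodes above a given node in these conditions increase, and their union still splits
  in all of them by the closure of splitting under limits. One attaches to each node \<open>t\<close> a normal tree
  \<open>R t\<close>, decreasing along \<open>t\<close>; whenever a splitting node is passed, the first argument not yet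
  decided gets decided, and at limits one takes intersections. The nodes that stay inside their own
  trees form a condition, and below it each value of the function is decided by some \<open>R t\<close>.
\<close>

section \<open>The forcing relation\<close>

text \<open>A decreasing sequence of Miller conditions deciding all \<open>lam\<close> arguments one
  after the other breaks down at its end, because intersections are under control only for families
  of fewer than \<open>lam\<close> trees. The refinements are therefore spread over the tree: a node
  has length below \<open>lam\<close>, so the tree attached to it results from fewer than
  \<open>lam\<close> refinements, and no node of length \<open>lam\<close> exists at which anything
  would have to survive. The price is that a given argument is decided at different levels on
  different branches, so decided values are indexed by nodes and not by levels. Laver trees escape
  this because a common stem forces compatibility. The splitting nodes of two Miller trees above a
  common node need not meet, so there a value has to be tied to a node through its attached tree.
  Intersecting many clubs at one node needs a cardinal above the number of clubs. Hence only levels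
  from some \<open>a0\<close> with \<open>lam < ks a0\<close> on count as splitting in the Miller
  case. Forcing and trees touch only in the relation \<open>decides\<close>, of which monotonicity
  and density are used.\<close>

locale forcing_order =
  fixes P :: "'p set" and le :: "'p \<Rightarrow> 'p \<Rightarrow> bool"
  assumes le_refl: "le p p"
    and le_trans: "le p q \<Longrightarrow> le q r \<Longrightarrow> le p r"
begin

section \<open>Forced equality as an equivalence relation\<close>

lemma forces_eq_iff:
  "forces_eq P le p x y \<longleftrightarrow>
    (\<forall>x' s q. (x', s) \<in> elts x \<and> q \<in> P \<and> le q p \<and> le q s \<longrightarrow>
      (\<exists>r y' u. r \<in> P \<and> le r q \<and> (y', u) \<in> elts y \<and> le r u \<and> forces_eq P le r x' y')) \<and>
    (\<forall>y' u q. (y', u) \<in> elts y \<and> q \<in> P \<and> le q p \<and> le q u \<longrightarrow>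
      (\<exists>r x' s. r \<in> P \<and> le r q \<and> (x', s) \<in> elts x \<and> le r s \<and> forces_eq P le r x' y'))"
  by (subst forces_eq.simps) simp

lemma forces_eq_mono:
  assumes "forces_eq P le p x y" "le q p" shows "forces_eq P le q x y"
proof -
  have "le r p" if "le r q" for r using that assms(2) le_trans by blast
  then show ?thesis using assms(1) unfolding forces_eq_iff[of _ x y] by blast
qed

lemma forces_eq_refl: "forces_eq P le p x x"
proof (induction x arbitrary: p)
  case (PName F)
  have IH: "forces_eq P le q y y" if "(y, s) \<in> ran F" for y s q
    using that PName by (fastforce simp: ran_def image_iff)
  show ?case
    unfolding forces_eq_iff[of _ "PName F"] using IH le_refl by auto blast+
qed

lemma forces_eq_sym: "forces_eq P le p x y \<Longrightarrow> forces_eq P le p y x"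
proof (induction rule: forces_eq.induct)
  case (1 x p y)
  show ?case unfolding forces_eq_iff[of _ y x] using 1 by meson
qed

text \<open>The witness for the second equality is found only below the witness for the first, so
  the induction on the first derivation must offer its conclusion at stronger conditions
  too.\<close>

lemma forces_eq_trans_below:
  "forces_eq P le p x y \<Longrightarrow> le q p \<Longrightarrow> forces_eq P le q y z \<Longrightarrow> forces_eq P le q x z"
proof (induction arbitrary: q z rule: forces_eq.induct)
  case (1 x p y)
  have yz:
    "\<forall>y' u r. (y', u) \<in> elts y \<and> r \<in> P \<and> le r q \<and> le r u \<longrightarrow>
      (\<exists>s z' w. s \<in> P \<and> le s r \<and> (z', w) \<in> elts z \<and> le s w \<and> forces_eq P le s y' z')"
    "\<forall>z' w r. (z', w) \<in> elts z \<and> r \<in> P \<and> le r q \<and> le r w \<longrightarrow>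
      (\<exists>s y' u. s \<in> P \<and> le s r \<and> (y', u) \<in> elts y \<and> le s u \<and> forces_eq P le s y' z')"
    using "1.prems"(2) unfolding forces_eq_iff[of _ y z] by blast+
  show ?case
  proof (rule forces_eq.intros; intro allI impI; elim conjE)
    fix x' s r assume a: "(x', s) \<in> elts x" "r \<in> P" "le r q" "le r s"
    have "le r p" using a "1.prems"(1) le_trans by blast
    then obtain r1 y' u where r1: "r1 \<in> P" "le r1 r" "(y', u) \<in> elts y" "le r1 u"
      and IH: "\<And>q z. le q r1 \<Longrightarrow> forces_eq P le q y' z \<Longrightarrow> forces_eq P le q x' z"
      using "1.IH"(1) a by meson
    obtain r2 z' w where "r2 \<in> P" "le r2 r1" "(z', w) \<in> elts z" "le r2 w" "forces_eq P le r2 y' z'"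
      using yz(1) r1 a le_trans by meson
    then show "\<exists>r' z' u. r' \<in> P \<and> le r' r \<and> (z', u) \<in> elts z \<and> le r' u \<and> forces_eq P le r' x' z'"
      using IH r1 le_trans by meson
  next
    fix z' w r assume a: "(z', w) \<in> elts z" "r \<in> P" "le r q" "le r w"
    obtain r1 y' u where r1: "r1 \<in> P" "le r1 r" "(y', u) \<in> elts y" "le r1 u" "forces_eq P le r1 y' z'"
      using yz(2) a by meson
    have "le r1 p" using r1 a "1.prems"(1) le_trans by blast
    then obtain r2 x' s where r2: "r2 \<in> P" "le r2 r1" "(x', s) \<in> elts x" "le r2 s"
      and IH: "\<And>q z. le q r2 \<Longrightarrow> forces_eq P le q y' z \<Longrightarrow> forces_eq P le q x' z"
      using "1.IH"(2) r1 by meson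
    have "forces_eq P le r2 x' z'"
      using IH[OF le_refl] forces_eq_mono r1 r2 by blast
    then show "\<exists>r' x' s. r' \<in> P \<and> le r' r \<and> (x', s) \<in> elts x \<and> le r' s \<and> forces_eq P le r' x' z'"
      using r1 r2 le_trans by meson
  qed
qed

lemma forces_eq_trans:
  "forces_eq P le p x y \<Longrightarrow> forces_eq P le p y z \<Longrightarrow> forces_eq P le p x z"
  using forces_eq_trans_below le_refl by blast

lemma forces_eq_dense:
  assumes "\<And>q. q \<in> P \<Longrightarrow> le q p \<Longrightarrow> \<exists>r\<in>P. le r q \<and> forces_eq P le r x y"
  shows "forces_eq P le p x y"
proof (rule forces_eq.intros; intro allI impI; elim conjE)
  fix x' s q assume a: "(x', s) \<in> elts x" "q \<in> P" "le q p" "le q s"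
  then obtain r where r: "r \<in> P" "le r q" "forces_eq P le r x y" using assms by blast
  have "le r s" using a r le_trans by blast
  then obtain r' y' u where "r' \<in> P" "le r' r" "(y', u) \<in> elts y" "le r' u" "forces_eq P le r' x' y'"
    using r(3)[unfolded forces_eq_iff[of _ x y]] a(1) r(1) le_refl by meson
  then show "\<exists>r y' u. r \<in> P \<and> le r q \<and> (y', u) \<in> elts y \<and> le r u \<and> forces_eq P le r x' y'"
    using r le_trans by meson
next
  fix y' u q assume a: "(y', u) \<in> elts y" "q \<in> P" "le q p" "le q u"
  then obtain r where r: "r \<in> P" "le r q" "forces_eq P le r x y" using assms by blast
  have "le r u" using a r le_trans by blast
  then obtain r' x' s where "r' \<in> P" "le r' r" "(x', s) \<in> elts x" "le r' s" "forces_eq P le r' x' y'"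
    using r(3)[unfolded forces_eq_iff[of _ x y]] a(1) r(1) le_refl by meson
  then show "\<exists>r x' s. r \<in> P \<and> le r q \<and> (x', s) \<in> elts x \<and> le r s \<and> forces_eq P le r x' y'"
    using r le_trans by meson
qed

section \<open>Monotonicity, density and the derived connectives\<close>

lemma forces_mono: "forces P le A p \<Longrightarrow> le q p \<Longrightarrow> forces P le A q"
proof (induction A arbitrary: p q)
  case (FEq x y) then show ?case using forces_eq_mono by auto
next
  case (FMem x y) then show ?case by simp (meson le_trans)
next
  case (FNot A) then show ?case by simp (meson le_trans)
next
  case (FAnd A B) then show ?case by simp blast
next
  case (FAll A) then show ?case by simp (meson rangeI)
qed

text \<open>Equality and membership are themselves density conditions, negation speaks about all
  stronger conditions, and the other cases are inductive. This removes the double negation hidden in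
  \<open>FImp\<close>.\<close>

lemma forces_dense:
  "(\<And>q. q \<in> P \<Longrightarrow> le q p \<Longrightarrow> \<exists>r\<in>P. le r q \<and> forces P le A r) \<Longrightarrow> forces P le A p"
proof (induction A arbitrary: p)
  case (FEq x y) then show ?case using forces_eq_dense[of p x y] by simp
next
  case (FMem x y)
  show ?case
  proof (simp, intro ballI impI)
    fix q assume "q \<in> P" "le q p"
    then obtain r where r: "r \<in> P" "le r q" "forces P le (FMem x y) r" using FMem by blast
    then show "\<exists>r. r \<in> P \<and> le r q \<and>
      (\<exists>y' u. (y', u) \<in> elts y \<and> le r u \<and> forces_eq P le r x y')"
      using r(3)[simplified, rule_format, OF r(1) le_refl] le_trans by meson
  qed
next
  case (FNot A)
  show ?case
  proof (simp, intro ballI impI notI)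
    fix q assume q: "q \<in> P" "le q p" "forces P le A q"
    then obtain r where r: "r \<in> P" "le r q" "forces P le (FNot A) r" using FNot by blast
    then show False using forces_mono[OF q(3) r(2)] le_refl by auto
  qed
next
  case (FAnd A B) then show ?case by (simp) meson
next
  case (FAll A)
  show ?case
  proof (simp, intro allI impI)
    fix x :: "('a, 'p) pname" assume x: "is_name P x"
    show "forces P le (A x) p"
    proof (rule FAll.IH[OF rangeI])
      fix q assume "q \<in> P" "le q p"
      then obtain r where "r \<in> P" "le r q" "forces P le (FAll A) r" using FAll.prems by blast
      then show "\<exists>r\<in>P. le r q \<and> forces P le (A x) r" using x by auto
    qed
  qed
qed

lemma forces_FImp:
  "forces P le (FImp A B) p \<longleftrightarrow> (\<forall>q\<in>P. le q p \<longrightarrow> forces P le A q \<longrightarrow> forces P le B q)"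
proof
  assume *: "forces P le (FImp A B) p"
  show "\<forall>q\<in>P. le q p \<longrightarrow> forces P le A q \<longrightarrow> forces P le B q"
  proof (intro ballI impI)
    fix q assume q: "q \<in> P" "le q p" "forces P le A q"
    show "forces P le B q"
    proof (rule forces_dense)
      fix r assume r: "r \<in> P" "le r q"
      then have "le r p" "forces P le A r" using q le_trans forces_mono by blast+
      then show "\<exists>s\<in>P. le s r \<and> forces P le B s"
        using * r by (auto simp: FImp_def)
    qed
  qed
next
  assume "\<forall>q\<in>P. le q p \<longrightarrow> forces P le A q \<longrightarrow> forces P le B q"
  then show "forces P le (FImp A B) p"
    by (auto simp: FImp_def) (meson le_refl)
qed

lemma forces_FIff:
  "forces P le (FIff A B) p \<longleftrightarrow> (\<forall>q\<in>P. le q p \<longrightarrow> forces P le A q = forces P le B q)"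
  by (auto simp: FIff_def forces_FImp)

lemma forces_FOr:
  "forces P le (FOr A B) p \<longleftrightarrow>
    (\<forall>q\<in>P. le q p \<longrightarrow> (\<exists>r\<in>P. le r q \<and> (forces P le A r \<or> forces P le B r)))"
  unfolding FOr_def forces.simps
  by (meson forces_mono le_refl le_trans)

lemma forces_FOr_I1: "forces P le A p \<Longrightarrow> forces P le (FOr A B) p"
  and forces_FOr_I2: "forces P le B p \<Longrightarrow> forces P le (FOr A B) p"
  unfolding forces_FOr using forces_mono le_refl by blast+

lemma forces_FEx:
  "forces P le (FEx A) p \<longleftrightarrow>
    (\<forall>q\<in>P. le q p \<longrightarrow> (\<exists>r\<in>P. le r q \<and> (\<exists>x. is_name P x \<and> forces P le (A x) r)))"
  unfolding FEx_def forces.simps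
  by (meson forces_mono le_refl le_trans)

section \<open>Unordered and ordered pairs\<close>

lemma forces_FUpair:
  "forces P le (FUpair z a b) p \<longleftrightarrow> (\<forall>w q. is_name P w \<longrightarrow> q \<in> P \<longrightarrow> le q p \<longrightarrow>
     forces P le (FMem w z) q = forces P le (FOr (FEq w a) (FEq w b)) q)"
  unfolding FUpair_def forces.simps(5) forces_FIff by blast

lemma forces_FPair:
  "forces P le (FPair z a b) p \<longleftrightarrow> (\<forall>w q. is_name P w \<longrightarrow> q \<in> P \<longrightarrow> le q p \<longrightarrow>
     forces P le (FMem w z) q = forces P le (FOr (FUpair w a a) (FUpair w a b)) q)"
  unfolding FPair_def forces.simps(5) forces_FIff by blast

lemma forces_FOr_FEq_cong:
  assumes "forces P le (FOr (FEq w a) (FEq w b)) p" "forces_eq P le p a a'" "forces_eq P le p b b'"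
  shows "forces P le (FOr (FEq w a') (FEq w b')) p"
  using assms unfolding forces_FOr forces.simps
  by (meson forces_eq_mono forces_eq_trans le_trans)

lemma forces_FUpair_cong:
  assumes "forces_eq P le p a a'" "forces_eq P le p b b'"
  shows "forces P le (FUpair z a b) p = forces P le (FUpair z a' b') p"
  unfolding forces_FUpair
  using forces_FOr_FEq_cong forces_eq_mono[OF assms(1)] forces_eq_mono[OF assms(2)] forces_eq_sym
  by meson

lemma forces_FPair_cong:
  assumes "forces_eq P le p a a'" "forces P le (FPair z a b) p"
  shows "forces P le (FPair z a' b) p"
proof -
  have "forces P le (FUpair w a a) q = forces P le (FUpair w a' a') q"
    "forces P le (FUpair w a b) q = forces P le (FUpair w a' b) q" if "le q p" for w q
    using forces_FUpair_cong forces_eq_mono[OF assms(1) that] forces_eq_refl by blast+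
  then have "forces P le (FOr (FUpair w a a) (FUpair w a b)) q =
      forces P le (FOr (FUpair w a' a') (FUpair w a' b)) q" if "le q p" for w q
    unfolding forces_FOr using that le_trans by meson
  then show ?thesis using assms(2) unfolding forces_FPair by simp
qed

lemma forces_FPairMem_cong:
  assumes "forces_eq P le p a a'" "forces P le (FPairMem a b f) p"
  shows "forces P le (FPairMem a' b f) p"
  using assms unfolding FPairMem_def forces_FEx forces.simps(4)
  by (meson forces_FPair_cong forces_eq_mono le_trans)

text \<open>Members of a name are indexed by \<open>'i\<close>, so two distinct indices are needed
  to hold two members. The label \<open>p\<close> makes both present below \<open>p\<close>.\<close>

definition upair_name :: "'i \<Rightarrow> 'i \<Rightarrow> 'p \<Rightarrow> ('i, 'p) pname \<Rightarrow> ('i, 'p) pname \<Rightarrow> ('i, 'p) pname" where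
  "upair_name i j p a b = PName (Map.empty(i \<mapsto> (a, p), j \<mapsto> (b, p)))"

lemma elts_upair_name: "i \<noteq> j \<Longrightarrow> elts (upair_name i j p a b) = {(a, p), (b, p)}"
  by (auto simp: upair_name_def ran_def)

lemma is_name_upair_name:
  "i \<noteq> j \<Longrightarrow> p \<in> P \<Longrightarrow> is_name P a \<Longrightarrow> is_name P b \<Longrightarrow> is_name P (upair_name i j p a b)"
  by (rule is_name.intros) (auto simp: elts_upair_name)

lemma forces_FUpair_upair_name:
  assumes "i \<noteq> j" shows "forces P le (FUpair (upair_name i j p a b) a b) p"
proof -
  have "forces P le (FMem w (upair_name i j p a b)) q = forces P le (FOr (FEq w a) (FEq w b)) q"
    if "le q p" for w q
  proof -
    have "le r p" if "le r s" "le s q" for r s using that \<open>le q p\<close> le_trans by blast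
    then show ?thesis
      unfolding forces_FOr forces.simps elts_upair_name[OF assms] by blast
  qed
  then show ?thesis unfolding forces_FUpair by blast
qed

lemma forces_FUpair_left: "forces P le (FUpair w a b) p \<Longrightarrow> p \<in> P \<Longrightarrow> is_name P a \<Longrightarrow> forces P le (FMem a w) p"
  unfolding forces_FUpair using le_refl forces_FOr_I1[of "FEq a a" p] forces_eq_refl[of p a]
  by (metis forces.simps(1))

lemma forces_FUpair_right: "forces P le (FUpair w a b) p \<Longrightarrow> p \<in> P \<Longrightarrow> is_name P b \<Longrightarrow> forces P le (FMem b w) p"
  unfolding forces_FUpair using le_refl forces_FOr_I2[of "FEq b b" p] forces_eq_refl[of p b]
  by (metis forces.simps(1))

text \<open>Enough for injectivity of pairs: the singleton of \<open>a\<close> and the pair of \<open>a\<close> and \<open>b\<close> are members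
  of \<open>z\<close>, so each is an unordered pair of \<open>a'\<close> and one of \<open>a'\<close>, \<open>b'\<close>.\<close>

lemma forces_FPair_members:
  fixes i j :: 'i and z :: "('i, 'p) pname"
  assumes ij: "i \<noteq> j" and p: "p \<in> P"
    and nm: "is_name P a" "is_name P b" "is_name P a'" "is_name P b'"
    and z: "forces P le (FPair z a b) p" "forces P le (FPair z a' b') p"
  shows "forces_eq P le p a a'" "forces P le (FOr (FEq b a') (FEq b b')) p"
proof -
  let ?s = "upair_name i j p a a" and ?t = "upair_name i j p a b"
  have s: "is_name P ?s" "forces P le (FUpair ?s a a) p"
    and t: "is_name P ?t" "forces P le (FUpair ?t a b) p"
    by (simp_all only: is_name_upair_name[OF ij p] forces_FUpair_upair_name[OF ij] nm)
  have "forces P le (FMem ?s z) p" "forces P le (FMem ?t z) p"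
    using z(1)[unfolded forces_FPair, rule_format, OF s(1) p le_refl] forces_FOr_I1[OF s(2)]
      z(1)[unfolded forces_FPair, rule_format, OF t(1) p le_refl] forces_FOr_I2[OF t(2)] by blast+
  then have s': "forces P le (FOr (FUpair ?s a' a') (FUpair ?s a' b')) p"
    and t': "forces P le (FOr (FUpair ?t a' a') (FUpair ?t a' b')) p"
    using z(2)[unfolded forces_FPair, rule_format, OF s(1) p le_refl]
      z(2)[unfolded forces_FPair, rule_format, OF t(1) p le_refl] by blast+
  show "forces_eq P le p a a'"
  proof (rule forces_eq_dense)
    fix q assume q: "q \<in> P" "le q p"
    then obtain r where r: "r \<in> P" "le r q" "forces P le (FMem a' ?s) r"
      using s'[unfolded forces_FOr] forces_FUpair_left nm by meson
    have "le r p" using r q le_trans by blast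
    then have "forces P le (FOr (FEq a' a) (FEq a' a)) r"
      using s(2)[unfolded forces_FUpair] r nm by blast
    then show "\<exists>r\<in>P. le r q \<and> forces_eq P le r a a'"
      unfolding forces_FOr using r le_refl le_trans forces_eq_sym by (metis forces.simps(1))
  qed
  show "forces P le (FOr (FEq b a') (FEq b b')) p"
  proof (rule forces_dense)
    fix q assume q: "q \<in> P" "le q p"
    then obtain r where r: "r \<in> P" "le r q" "forces P le (FUpair ?t a' a') r \<or> forces P le (FUpair ?t a' b') r"
      using t'[unfolded forces_FOr] by meson
    have "le r p" using r q le_trans by blast
    then have "forces P le (FMem b ?t) r"
      using forces_FUpair_right[OF t(2) p nm(2)] forces_mono by blast
    then have "forces P le (FOr (FEq b a') (FEq b a')) r \<or> forces P le (FOr (FEq b a') (FEq b b')) r"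
      using r(3) unfolding forces_FUpair using r(1) nm le_refl by blast
    then have "forces P le (FOr (FEq b a') (FEq b b')) r"
      unfolding forces_FOr by blast
    then show "\<exists>r\<in>P. le r q \<and> forces P le (FOr (FEq b a') (FEq b b')) r"
      using r by blast
  qed
qed

lemma forces_FPair_inject:
  fixes i j :: 'i and z :: "('i, 'p) pname"
  assumes ij: "i \<noteq> j" and p: "p \<in> P"
    and nm: "is_name P a" "is_name P b" "is_name P a'" "is_name P b'"
    and z: "forces P le (FPair z a b) p" "forces P le (FPair z a' b') p"
  shows "forces_eq P le p a a'" "forces_eq P le p b b'"
proof -
  show aa': "forces_eq P le p a a'"
    using forces_FPair_members(1)[OF ij p nm z] .
  have b: "forces P le (FOr (FEq b a') (FEq b b')) p"
    using forces_FPair_members(2)[OF ij p nm z] .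
  have b': "forces P le (FOr (FEq b' a) (FEq b' b)) p"
    using forces_FPair_members(2)[OF ij p nm(3,4,1,2) z(2,1)] .
  show "forces_eq P le p b b'"
  proof (rule forces_eq_dense)
    fix q assume q: "q \<in> P" "le q p"
    then obtain r where r: "r \<in> P" "le r q" "forces_eq P le r b a' \<or> forces_eq P le r b b'"
      using b[unfolded forces_FOr] by auto
    have rp: "le r p" using r q le_trans by blast
    then obtain s where s: "s \<in> P" "le s r" "forces_eq P le s b' a \<or> forces_eq P le s b' b"
      using b'[unfolded forces_FOr] r by auto
    \<comment> \<open>If neither alternative yields the equality directly, then \<open>b\<close>
      equals \<open>a'\<close>, which equals \<open>a\<close>, which equals
      \<open>b'\<close>.\<close>
    have "forces_eq P le s b b'"
      using s r(3) forces_eq_mono[OF _ s(2)] forces_eq_mono[OF aa' le_trans[OF s(2) rp]]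
        forces_eq_sym forces_eq_trans by meson
    then show "\<exists>r\<in>P. le r q \<and> forces_eq P le r b b'" using s r le_trans by blast
  qed
qed

section \<open>Check names and decided values\<close>

lemma elts_check: "elts (check u a) = {(check u b, u) | b. b < a}"
  by (subst check.simps) (auto simp: ran_def split: sum.splits if_splits, metis sum.exhaust)

lemma elts_check_set: "elts (check_set u X) = {(check u b, u) | b. b \<in> X}"
  by (auto simp: check_set_def ran_def split: sum.splits if_splits) (metis sum.exhaust)

lemma is_name_check: "u \<in> P \<Longrightarrow> is_name P (check u a)"
proof (induction a rule: less_induct)
  case (less a)
  then show ?case by (intro is_name.intros) (auto simp: elts_check)
qed

text \<open>Below both labels the choice of the label is immaterial. Thus \<open>check r a\<close>,
  a name over \<open>P\<close> for every condition \<open>r\<close>, can stand in for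
  \<open>check one a\<close> without knowing whether \<open>one\<close> is a condition.\<close>

lemma forces_eq_check:
  "le p u \<Longrightarrow> le p v \<Longrightarrow>
    forces_eq P le p (check u a :: ('o::wellorder + 'i, 'p) pname) (check v a)"
proof (induction a arbitrary: p rule: less_induct)
  case (less a)
  let ?c = "check :: 'p \<Rightarrow> 'o \<Rightarrow> ('o + 'i, 'p) pname"
  have IH: "forces_eq P le q (?c u b) (?c v b)" "le q u" "le q v" if "b < a" "le q p" for b q
    using less.IH[OF that(1)] le_trans[OF that(2)] less.prems by blast+
  show ?case
  proof (rule forces_eq.intros; intro allI impI; elim conjE)
    fix x s q assume x: "(x, s) \<in> elts (?c u a)" "q \<in> P" "le q p"
    then obtain b where "b < a" "x = ?c u b" by (auto simp: elts_check)
    then show "\<exists>r y t. r \<in> P \<and> le r q \<and> (y, t) \<in> elts (?c v a) \<and> le r t \<and> forces_eq P le r x y"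
      using IH[OF \<open>b < a\<close> x(3)] x(2) le_refl
      by (intro exI[of _ q] exI[of _ "?c v b"] exI[of _ v]) (auto simp: elts_check)
  next
    fix y t q assume y: "(y, t) \<in> elts (?c v a)" "q \<in> P" "le q p"
    then obtain b where "b < a" "y = ?c v b" by (auto simp: elts_check)
    then show "\<exists>r x s. r \<in> P \<and> le r q \<and> (x, s) \<in> elts (?c u a) \<and> le r s \<and> forces_eq P le r x y"
      using IH[OF \<open>b < a\<close> y(3)] y(2) le_refl
      by (intro exI[of _ q] exI[of _ "?c u b"] exI[of _ u]) (auto simp: elts_check)
  qed
qed

text \<open>The detour through \<open>a\<close> and \<open>b\<close> is taken because check names
  labelled \<open>one\<close> are guaranteed to be names over \<open>P\<close> only when
  \<open>one\<close> is a condition.\<close>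

definition decides :: "('o::wellorder + 'i, 'p) pname \<Rightarrow> 'p \<Rightarrow> 'o \<Rightarrow> 'o \<Rightarrow> 'p \<Rightarrow> bool" where
  "decides f one \<alpha> \<nu> r \<longleftrightarrow> (\<exists>a b. is_name P a \<and> is_name P b \<and> forces_eq P le r a (check one \<alpha>) \<and>
     forces_eq P le r b (check one \<nu>) \<and> forces P le (FPairMem a b f) r)"

lemma decides_mono: "decides f one \<alpha> \<nu> r \<Longrightarrow> le r' r \<Longrightarrow> decides f one \<alpha> \<nu> r'"
  unfolding decides_def using forces_mono forces_eq_mono by meson

lemma forces_FMem_checkD:
  assumes "forces P le (FMem x (check one a)) p" "p \<in> P"
  obtains r b where "r \<in> P" "le r p" "b < a" "forces_eq P le r x (check one b)"
  using assms le_refl by (auto simp: elts_check)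

lemma forces_FFunctionD:
  assumes f: "forces P le (FFunction f A B) p"
  shows
    "\<lbrakk>is_name P z; q \<in> P; le q p; forces P le (FMem z f) q\<rbrakk> \<Longrightarrow>
      \<exists>r a b. r \<in> P \<and> le r q \<and> is_name P a \<and> is_name P b \<and> forces P le (FMem a A) r \<and>
        forces P le (FMem b B) r \<and> forces P le (FPair z a b) r"
    and "\<lbrakk>is_name P a; q \<in> P; le q p; forces P le (FMem a A) q\<rbrakk> \<Longrightarrow>
      \<exists>r b. r \<in> P \<and> le r q \<and> is_name P b \<and> forces P le (FPairMem a b f) r"
    and "\<lbrakk>is_name P a; is_name P b; is_name P c; q \<in> P; le q p; forces P le (FPairMem a b f) q;
      forces P le (FPairMem a c f) q\<rbrakk> \<Longrightarrow> forces_eq P le q b c"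
proof -
  have f1: "\<forall>z. is_name P z \<longrightarrow> forces P le (FImp (FMem z f)
             (FEx (\<lambda>a. FEx (\<lambda>b. FAnd (FMem a A) (FAnd (FMem b B) (FPair z a b)))))) p"
    and f2: "\<forall>a. is_name P a \<longrightarrow> forces P le (FImp (FMem a A) (FEx (\<lambda>b. FPairMem a b f))) p"
    and f3: "\<forall>a b c. is_name P a \<longrightarrow> is_name P b \<longrightarrow> is_name P c \<longrightarrow>
        forces P le (FImp (FAnd (FPairMem a b f) (FPairMem a c f)) (FEq b c)) p"
    using f by (simp_all add: FFunction_def)
  show "\<exists>r a b. r \<in> P \<and> le r q \<and> is_name P a \<and> is_name P b \<and> forces P le (FMem a A) r \<and>
        forces P le (FMem b B) r \<and> forces P le (FPair z a b) r"
    if z: "is_name P z" "q \<in> P" "le q p" "forces P le (FMem z f) q"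
  proof -
    have "forces P le (FEx (\<lambda>a. FEx (\<lambda>b. FAnd (FMem a A) (FAnd (FMem b B) (FPair z a b))))) q"
      using f1 z unfolding forces_FImp by blast
    then obtain r a where r: "r \<in> P" "le r q" "is_name P a"
      "forces P le (FEx (\<lambda>b. FAnd (FMem a A) (FAnd (FMem b B) (FPair z a b)))) r"
      unfolding forces_FEx[where p = q] using z le_refl by blast
    then obtain s b where "s \<in> P" "le s r" "is_name P b"
      "forces P le (FAnd (FMem a A) (FAnd (FMem b B) (FPair z a b))) s"
      unfolding forces_FEx using le_refl by blast
    then show ?thesis using r le_trans unfolding forces.simps(4) by blast
  qed
  show "\<exists>r b. r \<in> P \<and> le r q \<and> is_name P b \<and> forces P le (FPairMem a b f) r"
    if "is_name P a" "q \<in> P" "le q p" "forces P le (FMem a A) q"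
    using f2 that unfolding forces_FImp forces_FEx using le_refl by blast
  show "forces_eq P le q b c"
    if "is_name P a" "is_name P b" "is_name P c" "q \<in> P" "le q p" "forces P le (FPairMem a b f) q"
      "forces P le (FPairMem a c f) q"
    using f3 that unfolding forces_FImp by simp
qed

lemma forces_FPairMemD:
  assumes "forces P le (FPairMem a b f) q" "q \<in> P"
  obtains r z where "r \<in> P" "le r q" "is_name P z" "forces P le (FPair z a b) r" "forces P le (FMem z f) r"
  using assms le_refl unfolding FPairMem_def forces_FEx forces.simps(4) by blast

text \<open>The function axiom gives some pair of a member of \<open>lam\<close> and a member of
  \<open>mu\<close>; injectivity of pairs carries their values over to \<open>a\<close> and
  \<open>b\<close>.\<close>

lemma FPairMem_values:
  fixes f :: "('o::wellorder + 'i, 'p) pname"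
  assumes ij: "(i :: 'o + 'i) \<noteq> j"
    and f: "forces P le (FFunction f (check one lam) (check one mu)) p"
    and q: "q \<in> P" "le q p" and nm: "is_name P a" "is_name P b"
    and ab: "forces P le (FPairMem a b f) q"
  obtains r \<alpha> \<nu> where "r \<in> P" "le r q" "\<alpha> < lam" "\<nu> < mu"
    "forces_eq P le r a (check one \<alpha>)" "forces_eq P le r b (check one \<nu>)"
proof -
  obtain r z where r: "r \<in> P" "le r q" "is_name P z" "forces P le (FPair z a b) r" "forces P le (FMem z f) r"
    using forces_FPairMemD[OF ab q(1)] .
  obtain s a' b' where s: "s \<in> P" "le s r" "is_name P a'" "is_name P b'"
      "forces P le (FMem a' (check one lam)) s" "forces P le (FMem b' (check one mu)) s"
      "forces P le (FPair z a' b') s"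
    using forces_FFunctionD(1)[OF f r(3,1) _ r(5)] le_trans r q by blast
  obtain t \<alpha> where t: "t \<in> P" "le t s" "\<alpha> < lam" "forces_eq P le t a' (check one \<alpha>)"
    using forces_FMem_checkD[OF s(5,1)] .
  obtain u \<nu> where u: "u \<in> P" "le u t" "\<nu> < mu" "forces_eq P le u b' (check one \<nu>)"
    using forces_FMem_checkD[OF forces_mono[OF s(6) t(2)] t(1)] .
  have us: "le u s" "le u r" "le u q" using u t s r le_trans by blast+
  have "forces_eq P le u a a'" "forces_eq P le u b b'"
    using forces_FPair_inject[OF ij u(1) nm s(3,4)] forces_mono[OF r(4) us(2)]
      forces_mono[OF s(7) us(1)] by blast+
  then show ?thesis
    using that[OF u(1) us(3) t(3) u(3)] forces_eq_trans forces_eq_mono[OF t(4) u(2)] u(4) by blast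
qed

lemma decides_dense:
  fixes f :: "('o::wellorder + 'i, 'p) pname"
  assumes ij: "(i :: 'o + 'i) \<noteq> j" and one: "\<forall>r\<in>P. le r one"
    and f: "forces P le (FFunction f (check one lam) (check one mu)) p"
    and r: "r \<in> P" "le r p" and \<alpha>: "\<alpha> < lam"
  shows "\<exists>r'\<in>P. le r' r \<and> (\<exists>\<nu>. decides f one \<alpha> \<nu> r')"
proof -
  \<comment> \<open>The label \<open>r\<close> in place of \<open>one\<close> makes this a name over
    \<open>P\<close>.\<close>
  have a: "is_name P (check r \<alpha>)" "forces_eq P le r (check r \<alpha>) (check one \<alpha>)"
    using is_name_check forces_eq_check le_refl one r by blast+
  then have "forces P le (FMem (check r \<alpha>) (check one lam)) r"
    using \<alpha> one le_refl forces_eq_mono by (auto simp: elts_check) blast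
  then obtain s b where s: "s \<in> P" "le s r" "is_name P b" "forces P le (FPairMem (check r \<alpha>) b f) s"
    using forces_FFunctionD(2)[OF f a(1) r] by blast
  have "le s p" using s r le_trans by blast
  then obtain t \<nu> where "t \<in> P" "le t s" "forces_eq P le t b (check one \<nu>)"
    using FPairMem_values[OF ij f s(1) _ a(1) s(3,4)] by metis
  then have "decides f one \<alpha> \<nu> t" "le t r" "t \<in> P"
    unfolding decides_def using a s forces_mono forces_eq_mono le_trans by blast+
  then show ?thesis by blast
qed

text \<open>Reduces the theorem to the combinatorics of trees: single-valuedness identifies every
  forced value of \<open>f\<close> with a decided one, so dense decisions inside \<open>X\<close>
  suffice.\<close>

lemma forces_range_subset:
  fixes f :: "('o::wellorder + 'i, 'p) pname"
  assumes ij: "(i :: 'o + 'i) \<noteq> j" and one: "\<forall>r\<in>P. le r one"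
    and f: "forces P le (FFunction f (check one lam) (check one mu)) p"
    and q: "q \<in> P" "le q p"
    and X: "\<And>r \<alpha>. r \<in> P \<Longrightarrow> le r q \<Longrightarrow> \<alpha> < lam \<Longrightarrow> \<exists>r'\<in>P. le r' r \<and> (\<exists>\<nu>\<in>X. decides f one \<alpha> \<nu> r')"
  shows "forces P le (FRangeSubset f (check_set one X)) q"
  unfolding FRangeSubset_def forces.simps(5) forces_FImp
proof (intro allI impI ballI)
  fix b :: "('o + 'i, 'p) pname" and r
  assume b: "is_name P b" and r: "r \<in> P" "le r q" and ex: "forces P le (FEx (\<lambda>a. FPairMem a b f)) r"
  show "forces P le (FMem b (check_set one X)) r"
  proof (rule forces_dense)
    fix s assume s: "s \<in> P" "le s r"
    then obtain t a where t: "t \<in> P" "le t s" "is_name P a" "forces P le (FPairMem a b f) t"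
      using ex unfolding forces_FEx by blast
    have "le t p" "le t q" using t s r q le_trans by blast+
    then obtain u \<alpha> where u: "u \<in> P" "le u t" "\<alpha> < lam" "forces_eq P le u a (check one \<alpha>)"
      using FPairMem_values[OF ij f t(1) _ t(3) b t(4)] by metis
    obtain v \<nu> where v: "v \<in> P" "le v u" "\<nu> \<in> X" "decides f one \<alpha> \<nu> v"
      using X[OF u(1) _ u(3)] u \<open>le t q\<close> le_trans by blast
    then obtain a' b' where a': "is_name P a'" "is_name P b'" "forces_eq P le v a' (check one \<alpha>)"
      "forces_eq P le v b' (check one \<nu>)" "forces P le (FPairMem a' b' f) v"
      unfolding decides_def by blast
    have vt: "le v t" "le v p" "le v s" using v u t \<open>le t p\<close> le_trans by blast+
    have "forces_eq P le v a a'"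
      using forces_eq_mono[OF u(4) v(2)] a'(3) forces_eq_sym forces_eq_trans by blast
    then have "forces P le (FPairMem a' b f) v"
      using forces_FPairMem_cong forces_mono[OF t(4) vt(1)] by blast
    then have "forces_eq P le v b b'"
      using forces_FFunctionD(3)[OF f a'(1) b a'(2) v(1) vt(2)] a'(5) by blast
    then have "forces_eq P le v b (check one \<nu>)" using a'(4) forces_eq_trans by blast
    then have "forces P le (FMem b (check_set one X)) v"
      using v(3) one le_refl forces_eq_mono by (auto simp: elts_check_set) blast
    then show "\<exists>v\<in>P. le v s \<and> forces P le (FMem b (check_set one X)) v" using v vt by blast
  qed
qed

end


section \<open>Clubs and cofinalities\<close>

lemma card_of_finite_ordLess_infinite: "finite A \<Longrightarrow> infinite B \<Longrightarrow> |A| <o |B|"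
  by (rule finite_ordLess_infinite[OF card_of_Well_order card_of_Well_order]) (auto simp: Field_card_of)

text \<open>The bridge between comparison of cardinals and ordinals of type \<open>'o\<close>: the
  order of \<open>'o\<close> below \<open>k\<close> is at least as long as the cardinal of
  \<open>{..<k}\<close>, so the smaller cardinal of \<open>A\<close> is isomorphic to a proper
  initial segment of it.\<close>

lemma ex_initial_segment:
  fixes k :: "'o::wellorder"
  assumes "|A| <o |{..<k}|"
  shows "\<exists>c<k. \<exists>g. g ` {..<c} = A"
proof -
  let ?r = "{(x, y). x \<le> y \<and> y < k}"
  have F: "Field ?r = {..<k}" by (force simp: Field_def)
  have wf: "wf {(x, y). x < (y::'o)}" by (rule wf)
  have "well_order_on {..<k} ?r"
    unfolding well_order_on_def linear_order_on_def partial_order_on_def preorder_on_def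
  proof (intro conjI)
    show "refl_on {..<k} ?r" by (auto simp: refl_on_def)
    show "trans ?r" by (auto simp: trans_def)
    show "antisym ?r" by (auto simp: antisym_def)
    show "total_on {..<k} ?r" by (auto simp: total_on_def)
    show "wf (?r - Id)" by (rule wf_subset[OF wf]) auto
    show "?r \<subseteq> {..<k} \<times> {..<k}" by auto
  qed
  then have wo: "Well_order ?r" and le: "|{..<k}| \<le>o ?r"
    using F card_of_least by auto
  have "|A| <o ?r" using assms le ordLess_ordLeq_trans by blast
  then obtain a where a: "a \<in> Field ?r" "|A| =o Restr ?r (underS ?r a)"
    using ordLess_iff_ordIso_Restr[OF wo card_of_Well_order] by blast
  have "Field (Restr ?r (underS ?r a)) = {..<a}"
    using a(1) unfolding F by (auto simp: Field_def underS_def)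
  then have "|A| =o |{..<a}|" using card_of_cong[OF a(2)] by (simp add: Field_card_of)
  then obtain g where "bij_betw g {..<a} A"
    using ordIso_symmetric card_of_ordIso by metis
  then show ?thesis using a(1) unfolding F bij_betw_def by blast
qed

lemma bounded_below_cof:
  assumes A: "A \<subseteq> {..<k}" and small: "|A| <o |{..<cof k}|"
  shows "\<exists>d<k. \<forall>x\<in>A. x < d"
proof (rule ccontr)
  assume "\<not> ?thesis"
  then have unb: "unbounded_in A k"
    using A unfolding unbounded_in_def by (meson lessThan_iff not_le subsetD)
  obtain c g where "c < cof k" "g ` {..<c} = A" using ex_initial_segment[OF small] by blast
  then show False
    using A unb not_less_Least[of c "\<lambda>c. \<exists>f. f ` {..<c} \<subseteq> {..<k} \<and> unbounded_in (f ` {..<c}) k"]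
    unfolding cof_def by blast
qed

lemma cof_le:
  "f ` {..<c} \<subseteq> {..<k} \<Longrightarrow> unbounded_in (f ` {..<c}) k \<Longrightarrow> cof k \<le> c"
  unfolding cof_def by (rule Least_le) blast

lemma regular_bounded:
  "regular_cardinal k \<Longrightarrow> A \<subseteq> {..<k} \<Longrightarrow> |A| <o |{..<k}| \<Longrightarrow> \<exists>d<k. \<forall>x\<in>A. x < d"
  using bounded_below_cof[of A k] by (simp add: regular_cardinal_def)

lemma regular_ex_greater:
  assumes "regular_cardinal k" "x < k" shows "\<exists>y<k. x < y"
proof -
  have "|{x}| <o |{..<k}|"
    using assms by (simp add: regular_cardinal_def card_of_finite_ordLess_infinite)
  then show ?thesis using regular_bounded[OF assms(1), of "{x}"] assms(2) by auto
qed

lemma club_ex_greater: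
  assumes "regular_cardinal k" "club_in C k" "x < k" shows "\<exists>c\<in>C. x < c"
  using regular_ex_greater[OF assms(1,3)] assms(2) unfolding club_in_def unbounded_in_def
  by (meson order_less_le_trans)

lemma card_unbounded:
  assumes "regular_cardinal k" "C \<subseteq> {..<k}" "unbounded_in C k" shows "|{..<k}| \<le>o |C|"
proof (rule ccontr)
  assume "\<not> ?thesis"
  then have "|C| <o |{..<k}|" by (simp add: not_ordLeq_iff_ordLess card_of_Well_order)
  then obtain d where "d < k" "\<forall>x\<in>C. x < d" using regular_bounded assms by blast
  then show False using assms(3) unfolding unbounded_in_def by (meson leD)
qed

lemma club_Int_atLeast:
  assumes "regular_cardinal k" "club_in C k" "e < k" shows "club_in (C \<inter> {e..}) k"
  unfolding club_in_def
proof (intro conjI allI impI)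
  show "C \<inter> {e..} \<subseteq> {..<k}" using assms(2) unfolding club_in_def by blast
  show "unbounded_in (C \<inter> {e..}) k"
    unfolding unbounded_in_def
  proof (intro allI impI)
    fix a assume "a < k"
    then have "max a e < k" using assms(3) by simp
    then obtain b where "b \<in> C" "max a e \<le> b" "b < k"
      using assms(2) unfolding club_in_def unbounded_in_def by blast
    then show "\<exists>b\<in>C \<inter> {e..}. a \<le> b \<and> b < k" by (intro bexI[of _ b]) auto
  qed
next
  fix d assume d: "d < k" "limit_ordinal d \<and> unbounded_in (C \<inter> {e..}) d"
  then have "unbounded_in C d" unfolding unbounded_in_def by blast
  then have "d \<in> C" using assms(2) d unfolding club_in_def by blast
  moreover have "e \<le> d" using d unfolding limit_ordinal_def unbounded_in_def by force
  ultimately show "d \<in> C \<inter> {e..}" by simp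
qed

text \<open>Iterating \<open>h\<close> countably often from \<open>a\<close> interleaves elements of
  all the clubs. The supremum of the iterates is below \<open>k\<close>, which is regular and
  uncountable, and is a limit of each club, hence a member of all of them.\<close>

lemma club_Inter:
  assumes k: "regular_cardinal k" "natLeq <o |{..<k}|"
    and ne: "\<C> \<noteq> {}" and small: "|\<C>| <o |{..<k}|" and clubs: "\<And>C. C \<in> \<C> \<Longrightarrow> club_in C k"
  shows "club_in (\<Inter>\<C>) k"
  unfolding club_in_def
proof (intro conjI allI impI)
  show "\<Inter>\<C> \<subseteq> {..<k}" using clubs ne unfolding club_in_def by blast
next
  fix d assume d: "d < k" "limit_ordinal d \<and> unbounded_in (\<Inter>\<C>) d"
  then have "unbounded_in C d" if "C \<in> \<C>" for C using that unfolding unbounded_in_def by blast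
  then show "d \<in> \<Inter>\<C>" using clubs d unfolding club_in_def by blast
next
  have "\<exists>e<k. b < e \<and> (\<forall>C\<in>\<C>. \<exists>c\<in>C. b \<le> c \<and> c < e)" if "b < k" for b
  proof -
    have "\<forall>C\<in>\<C>. \<exists>c\<in>C. b \<le> c \<and> c < k"
      using clubs that unfolding club_in_def unbounded_in_def by blast
    then obtain n where n: "\<And>C. C \<in> \<C> \<Longrightarrow> n C \<in> C \<and> b \<le> n C \<and> n C < k" by metis
    have "|n ` \<C>| <o |{..<k}|" using card_of_image small ordLeq_ordLess_trans by blast
    then obtain e where "e < k" "\<forall>x\<in>n ` \<C>. x < e"
      using regular_bounded[OF k(1), of "n ` \<C>"] n by blast
    then show ?thesis using n ne by (meson all_not_in_conv imageI le_less_trans)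
  qed
  then obtain h where h: "\<And>b. b < k \<Longrightarrow> h b < k \<and> b < h b \<and> (\<forall>C\<in>\<C>. \<exists>c\<in>C. b \<le> c \<and> c < h b)"
    by metis
  show "unbounded_in (\<Inter>\<C>) k"
    unfolding unbounded_in_def
  proof (intro allI impI)
    fix a assume a: "a < k"
    define s where "s n = (h ^^ n) a" for n
    have s: "s n < k" for n by (induction n) (use a h in \<open>auto simp: s_def\<close>)
    have s_Suc: "s n < s (Suc n)" "\<forall>C\<in>\<C>. \<exists>c\<in>C. s n \<le> c \<and> c < s (Suc n)" for n
      using h[OF s[of n]] by (auto simp: s_def)
    have "|range s| \<le>o natLeq"
      using card_of_image[of s UNIV] card_of_nat ordLeq_ordIso_trans by blast
    then have "|range s| <o |{..<k}|" using k(2) ordLeq_ordLess_trans by blast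
    then obtain e where e: "e < k" "\<forall>n. s n < e"
      using regular_bounded[OF k(1), of "range s"] s by blast
    \<comment> \<open>The least strict upper bound; as the iterates increase strictly, it is their
      supremum and a limit.\<close>
    define d where "d = (LEAST d. \<forall>n. s n < d)"
    have d: "\<forall>n. s n < d" "d \<le> e"
      unfolding d_def using LeastI[of "\<lambda>d. \<forall>n. s n < d", OF e(2)] Least_le[of "\<lambda>d. \<forall>n. s n < d", OF e(2)]
      by blast+
    have below: "\<exists>n. x \<le> s n" if "x < d" for x
      using not_less_Least[of x "\<lambda>d. \<forall>n. s n < d"] that unfolding d_def by (meson not_le)
    have lim: "limit_ordinal d"
      unfolding limit_ordinal_def using d(1) below s_Suc(1) by (meson le_less_trans)
    have "unbounded_in C d" if C: "C \<in> \<C>" for C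
      unfolding unbounded_in_def
    proof (intro allI impI)
      fix x assume "x < d"
      then obtain n where n: "x \<le> s n" using below by blast
      obtain c where "c \<in> C" "s n \<le> c" "c < s (Suc n)" using s_Suc(2)[of n] C by blast
      then show "\<exists>b\<in>C. x \<le> b \<and> b < d"
        using n order_trans[of x "s n" c] less_trans[of c "s (Suc n)" d] d(1) by blast
    qed
    then have "d \<in> \<Inter>\<C>" using clubs lim d(2) e(1) unfolding club_in_def by (meson InterI le_less_trans)
    moreover have "a \<le> d" using d(1) by (auto simp: s_def dest: spec[of _ 0])
    ultimately show "\<exists>b\<in>\<Inter>\<C>. a \<le> b \<and> b < k" using d(2) e(1) by (meson le_less_trans)
  qed
qed

section \<open>The cofinal sequence of regular cardinals\<close>

locale singular_sequence =
  fixes kap lam :: "'o::wellorder" and ks :: "'o \<Rightarrow> 'o"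
  assumes kap: "singular_cardinal kap"
    and lam: "lam = cof kap"
    and uncountable: "natLeq <o |{..<lam}|"
    and power_less: "\<forall>tau<kap. is_cardinal tau \<longrightarrow> |{..<tau}| ^c |{..<lam}| <o |{..<kap}|"
    and ks_strict: "\<forall>a b. a < b \<and> b < lam \<longrightarrow> ks a < ks b"
    and ks_regular: "\<forall>a<lam. regular_cardinal (ks a)"
    and ks_le_kap: "\<forall>a<lam. ks a \<le> kap"
    and ks_sup: "\<forall>u. (\<forall>a<lam. ks a \<le> u) \<longrightarrow> kap \<le> u"
begin

lemma lam_less_kap: "lam < kap"
  using kap lam by (simp add: singular_cardinal_def)

lemma infinite_lam: "infinite {..<lam}"
  using uncountable by (metis card_of_ordLeq_infinite infinite_UNIV_nat card_of_nat
      ordIso_ordLeq_trans ordLess_imp_ordLeq)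

lemma infinite_kap: "infinite {..<kap}"
  using kap by (simp add: singular_cardinal_def)

text \<open>Equality is excluded because \<open>ks a\<close> is regular and \<open>kap\<close> is
  singular.\<close>

lemma ks_less_kap: "a < lam \<Longrightarrow> ks a < kap"
  using ks_le_kap ks_regular lam lam_less_kap unfolding regular_cardinal_def
  by (metis less_irrefl order_le_less)

lemma ks_cofinal: "c < kap \<Longrightarrow> \<exists>a<lam. c < ks a"
  using ks_sup by (meson not_le)

lemma ks_mono: "a \<le> b \<Longrightarrow> b < lam \<Longrightarrow> ks a \<le> ks b"
  using ks_strict by (metis order_le_less)

lemma ks_less: "a < b \<Longrightarrow> b < lam \<Longrightarrow> ks a < ks b"
  using ks_strict by blast

lemma unbounded_image_ks:
  assumes "A \<subseteq> {..<lam}" "\<forall>d<lam. \<exists>x\<in>A. d \<le> x"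
  shows "ks ` A \<subseteq> {..<kap}" "unbounded_in (ks ` A) kap"
proof -
  show "ks ` A \<subseteq> {..<kap}" using assms(1) ks_less_kap by blast
  show "unbounded_in (ks ` A) kap"
    unfolding unbounded_in_def
  proof (intro allI impI)
    fix c assume "c < kap"
    then obtain a where a: "a < lam" "c < ks a" using ks_cofinal by blast
    then obtain x where "x \<in> A" "a \<le> x" using assms(2) by blast
    then show "\<exists>b\<in>ks ` A. c \<le> b \<and> b < kap"
      using a ks_mono[of a x] ks_less_kap[of x] assms(1) by force
  qed
qed

text \<open>Regularity of \<open>lam\<close>, which it has as a cofinality: \<open>ks\<close> would
  carry a small unbounded subset to a cofinal sequence in \<open>kap\<close> shorter than
  \<open>lam\<close>.\<close>

lemma lam_bounded:
  assumes A: "A \<subseteq> {..<lam}" and small: "|A| <o |{..<lam}|"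
  shows "\<exists>d<lam. \<forall>x\<in>A. x < d"
proof (rule ccontr)
  assume "\<not> ?thesis"
  then have unb: "\<forall>d<lam. \<exists>x\<in>A. d \<le> x" by (meson not_le)
  obtain c g where c: "c < lam" "g ` {..<c} = A" using ex_initial_segment[OF small] by blast
  have "cof kap \<le> c"
    using unbounded_image_ks[OF A unb] c(2) cof_le[of "ks \<circ> g" c kap] unfolding image_comp[symmetric] by simp
  then show False using c lam by simp
qed

text \<open>The same transfer shows that \<open>lam\<close> is a cardinal: a surjection of
  \<open>{..<d}\<close> onto \<open>{..<lam}\<close>, composed with \<open>ks\<close>, would be
  cofinal in \<open>kap\<close>.\<close>

lemma card_below_lam:
  assumes "d < lam" shows "|{..<d}| <o |{..<lam}|"
proof (rule ccontr)
  assume "\<not> ?thesis"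
  then have "|{..<lam}| \<le>o |{..<d}|" by (simp add: not_ordLess_iff_ordLeq card_of_Well_order)
  then obtain g where "g ` {..<d} = {..<lam}"
    using card_of_ordLeq2[of "{..<lam}" "{..<d}"] assms by auto
  then have "cof kap \<le> d"
    using unbounded_image_ks[of "{..<lam}"] cof_le[of "ks \<circ> g" d kap]
    unfolding image_comp[symmetric] by auto
  then show False using assms lam by simp
qed

lemma lam_ex_greater: "a < lam \<Longrightarrow> \<exists>b<lam. a < b"
  using lam_bounded[of "{a}"] infinite_lam by (auto simp: card_of_finite_ordLess_infinite)

lemma zero_less_lam: "\<exists>z<lam. \<forall>a. z \<le> a"
proof -
  obtain a where "a < lam" using infinite_lam by (metis finite.emptyI lessThan_iff subsetI subset_empty)
  then show ?thesis using Least_le[of "\<lambda>_. True"] by (meson le_less_trans)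
qed

lemma ks_eventually_greater: "\<exists>a<lam. lam < ks a"
  using ks_cofinal lam_less_kap by blast

lemma card_less_ks: "b < lam \<Longrightarrow> c < ks b \<Longrightarrow> |{..<c}| <o |{..<ks b}|"
  using ks_regular unfolding regular_cardinal_def is_cardinal_def by blast

lemma uncountable_ks:
  assumes "a < b" "b < lam" shows "natLeq <o |{..<ks b}|"
proof -
  have "infinite {..<ks a}" using assms ks_regular unfolding regular_cardinal_def by (meson less_trans)
  then have "natLeq \<le>o |{..<ks a}|" using infinite_iff_natLeq_ordLeq by blast
  then show ?thesis using card_less_ks ks_less assms ordLeq_ordLess_trans by blast
qed

end


section \<open>Nodes and trees\<close>

lemma len_eq: "dom t = {..<a} \<Longrightarrow> len t = a"
  unfolding len_def by (rule the_equality) auto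

lemma restrict_map_le: "t |` A \<subseteq>\<^sub>m t"
  by (simp add: map_le_def)

lemma restrict_below:
  fixes t :: "'o::wellorder node"
  shows "b \<le> a \<Longrightarrow> t |` {..<a} |` {..<b} = t |` {..<b}" "b < a \<Longrightarrow> t |` {..<a} |` {..b} = t |` {..b}"
  by (auto intro!: ext simp: restrict_map_def)

text \<open>Meaningful only if something lies above \<open>a\<close>, since \<open>'o\<close> may
  have a largest element; hence the assumptions \<open>a < b\<close> or \<open>a < lam\<close> in
  the lemmas about it.\<close>

definition next_ord :: "'o::wellorder \<Rightarrow> 'o" where
  "next_ord a = (LEAST b. a < b)"

lemma less_next_ord_iff: "a < b \<Longrightarrow> x < next_ord a \<longleftrightarrow> x \<le> a"
  unfolding next_ord_def
  by (metis LeastI le_less_trans not_le not_less_Least)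

lemma next_ord_le: "a < b \<Longrightarrow> next_ord a \<le> b"
  unfolding next_ord_def by (rule Least_le)

lemma lessThan_next_ord: "a < b \<Longrightarrow> {..<next_ord a} = {..a}"
  using less_next_ord_iff by blast

lemma next_ord_or_limit:
  obtains "\<And>x. \<not> x < a" | b where "b < a" "a = next_ord b" | "limit_ordinal a"
proof (cases "limit_ordinal a \<or> (\<forall>x. \<not> x < a)")
  case False
  then obtain b where "b < a" "\<forall>c<a. c \<le> b" unfolding limit_ordinal_def by (meson not_le)
  then have "a = next_ord b"
    by (meson less_next_ord_iff next_ord_le not_le order_antisym order_refl)
  then show ?thesis using that(2) \<open>b < a\<close> by blast
qed (use that in blast)

definition cone :: "'o node set \<Rightarrow> 'o node \<Rightarrow> 'o node set" where
  "cone r v = {u \<in> r. u \<subseteq>\<^sub>m v \<or> v \<subseteq>\<^sub>m u}"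

lemma cone_subset: "cone r v \<subseteq> r"
  unfolding cone_def by blast

context singular_sequence
begin

section \<open>Restriction and extension of nodes\<close>

abbreviation "N \<equiv> all_nodes lam ks"

lemma nodeI: "dom t = {..<a} \<Longrightarrow> a < lam \<Longrightarrow> (\<And>b. b < a \<Longrightarrow> \<exists>c<ks b. t b = Some c) \<Longrightarrow> t \<in> N"
  unfolding all_nodes_def by blast

lemma nodeD:
  assumes "t \<in> N"
  shows "dom t = {..<len t}" "len t < lam" "b < len t \<Longrightarrow> \<exists>c<ks b. t b = Some c"
proof -
  obtain a where a: "a < lam" "dom t = {..<a}" "\<forall>b<a. \<exists>c<ks b. t b = Some c"
    using assms unfolding all_nodes_def by blast
  then have "len t = a" using len_eq by blast
  then show "dom t = {..<len t}" "len t < lam" "b < len t \<Longrightarrow> \<exists>c<ks b. t b = Some c"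
    using a by blast+
qed

lemma node_None: "t \<in> N \<Longrightarrow> len t \<le> b \<Longrightarrow> t b = None"
  using nodeD(1)[of t] by (metis domIff lessThan_iff not_le)

lemma restrict_node:
  assumes "t \<in> N" "b \<le> len t" shows "t |` {..<b} \<in> N" "len (t |` {..<b}) = b"
proof -
  have d: "dom (t |` {..<b}) = {..<b}" using nodeD(1)[OF assms(1)] assms(2) by auto
  then show "len (t |` {..<b}) = b" using len_eq by blast
  show "t |` {..<b} \<in> N"
    using nodeD[OF assms(1)] assms(2) by (intro nodeI[OF d]) auto
qed

lemma restrict_len: "t \<in> N \<Longrightarrow> len t \<le> b \<Longrightarrow> t |` {..<b} = t"
  using nodeD(1)[of t] by (intro ext) (auto simp: restrict_map_def node_None)

lemma node_le_iff:
  assumes "s \<in> N" "t \<in> N"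
  shows "s \<subseteq>\<^sub>m t \<longleftrightarrow> len s \<le> len t \<and> t |` {..<len s} = s"
proof
  assume le: "s \<subseteq>\<^sub>m t"
  then have "{..<len s} \<subseteq> {..<len t}" using map_le_implies_dom_le nodeD(1) assms by metis
  then have l: "len s \<le> len t" by simp
  have "(t |` {..<len s}) x = s x" for x
    using le nodeD(1)[OF assms(1)] node_None[OF assms(1)] unfolding map_le_def
    by (cases "x < len s") (auto simp: restrict_map_def)
  then show "len s \<le> len t \<and> t |` {..<len s} = s" using l by blast
qed (metis restrict_map_le)

lemma node_le_len: "s \<in> N \<Longrightarrow> t \<in> N \<Longrightarrow> s \<subseteq>\<^sub>m t \<Longrightarrow> len s \<le> len t"
  using node_le_iff by blast

lemma node_le_eq: "s \<in> N \<Longrightarrow> t \<in> N \<Longrightarrow> s \<subseteq>\<^sub>m t \<Longrightarrow> len t \<le> len s \<Longrightarrow> s = t"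
  using node_le_iff[of s t] restrict_len[of t "len s"] by metis

lemma node_le_restrict: "s \<in> N \<Longrightarrow> t \<in> N \<Longrightarrow> s \<subseteq>\<^sub>m t \<Longrightarrow> s = t |` {..<len s}"
  using node_le_iff[of s t] by metis

lemma node_le_less: "s \<in> N \<Longrightarrow> t \<in> N \<Longrightarrow> s \<subseteq>\<^sub>m t \<Longrightarrow> s \<noteq> t \<Longrightarrow> len s < len t"
  using node_le_eq by (meson not_le)

lemma nodes_below_comparable:
  assumes "s \<in> N" "t \<in> N" "u \<in> N" "s \<subseteq>\<^sub>m u" "t \<subseteq>\<^sub>m u" "len s \<le> len t"
  shows "s \<subseteq>\<^sub>m t"
proof -
  have "t |` {..<len s} = u |` {..<len s}"
    using node_le_restrict[OF assms(2,3,5)] restrict_below(1)[OF assms(6)] by metis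
  then show ?thesis using node_le_iff assms by metis
qed

lemma less_next: "a < lam \<Longrightarrow> a < next_ord a" "a < lam \<Longrightarrow> next_ord a < lam"
  "a < lam \<Longrightarrow> x < next_ord a \<longleftrightarrow> x \<le> a" "a < lam \<Longrightarrow> {..<next_ord a} = {..a}"
proof -
  assume "a < lam"
  then obtain b where b: "a < b" "b < lam" using lam_ex_greater by blast
  show "a < next_ord a" "x < next_ord a \<longleftrightarrow> x \<le> a" "{..<next_ord a} = {..a}"
    using less_next_ord_iff[OF b(1)] lessThan_next_ord[OF b(1)] by simp_all
  show "next_ord a < lam" using next_ord_le[OF b(1)] b(2) by simp
qed

text \<open>Restricting to \<open>{..b}\<close> is the way to speak of the immediate successor,
  along \<open>u\<close>, of the restriction to \<open>{..<b}\<close> without mentioning a successor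
  ordinal.\<close>

lemma restrict_upto:
  assumes "u \<in> N" "b < len u"
  shows "u |` {..b} = (u |` {..<b})(b \<mapsto> the (u b))" "u |` {..b} = u |` {..<next_ord b}"
    "u |` {..b} \<in> N" "len (u |` {..b}) = next_ord b"
proof -
  have b: "b < lam" "next_ord b \<le> len u"
    using less_trans[OF assms(2) nodeD(2)[OF assms(1)]] next_ord_le[OF assms(2)] by blast+
  show eq: "u |` {..b} = u |` {..<next_ord b}" using less_next(4)[OF b(1)] by simp
  show "u |` {..b} = (u |` {..<b})(b \<mapsto> the (u b))"
    using nodeD(3)[OF assms] by (intro ext) (auto simp: restrict_map_def)
  show "u |` {..b} \<in> N" "len (u |` {..b}) = next_ord b"
    unfolding eq using restrict_node[OF assms(1) b(2)] by blast+
qed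

lemma extend_node:
  assumes "t \<in> N" "c < ks (len t)"
  shows "t(len t \<mapsto> c) \<in> N" "len (t(len t \<mapsto> c)) = next_ord (len t)"
proof -
  have d: "dom (t(len t \<mapsto> c)) = {..<next_ord (len t)}"
    using nodeD(1,2)[OF assms(1)] less_next(4) by auto
  then show "len (t(len t \<mapsto> c)) = next_ord (len t)" using len_eq by blast
  show "t(len t \<mapsto> c) \<in> N"
    using nodeD[OF assms(1)] assms(2) less_next(2,3)[of "len t"] by (intro nodeI[OF d]) auto
qed

lemma extend_restrict:
  assumes "t \<in> N"
  shows "b \<le> len t \<Longrightarrow> (t(len t \<mapsto> c)) |` {..<b} = t |` {..<b}"
    "b < len t \<Longrightarrow> (t(len t \<mapsto> c)) |` {..b} = t |` {..b}"
    "(t(len t \<mapsto> c)) |` {..len t} = t(len t \<mapsto> c)" "t \<subseteq>\<^sub>m t(len t \<mapsto> c)"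
  using node_None[OF assms] nodeD(1)[OF assms] by (auto intro!: ext simp: restrict_map_def map_le_def)

lemma OSucc_subset:
  assumes "T \<subseteq> N" "t \<in> N" shows "OSucc T t \<subseteq> {..<ks (len t)}"
proof
  fix c assume "c \<in> OSucc T t"
  then have u: "t(len t \<mapsto> c) \<in> N" using assms unfolding OSucc_def by blast
  have "len t \<in> dom (t(len t \<mapsto> c))" by simp
  then have "len t < len (t(len t \<mapsto> c))" using nodeD(1)[OF u] by (metis lessThan_iff)
  then show "c \<in> {..<ks (len t)}" using nodeD(3)[OF u] by fastforce
qed

lemma OSucc_mono: "r \<subseteq> r' \<Longrightarrow> OSucc r t \<subseteq> OSucc r' t"
  unfolding OSucc_def by blast

section \<open>Trees, successor sets and unions of chains\<close>

lemma treeD: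
  assumes "is_tree lam ks T"
  shows "T \<subseteq> N" "t \<in> T \<Longrightarrow> s \<in> N \<Longrightarrow> s \<subseteq>\<^sub>m t \<Longrightarrow> s \<in> T" "T \<noteq> {}" "t \<in> T \<Longrightarrow> t |` {..<b} \<in> T"
    "t \<in> T \<Longrightarrow> t |` {..b} \<in> T" "Map.empty \<in> T"
proof -
  show TN: "T \<subseteq> N" and cl: "t \<in> T \<Longrightarrow> s \<in> N \<Longrightarrow> s \<subseteq>\<^sub>m t \<Longrightarrow> s \<in> T" and ne: "T \<noteq> {}" for s t
    using assms unfolding is_tree_def by blast+
  show r: "t \<in> T \<Longrightarrow> t |` {..<b} \<in> T" for t b
    using restrict_len[of t b] restrict_node(1)[of t b] TN cl restrict_map_le by (metis linear subsetD)
  show "t \<in> T \<Longrightarrow> t |` {..b} \<in> T"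
  proof -
    assume t: "t \<in> T"
    show "t |` {..b} \<in> T"
    proof (cases "b < lam")
      case True then show ?thesis using r[OF t, of "next_ord b"] less_next(4) by simp
    next
      case False
      then have "t |` {..b} = t"
        using nodeD(1,2)[of t] t TN node_None[of t] by (intro ext) (force simp: restrict_map_def)
      then show ?thesis using t by simp
    qed
  qed
  obtain z where z: "z < lam" "\<forall>a. z \<le> a" using zero_less_lam by blast
  then have "{..<z} = {}" using not_less by blast
  moreover obtain t where "t \<in> T" using ne by blast
  ultimately show "Map.empty \<in> T" using r[of t z] by (simp add: restrict_map_def)
qed

lemma OSucc_toward:
  assumes T: "is_tree lam ks T" and u: "u \<in> T" and t: "t \<in> N" "t \<subseteq>\<^sub>m u" "t \<noteq> u"
  shows "the (u (len t)) \<in> OSucc T t" "t(len t \<mapsto> the (u (len t))) = u |` {..len t}"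
    "t(len t \<mapsto> the (u (len t))) \<subseteq>\<^sub>m u"
proof -
  have uN: "u \<in> N" using treeD(1)[OF T] u by blast
  have l: "len t < len u" using node_le_less t uN by blast
  show eq: "t(len t \<mapsto> the (u (len t))) = u |` {..len t}"
    using restrict_upto(1)[OF uN l] node_le_restrict[OF t(1) uN t(2)] by metis
  then show "t(len t \<mapsto> the (u (len t))) \<subseteq>\<^sub>m u" by (simp add: restrict_map_le)
  show "the (u (len t)) \<in> OSucc T t" using eq treeD(5)[OF T u] unfolding OSucc_def by simp
qed

lemma upd_inject: "t \<in> N \<Longrightarrow> t(len t \<mapsto> c) = t(len t \<mapsto> c') \<Longrightarrow> c = c'"
  by (meson map_upd_eqD1)

lemma Succ_eq:
  assumes T: "is_tree lam ks T" and t: "t \<in> T"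
  shows "Succ T t = (\<lambda>c. t(len t \<mapsto> c)) ` OSucc T t"
proof (intro equalityI subsetI)
  have tN: "t \<in> N" using treeD(1)[OF T] t by blast
  fix u assume "u \<in> Succ T t"
  then have u: "u \<in> T" "t \<subseteq>\<^sub>m u" "u \<noteq> t" "\<And>v. v \<in> T \<Longrightarrow> t \<subseteq>\<^sub>m v \<Longrightarrow> v \<subseteq>\<^sub>m u \<Longrightarrow> v = t \<or> v = u"
    unfolding Succ_def by blast+
  let ?v = "t(len t \<mapsto> the (u (len t)))"
  have v: "the (u (len t)) \<in> OSucc T t" "?v \<subseteq>\<^sub>m u"
    using OSucc_toward[OF T u(1) tN u(2)] u(3) by blast+
  have "?v \<noteq> t" using node_None[OF tN] by (metis fun_upd_same option.distinct(1) order_refl)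
  moreover have "?v \<in> T" using v(1) unfolding OSucc_def by simp
  ultimately have "u = ?v" using u(4)[of ?v] v(2) extend_restrict(4)[OF tN] by metis
  then show "u \<in> (\<lambda>c. t(len t \<mapsto> c)) ` OSucc T t" using v by blast
next
  have tN: "t \<in> N" using treeD(1)[OF T] t by blast
  fix u assume "u \<in> (\<lambda>c. t(len t \<mapsto> c)) ` OSucc T t"
  then obtain c where c: "c \<in> OSucc T t" "u = t(len t \<mapsto> c)" by blast
  have ck: "c < ks (len t)" using OSucc_subset[OF treeD(1)[OF T] tN] c by blast
  have uN: "u \<in> N" "len u = next_ord (len t)" using extend_node[OF tN ck] c by blast+
  have "v = t \<or> v = u" if v: "v \<in> T" "t \<subseteq>\<^sub>m v" "v \<subseteq>\<^sub>m u" for v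
  proof (cases "v = t")
    case False
    have vN: "v \<in> N" using treeD(1)[OF T] v by blast
    then have "len t < len v" using node_le_less tN v False by blast
    then have "len u \<le> len v" using uN next_ord_le by simp
    then show ?thesis using node_le_eq[OF vN uN(1) v(3)] by blast
  qed blast
  moreover have "u \<noteq> t" using c node_None[OF tN] by (metis fun_upd_same option.distinct(1) order_refl)
  ultimately show "u \<in> Succ T t"
    using c extend_restrict(4)[OF tN] unfolding Succ_def OSucc_def by blast
qed

lemma card_Succ:
  assumes T: "is_tree lam ks T" and t: "t \<in> T" shows "|Succ T t| =o |OSucc T t|"
proof -
  have "inj_on (\<lambda>c. t(len t \<mapsto> c)) (OSucc T t)"
    using upd_inject treeD(1)[OF T] t by (blast intro: inj_onI)
  then show ?thesis unfolding Succ_eq[OF assms]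
    using card_of_ordIso inj_on_imp_bij_betw ordIso_symmetric by metis
qed

text \<open>The union of the chain. It is short enough to be a node because \<open>lam\<close> is
  regular; the last clause says that it is no longer than the chain requires.\<close>

lemma join_exists:
  assumes C: "C \<subseteq> N" "C \<noteq> {}" "\<And>s t. s \<in> C \<Longrightarrow> t \<in> C \<Longrightarrow> s \<subseteq>\<^sub>m t \<or> t \<subseteq>\<^sub>m s"
    and small: "|C| <o |{..<lam}|"
  obtains u where "u \<in> N" "\<And>t. t \<in> C \<Longrightarrow> t \<subseteq>\<^sub>m u" "\<And>b. b < len u \<Longrightarrow> \<exists>t\<in>C. b < len t"
proof -
  have "|len ` C| <o |{..<lam}|" using card_of_image small ordLeq_ordLess_trans by blast
  then obtain d where d: "d < lam" "\<forall>t\<in>C. len t < d"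
    using lam_bounded[of "len ` C"] C(1) nodeD(2) by blast
  \<comment> \<open>The supremum of the lengths may be attained, and then the join belongs to
    \<open>C\<close>. This is why users of the lemma treat that case separately.\<close>
  define a where "a = (LEAST a. \<forall>t\<in>C. len t \<le> a)"
  have d': "\<forall>t\<in>C. len t \<le> d" using d by (meson less_imp_le)
  have a: "\<forall>t\<in>C. len t \<le> a" "a \<le> d"
    using LeastI[of "\<lambda>a. \<forall>t\<in>C. len t \<le> a", OF d'] Least_le[of "\<lambda>a. \<forall>t\<in>C. len t \<le> a", OF d']
    unfolding a_def by blast+
  have below: "\<exists>t\<in>C. b < len t" if "b < a" for b
    using not_less_Least[of b "\<lambda>a. \<forall>t\<in>C. len t \<le> a"] that unfolding a_def by (meson not_le)
  define u where "u b = (if b < a then (SOME t. t \<in> C \<and> b < len t) b else None)" for b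
  have u: "u b = t b" if "t \<in> C" "b < len t" for t b
  proof -
    have ba: "b < a" using that a(1) by (meson less_le_trans)
    define s where "s = (SOME t. t \<in> C \<and> b < len t)"
    have s: "s \<in> C" "b < len s" using someI[of "\<lambda>t. t \<in> C \<and> b < len t" t] that unfolding s_def by blast+
    have "b \<in> dom s" "b \<in> dom t" using nodeD(1) C(1) s that by blast+
    then have "s b = t b" using C(3)[OF s(1) that(1)] unfolding map_le_def by metis
    then show ?thesis using ba unfolding u_def s_def by simp
  qed
  have val: "\<exists>c<ks b. u b = Some c" if "b < a" for b
    using below[OF that] u nodeD(3) C(1) by (metis subsetD)
  have dom: "dom u = {..<a}"
  proof (intro equalityI subsetI)
    fix b assume "b \<in> dom u" then show "b \<in> {..<a}" unfolding u_def by (auto split: if_splits)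
  next
    fix b assume "b \<in> {..<a}" then show "b \<in> dom u" using val[of b] by auto
  qed
  have "u \<in> N" using nodeI[OF dom] val a d by simp
  moreover have "t \<subseteq>\<^sub>m u" if "t \<in> C" for t
    using u[OF that] nodeD(1) that C(1) unfolding map_le_def by (metis lessThan_iff subsetD)
  ultimately show ?thesis using that below len_eq[OF dom] by metis
qed

section \<open>Cones\<close>

lemma cone_tree:
  assumes T: "is_tree lam ks T" and v: "v \<in> T" shows "is_tree lam ks (cone T v)"
proof -
  have vN: "v \<in> N" using treeD(1)[OF T] v by blast
  have "s \<in> cone T v" if t: "t \<in> cone T v" and s: "s \<in> N" "s \<subseteq>\<^sub>m t" for s t
  proof -
    have t': "t \<in> T" "t \<in> N" "t \<subseteq>\<^sub>m v \<or> v \<subseteq>\<^sub>m t" using t treeD(1)[OF T] unfolding cone_def by blast+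
    then have "s \<subseteq>\<^sub>m v \<or> v \<subseteq>\<^sub>m s"
      using s vN nodes_below_comparable[OF s(1) vN t'(2) s(2)] nodes_below_comparable[OF vN s(1) t'(2) _ s(2)]
        map_le_trans[OF s(2)] by (metis linear)
    then show ?thesis using treeD(2)[OF T t'(1) s] unfolding cone_def by blast
  qed
  moreover have "v \<in> cone T v" using v unfolding cone_def by simp
  ultimately show ?thesis using treeD(1)[OF T] unfolding is_tree_def cone_def by blast
qed

lemma OSucc_cone:
  assumes T: "is_tree lam ks T" and v: "v \<in> T" "t \<in> N" "v \<subseteq>\<^sub>m t"
  shows "OSucc (cone T v) t = OSucc T t"
  unfolding OSucc_def cone_def
  using map_le_trans[OF v(3) extend_restrict(4)[OF v(2)]] by blast

lemma OSucc_cone_below: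
  assumes T: "is_tree lam ks T" and v: "v \<in> T" "t \<in> N" "t \<subseteq>\<^sub>m v" "t \<noteq> v"
  shows "OSucc (cone T v) t = {the (v (len t))}"
proof -
  have vN: "v \<in> N" using treeD(1)[OF T] v by blast
  have l: "len t < len v" using node_le_less v vN by blast
  have "c = the (v (len t))" if "c \<in> OSucc (cone T v) t" for c
  proof -
    have u: "t(len t \<mapsto> c) \<in> T" "t(len t \<mapsto> c) \<subseteq>\<^sub>m v \<or> v \<subseteq>\<^sub>m t(len t \<mapsto> c)"
      using that unfolding OSucc_def cone_def by blast+
    have "len t \<in> dom v" "len t \<in> dom (t(len t \<mapsto> c))" using l nodeD(1)[OF vN] by auto
    then have "v (len t) = (t(len t \<mapsto> c)) (len t)" using u(2) unfolding map_le_def by metis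
    then show ?thesis by simp
  qed
  moreover have "v \<in> cone T v" using v unfolding cone_def by simp
  then have "the (v (len t)) \<in> OSucc (cone T v) t"
    using OSucc_toward(1)[OF cone_tree[OF T v(1)] _ v(2-4)] by blast
  ultimately show ?thesis by blast
qed

end


section \<open>Laver trees\<close>

context singular_sequence
begin

section \<open>Counting the nodes\<close>

lemma card_nodes_of_len:
  assumes a: "a < lam" shows "|{t \<in> N. len t = a}| \<le>o |{..<kap}|"
proof -
  obtain z :: 'o where z: "\<forall>b. z \<le> b" using zero_less_lam by blast
  have "{..<ks a} \<noteq> {}" using a ks_regular unfolding regular_cardinal_def by (metis finite.emptyI)
  then have za: "z < ks a" using z by (metis all_not_in_conv lessThan_iff le_less_trans)
  \<comment> \<open>Padding by the least ordinal turns a node of length \<open>a\<close> into a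
    function from \<open>lam\<close> to \<open>ks a\<close>; the value \<open>undefined\<close>
    outside \<open>lam\<close> is what \<open>Func\<close> prescribes. There are fewer than
    \<open>kap\<close> such functions by \<open>power_less\<close>.\<close>
  let ?h = "\<lambda>t b. if b < lam then if b < a then the (t b) else z else undefined"
  have val: "\<exists>c<ks a. t b = Some c" if "t \<in> N" "len t = a" "b < a" for t b
    using nodeD(3)[of t b] that ks_mono[of b a] a by (metis less_imp_le less_le_trans)
  have "?h ` {t \<in> N. len t = a} \<subseteq> Func {..<lam} {..<ks a}"
    unfolding Func_def using val za by force
  moreover have "inj_on ?h {t \<in> N. len t = a}"
  proof (rule inj_onI)
    fix s t assume s: "s \<in> {t \<in> N. len t = a}" and t: "t \<in> {t \<in> N. len t = a}" and eq: "?h s = ?h t"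
    have "s b = t b" for b
    proof (cases "b < a")
      case True
      then have "the (s b) = the (t b)" using fun_cong[OF eq, of b] less_trans[OF True a] by simp
      then show ?thesis using val[of s b] val[of t b] s t True by auto
    next
      case False then show ?thesis using node_None[of s b] node_None[of t b] s t by auto
    qed
    then show "s = t" by blast
  qed
  ultimately have "|{t \<in> N. len t = a}| \<le>o |{..<ks a}| ^c |{..<lam}|"
    unfolding cexp_def Field_card_of using card_of_ordLeq by blast
  moreover have "|{..<ks a}| ^c |{..<lam}| <o |{..<kap}|"
    using power_less ks_less_kap[OF a] ks_regular a unfolding regular_cardinal_def by blast
  ultimately show ?thesis using ordLeq_ordLess_trans ordLess_imp_ordLeq by blast
qed

lemma card_lam_kap: "|{..<lam}| \<le>o |{..<kap}|"
  using lam_less_kap by (intro card_of_mono1) auto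

lemma card_all_nodes: "|N| \<le>o |{..<kap}|"
proof -
  have "N = (\<Union>a\<in>{..<lam}. {t \<in> N. len t = a})" using nodeD(2) by auto
  moreover have "|\<Union>a\<in>{..<lam}. {t \<in> N. len t = a}| \<le>o |{..<kap}|"
    by (rule card_of_UNION_ordLeq_infinite[OF infinite_kap card_lam_kap]) (simp add: card_nodes_of_len)
  ultimately show ?thesis by simp
qed

lemma card_node_values: "|\<Union>a\<in>{..<lam}. v a ` N| \<le>o |{..<kap}|"
  by (rule card_of_UNION_ordLeq_infinite[OF infinite_kap card_lam_kap])
    (simp add: ordLeq_transitive[OF card_of_image card_all_nodes])

lemma limit_closed:
  assumes "lt_closed lam T" "u \<in> N" "limit_ordinal (len u)" "\<And>b. b < len u \<Longrightarrow> u |` {..<b} \<in> T"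
  shows "u \<in> T"
  using assms nodeD unfolding lt_closed_def by blast

text \<open>Limits need checking only for maps already known to be nodes: below a limit every value
  occurs in a proper restriction, which lies in \<open>T\<close>.\<close>

lemma lt_closedI:
  assumes T: "T \<subseteq> N" "\<And>t. t \<in> T \<Longrightarrow> OSucc T t \<noteq> {}"
    and lim: "\<And>u. u \<in> N \<Longrightarrow> limit_ordinal (len u) \<Longrightarrow> (\<And>b. b < len u \<Longrightarrow> u |` {..<b} \<in> T) \<Longrightarrow> u \<in> T"
  shows "lt_closed lam T"
  unfolding lt_closed_def
proof (intro conjI allI impI ballI)
  fix t assume t: "t \<in> T"
  then obtain c where c: "t(len t \<mapsto> c) \<in> T" using T(2) unfolding OSucc_def by blast
  have tN: "t \<in> N" using t T by blast
  have "t(len t \<mapsto> c) \<noteq> t" using node_None[OF tN] by (metis fun_upd_same option.distinct(1) order_refl)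
  then show "\<exists>u\<in>T. t \<subseteq>\<^sub>m u \<and> u \<noteq> t" using c extend_restrict(4)[OF tN] by blast
next
  fix d and f :: "'o node"
  assume d: "d < lam" and f: "limit_ordinal d \<and> dom f = {..<d} \<and> (\<forall>b<d. f |` {..<b} \<in> T)"
  have "\<exists>c<ks b. f b = Some c" if b: "b < d" for b
  proof -
    obtain b' where b': "b < b'" "b' < d" using f b unfolding limit_ordinal_def by blast
    then have g: "f |` {..<b'} \<in> N" using f T by blast
    have "dom (f |` {..<b'}) = {..<b'}" using f b' by auto
    then have "len (f |` {..<b'}) = b'" using len_eq by blast
    then show ?thesis using nodeD(3)[OF g, of b] b' by simp
  qed
  then have "f \<in> N" using nodeI d f by blast
  moreover have "len f = d" using f len_eq by blast
  ultimately show "f \<in> T" using lim[of f] f by simp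
qed

lemma OSucc_nonempty:
  assumes T: "is_tree lam ks T" "lt_closed lam T" and t: "t \<in> T" shows "OSucc T t \<noteq> {}"
proof -
  obtain u where "u \<in> T" "t \<subseteq>\<^sub>m u" "u \<noteq> t" using assms unfolding lt_closed_def by blast
  then show ?thesis using OSucc_toward(1)[OF T(1), of u t] treeD(1)[OF T(1)] t by blast
qed

lemma cone_lt_closed:
  assumes T: "is_tree lam ks T" "lt_closed lam T" and v: "v \<in> T"
  shows "lt_closed lam (cone T v)"
proof (rule lt_closedI)
  note TN = treeD(1)[OF T(1)]
  show "cone T v \<subseteq> N" using TN unfolding cone_def by blast
  show "OSucc (cone T v) t \<noteq> {}" if "t \<in> cone T v" for t
  proof (cases "v \<subseteq>\<^sub>m t")
    case True
    then show ?thesis using OSucc_cone[OF T(1) v _ True] OSucc_nonempty[OF T] that TN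
      unfolding cone_def by blast
  next
    case False
    then show ?thesis using OSucc_cone_below[OF T(1) v, of t] that TN unfolding cone_def by auto
  qed
next
  fix u assume u: "u \<in> N" "limit_ordinal (len u)" "\<And>b. b < len u \<Longrightarrow> u |` {..<b} \<in> cone T v"
  have "u \<in> T" using limit_closed[OF T(2) u(1,2)] u(3) unfolding cone_def by blast
  moreover have "u \<subseteq>\<^sub>m v \<or> v \<subseteq>\<^sub>m u"
  proof (cases "\<exists>b<len u. v \<subseteq>\<^sub>m u |` {..<b}")
    case True then show ?thesis using map_le_trans restrict_map_le by blast
  next
    case False
    then have below: "u |` {..<b} \<subseteq>\<^sub>m v" if "b < len u" for b using u(3)[OF that] that unfolding cone_def by blast
    have "u x = v x" if x: "x \<in> dom u" for x
    proof -
      obtain b where b: "x < b" "b < len u"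
        using x u(2) nodeD(1)[OF u(1)] unfolding limit_ordinal_def by blast
      then have "x \<in> dom (u |` {..<b})" using x by simp
      then have "(u |` {..<b}) x = v x" using below[OF b(2)] unfolding map_le_def by blast
      then show ?thesis using b(1) by simp
    qed
    then show ?thesis unfolding map_le_def by blast
  qed
  ultimately show "u \<in> cone T v" unfolding cone_def by blast
qed

text \<open>An unbounded subset of a regular cardinal has full size, and all successors of
  \<open>t\<close> take values below \<open>ks (len t)\<close>.\<close>

lemma card_Succ_club_splitting:
  assumes p: "is_tree lam ks p" and t: "t \<in> p" and sp: "club_splitting ks p (len t) t"
  shows "|Succ p t| =o |{..<ks (len t)}|"
proof -
  have tN: "t \<in> N" using treeD(1)[OF p] t by blast
  obtain C where C: "club_in C (ks (len t))" "C \<subseteq> OSucc p t" using sp unfolding club_splitting_def by blast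
  have "|{..<ks (len t)}| \<le>o |C|"
    using card_unbounded ks_regular nodeD(2)[OF tN] C(1) unfolding club_in_def by blast
  then have "|{..<ks (len t)}| \<le>o |OSucc p t|" using card_of_mono1[OF C(2)] ordLeq_transitive by blast
  moreover have "|OSucc p t| \<le>o |{..<ks (len t)}|"
    using card_of_mono1[OF OSucc_subset[OF treeD(1)[OF p] tN]] .
  ultimately have "|OSucc p t| =o |{..<ks (len t)}|" by (simp add: ordIso_iff_ordLeq)
  then show ?thesis using card_Succ[OF p t] ordIso_transitive by blast
qed

section \<open>Conditions with a given stem\<close>

definition laver_stem :: "'o node set \<Rightarrow> 'o node \<Rightarrow> bool" where
  "laver_stem p s \<longleftrightarrow> is_tree lam ks p \<and> lt_closed lam p \<and> s \<in> p \<and> (\<forall>t\<in>p. s \<subseteq>\<^sub>m t \<or> t \<subseteq>\<^sub>m s) \<and>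
     (\<forall>t\<in>p. s \<subseteq>\<^sub>m t \<longrightarrow> club_splitting ks p (len t) t)"

lemma L_club_iff: "p \<in> L_club lam ks \<longleftrightarrow> (\<exists>s. laver_stem p s)"
  using card_Succ_club_splitting unfolding L_club_def laver_stem_def mem_Collect_eq by meson

lemma laver_stem_cone:
  assumes "laver_stem p s" "t \<in> p" "s \<subseteq>\<^sub>m t" shows "laver_stem (cone p t) t"
proof -
  have p: "is_tree lam ks p" "lt_closed lam p" using assms(1) unfolding laver_stem_def by blast+
  have "club_splitting ks (cone p t) (len u) u" if "u \<in> cone p t" "t \<subseteq>\<^sub>m u" for u
  proof -
    have "u \<in> p" using that unfolding cone_def by blast
    moreover have "u \<in> N" using \<open>u \<in> p\<close> treeD(1)[OF p(1)] by blast
    ultimately show ?thesis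
      using OSucc_cone[OF p(1) assms(2) _ that(2)] assms(1) map_le_trans[OF assms(3) that(2)]
      unfolding laver_stem_def club_splitting_def by simp
  qed
  then show ?thesis
    using cone_tree[OF p(1) assms(2)] cone_lt_closed[OF p assms(2)] assms(2)
    unfolding laver_stem_def by (auto simp: cone_def)
qed

lemma OSucc_Int: "OSucc (p \<inter> q) t = OSucc p t \<inter> OSucc q t"
  unfolding OSucc_def by blast

text \<open>The stem has to be nonempty because \<open>ks\<close> may start with \<open>\<omega>\<close>, where clubs may be disjoint.\<close>

lemma laver_stem_Int:
  assumes p: "laver_stem p s" and q: "laver_stem q s" and a: "a < len s"
  shows "laver_stem (p \<inter> q) s"
proof -
  have pt: "is_tree lam ks p" "lt_closed lam p" and qt: "is_tree lam ks q" "lt_closed lam q"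
    and s: "s \<in> p" "s \<in> q"
    using p q unfolding laver_stem_def by blast+
  note pN = treeD(1)[OF pt(1)]
  have tree: "is_tree lam ks (p \<inter> q)" using pt(1) qt(1) s unfolding is_tree_def by blast
  have sN: "s \<in> N" using s pN by blast
  have split: "club_splitting ks (p \<inter> q) (len t) t" if t: "t \<in> p \<inter> q" "s \<subseteq>\<^sub>m t" for t
  proof -
    have tN: "t \<in> N" using t pN by blast
    have "a < len t" using a node_le_len[OF sN tN t(2)] by simp
    then have unc: "natLeq <o |{..<ks (len t)}|" using uncountable_ks nodeD(2)[OF tN] by blast
    have reg: "regular_cardinal (ks (len t))" using ks_regular nodeD(2)[OF tN] by blast
    obtain C D where C: "club_in C (ks (len t))" "C \<subseteq> OSucc p t" and D: "club_in D (ks (len t))" "D \<subseteq> OSucc q t"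
      using p q t unfolding laver_stem_def club_splitting_def by blast
    have "|{C, D}| <o |{..<ks (len t)}|"
      using reg unfolding regular_cardinal_def by (intro card_of_finite_ordLess_infinite) auto
    then have "club_in (\<Inter>{C, D}) (ks (len t))" using club_Inter[OF reg unc, of "{C, D}"] C D by blast
    moreover have "\<Inter>{C, D} \<subseteq> OSucc (p \<inter> q) t" using C D unfolding OSucc_Int by blast
    ultimately show ?thesis unfolding club_splitting_def by blast
  qed
  have "lt_closed lam (p \<inter> q)"
  proof (rule lt_closedI)
    show "p \<inter> q \<subseteq> N" using pN by blast
    show "OSucc (p \<inter> q) t \<noteq> {}" if t: "t \<in> p \<inter> q" for t
    proof (cases "s \<subseteq>\<^sub>m t")
      case True
      have tN: "t \<in> N" using t pN by blast
      then have "\<exists>c. c < ks (len t)" using ks_regular nodeD(2)[OF tN] unfolding regular_cardinal_def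
        by (metis finite.emptyI lessThan_iff subset_eq subset_empty)
      then show ?thesis
        using split[OF t True] unfolding club_splitting_def club_in_def unbounded_in_def by blast
    next
      case False
      then have "t \<subseteq>\<^sub>m s" "t \<noteq> s" using p t unfolding laver_stem_def by auto
      then show ?thesis using OSucc_toward(1)[OF tree, of s t] s t pN by blast
    qed
    show "u \<in> p \<inter> q" if "u \<in> N" "limit_ordinal (len u)" "\<And>b. b < len u \<Longrightarrow> u |` {..<b} \<in> p \<inter> q" for u
      using that limit_closed[OF pt(2)] limit_closed[OF qt(2)] by blast
  qed
  then show ?thesis using tree split s p unfolding laver_stem_def by blast
qed

lemma laver_values:
  assumes mono: "\<And>\<alpha> \<nu> r r'. D \<alpha> \<nu> r \<Longrightarrow> r' \<subseteq> r \<Longrightarrow> D \<alpha> \<nu> r'"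
    and dense: "\<And>\<alpha> r. \<alpha> < lam \<Longrightarrow> r \<in> L_club lam ks \<Longrightarrow> r \<subseteq> p \<Longrightarrow>
      \<exists>r'\<in>L_club lam ks. r' \<subseteq> r \<and> (\<exists>\<nu>::'o. D \<alpha> \<nu> r')"
  shows "\<exists>X. |X| \<le>o |{..<kap}| \<and> (\<forall>r\<in>L_club lam ks. r \<subseteq> p \<longrightarrow> (\<forall>\<alpha><lam.
      \<exists>r'\<in>L_club lam ks. r' \<subseteq> r \<and> (\<exists>\<nu>\<in>X. D \<alpha> \<nu> r')))"
proof -
  define v where "v \<alpha> t = (SOME \<nu>. \<exists>r. laver_stem r t \<and> D \<alpha> \<nu> r)" for \<alpha> t
  let ?X = "\<Union>\<alpha>\<in>{..<lam}. v \<alpha> ` N"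
  have "\<exists>r'\<in>L_club lam ks. r' \<subseteq> r \<and> (\<exists>\<nu>\<in>?X. D \<alpha> \<nu> r')"
    if r: "r \<in> L_club lam ks" "r \<subseteq> p" and \<alpha>: "\<alpha> < lam" for r \<alpha>
  proof -
    obtain r1 \<nu> where r1: "r1 \<in> L_club lam ks" "r1 \<subseteq> r" "D \<alpha> \<nu> r1" using dense[OF \<alpha> r] by blast
    then obtain s where s: "laver_stem r1 s" using L_club_iff by blast
    then have T: "is_tree lam ks r1" "lt_closed lam r1" "s \<in> r1" unfolding laver_stem_def by blast+
    note N = treeD(1)[OF T(1)]
    \<comment> \<open>Moving to a proper extension of the stem makes the new stem nonempty, as
      compatibility requires.\<close>
    obtain t where t: "t \<in> r1" "s \<subseteq>\<^sub>m t" "t \<noteq> s" using T unfolding lt_closed_def by blast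
    have tN: "t \<in> N" "s \<in> N" using N t T by blast+
    have l: "len s < len t" using node_le_less tN t by blast
    have st: "laver_stem (cone r1 t) t" using laver_stem_cone[OF s t(1,2)] .
    have "D \<alpha> \<nu> (cone r1 t)" using mono[OF r1(3) cone_subset] .
    then have "\<exists>\<nu>. \<exists>r. laver_stem r t \<and> D \<alpha> \<nu> r" using st by blast
    \<comment> \<open>The value \<nu> decided by \<open>r1\<close> is not compared with the chosen
      one: the intersection of the two conditions lies below \<open>r2\<close> and so decides the
      value that depends on the argument and the stem alone.\<close>
    from someI_ex[OF this] obtain r2 where r2: "laver_stem r2 t" "D \<alpha> (v \<alpha> t) r2"
      unfolding v_def by blast
    have "laver_stem (cone r1 t \<inter> r2) t" using laver_stem_Int[OF st r2(1) l] .
    then have "cone r1 t \<inter> r2 \<in> L_club lam ks" using L_club_iff by blast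
    moreover have "cone r1 t \<inter> r2 \<subseteq> r" using r1 unfolding cone_def by blast
    moreover have "D \<alpha> (v \<alpha> t) (cone r1 t \<inter> r2)" using mono[OF r2(2) Int_lower2] .
    ultimately show ?thesis using \<alpha> tN(1) by blast
  qed
  then show ?thesis using card_node_values[of v] by (intro exI[of _ ?X] conjI ballI impI allI)
qed

end


section \<open>Normal trees\<close>

text \<open>From level \<open>a0\<close> on the cardinals exceed \<open>lam\<close>. There fewer
  than \<open>lam\<close> many clubs meet in a club, and the values of \<open>ks\<close> at smaller
  indices are bounded.\<close>

locale large_sequence = singular_sequence kap lam ks
  for kap lam :: "'o::wellorder" and ks +
  fixes a0 :: 'o
  assumes a0: "a0 < lam" "lam < ks a0"
begin

lemma card_lam_less_ks: "a0 \<le> a \<Longrightarrow> a < lam \<Longrightarrow> |{..<lam}| <o |{..<ks a}|"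
  using a0 ks_mono[of a0 a] card_less_ks[of a lam] by (meson less_le_trans)

lemma uncountable_large_ks: "a0 \<le> a \<Longrightarrow> a < lam \<Longrightarrow> natLeq <o |{..<ks a}|"
  using card_lam_less_ks uncountable ordLess_transitive by blast

text \<open>Trimming the successors makes the index at which a node splits unique.\<close>

definition splits :: "'o node set \<Rightarrow> 'o node \<Rightarrow> bool" where
  "splits r t \<longleftrightarrow> t \<in> r \<and> a0 \<le> len t \<and> (\<forall>c\<in>OSucc r t. \<forall>b<len t. ks b \<le> c) \<and>
     club_splitting ks r (len t) t"

text \<open>The last clause is the closure condition of \<open>scl_M_club\<close> with every
  splitting node indexed by its own length. Asking for \<open>u\<close> in \<open>N\<close> only is
  harmless because the tree is closed under limits.\<close>

definition normal_tree :: "'o node set \<Rightarrow> bool" where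
  "normal_tree r \<longleftrightarrow> is_tree lam ks r \<and> lt_closed lam r \<and>
     (\<forall>t\<in>r. splits r t \<or> (\<exists>!c. c \<in> OSucc r t)) \<and>
     (\<forall>t\<in>r. \<exists>u. splits r u \<and> t \<subseteq>\<^sub>m u) \<and>
     (\<forall>u\<in>N. limit_ordinal (len u) \<and> unbounded_in {b. splits r (u |` {..<b})} (len u) \<longrightarrow> splits r u)"

lemma normal_treeD:
  assumes "normal_tree r"
  shows "is_tree lam ks r" "lt_closed lam r" "r \<subseteq> N"
    "t \<in> r \<Longrightarrow> \<not> splits r t \<Longrightarrow> \<exists>!c. c \<in> OSucc r t"
    "t \<in> r \<Longrightarrow> \<exists>u. splits r u \<and> t \<subseteq>\<^sub>m u"
    "u \<in> N \<Longrightarrow> limit_ordinal (len u) \<Longrightarrow> unbounded_in {b. splits r (u |` {..<b})} (len u) \<Longrightarrow> splits r u"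
  using assms treeD(1) unfolding normal_tree_def by blast+

lemma splits_mem: "splits r t \<Longrightarrow> t \<in> r"
  unfolding splits_def by blast

lemma splits_cong: "OSucc r t = OSucc r' t \<Longrightarrow> t \<in> r' \<Longrightarrow> splits r t \<Longrightarrow> splits r' t"
  unfolding splits_def club_splitting_def by simp

lemma club_splitting_other:
  assumes "a < lam" "club_splitting ks r a t" shows "\<exists>c\<in>OSucc r t. c \<noteq> x"
proof -
  have reg: "regular_cardinal (ks a)" using ks_regular assms by blast
  obtain C where C: "club_in C (ks a)" "C \<subseteq> OSucc r t" using assms unfolding club_splitting_def by blast
  obtain y where "y < ks a" using reg unfolding regular_cardinal_def
    by (metis finite.emptyI lessThan_iff subset_eq subset_empty)
  then obtain c where c: "c \<in> C" using club_ex_greater[OF reg C(1)] by blast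
  then have "c < ks a" using C unfolding club_in_def by blast
  then obtain c' where "c' \<in> C" "c < c'" using club_ex_greater[OF reg C(1)] by blast
  then show ?thesis using c C by (metis less_irrefl subsetD)
qed

lemma splits_other:
  assumes "splits r t" "r \<subseteq> N" shows "\<exists>c\<in>OSucc r t. c \<noteq> x"
proof -
  have "len t < lam" using assms nodeD(2) unfolding splits_def by blast
  then show ?thesis using club_splitting_other assms unfolding splits_def by blast
qed

text \<open>A node of \<open>r'\<close> that does not split has a single successor, too few for a
  node that splits in \<open>r\<close>. Only this dichotomy lets the trimming condition pass to the
  larger tree.\<close>

lemma splits_mono:
  assumes r': "normal_tree r'" and sub: "r \<subseteq> r'" and t: "splits r t" shows "splits r' t"
proof (rule ccontr)
  assume "\<not> splits r' t"
  moreover have "t \<in> r'" using t sub unfolding splits_def by blast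
  ultimately obtain c where "\<forall>c'\<in>OSucc r' t. c' = c" using normal_treeD(4)[OF r'] by blast
  moreover have "r \<subseteq> N" using sub normal_treeD(3)[OF r'] by blast
  ultimately show False using splits_other[OF t, of c] OSucc_mono[OF sub] by blast
qed

lemma splits_cone_iff:
  assumes r: "normal_tree r" and v: "v \<in> r"
  shows "splits (cone r v) t \<longleftrightarrow> splits r t \<and> v \<subseteq>\<^sub>m t"
proof
  note T = normal_treeD(1)[OF r]
  assume s: "splits (cone r v) t"
  then have t: "t \<in> r" "t \<in> N" "t \<subseteq>\<^sub>m v \<or> v \<subseteq>\<^sub>m t" using treeD(1)[OF T] unfolding splits_def cone_def by blast+
  have "v \<subseteq>\<^sub>m t"
  proof (rule ccontr)
    assume n: "\<not> v \<subseteq>\<^sub>m t"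
    then have "t \<subseteq>\<^sub>m v" "t \<noteq> v" using t by auto
    then have "OSucc (cone r v) t = {the (v (len t))}" using OSucc_cone_below[OF T v t(2)] by blast
    moreover have "cone r v \<subseteq> N" using treeD(1)[OF T] cone_subset by blast
    ultimately show False using splits_other[OF s, of "the (v (len t))"] by blast
  qed
  then show "splits r t \<and> v \<subseteq>\<^sub>m t"
    using splits_cong[OF OSucc_cone[OF T v t(2)] t(1) s] by blast
next
  note T = normal_treeD(1)[OF r]
  assume s: "splits r t \<and> v \<subseteq>\<^sub>m t"
  then have "t \<in> N" "t \<in> cone r v" using treeD(1)[OF T] unfolding splits_def cone_def by blast+
  then show "splits (cone r v) t"
    using splits_cong[OF OSucc_cone[OF T v, symmetric]] s by blast
qed

lemma normal_tree_cone:
  assumes r: "normal_tree r" and v: "v \<in> r" shows "normal_tree (cone r v)"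
  unfolding normal_tree_def
proof (intro conjI ballI impI)
  note T = normal_treeD(1,2)[OF r] and rN = normal_treeD(3)[OF r]
  show "is_tree lam ks (cone r v)" using cone_tree[OF T(1) v] .
  show "lt_closed lam (cone r v)" using cone_lt_closed[OF T v] .
  fix t assume t: "t \<in> cone r v"
  then have t': "t \<in> r" "t \<in> N" "t \<subseteq>\<^sub>m v \<or> v \<subseteq>\<^sub>m t" using rN unfolding cone_def by blast+
  show "splits (cone r v) t \<or> (\<exists>!c. c \<in> OSucc (cone r v) t)"
  proof (cases "v \<subseteq>\<^sub>m t")
    case True
    then show ?thesis using splits_cone_iff[OF r v] normal_treeD(4)[OF r t'(1)] OSucc_cone[OF T(1) v t'(2)] by auto
  next
    case False
    then have "OSucc (cone r v) t = {the (v (len t))}" using OSucc_cone_below[OF T(1) v t'(2)] t' by auto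
    then show ?thesis by simp
  qed
  show "\<exists>u. splits (cone r v) u \<and> t \<subseteq>\<^sub>m u"
  proof (cases "v \<subseteq>\<^sub>m t")
    case True
    then show ?thesis using normal_treeD(5)[OF r t'(1)] splits_cone_iff[OF r v] map_le_trans by blast
  next
    case False
    then show ?thesis using normal_treeD(5)[OF r v] splits_cone_iff[OF r v] map_le_trans t'(3) by blast
  qed
next
  fix u assume u: "u \<in> N"
    "limit_ordinal (len u) \<and> unbounded_in {b. splits (cone r v) (u |` {..<b})} (len u)"
  then have "unbounded_in {b. splits r (u |` {..<b})} (len u)"
    using splits_cone_iff[OF r v] unfolding unbounded_in_def by blast
  then have "splits r u" using normal_treeD(6)[OF r u(1)] u(2) by blast
  moreover obtain b where "splits (cone r v) (u |` {..<b})"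
    using u(2) unfolding limit_ordinal_def unbounded_in_def by blast
  then have "v \<subseteq>\<^sub>m u" using splits_cone_iff[OF r v] map_le_trans restrict_map_le by blast
  ultimately show "splits (cone r v) u" using splits_cone_iff[OF r v] by blast
qed

section \<open>First splitting nodes\<close>

lemma minimal_split:
  assumes r: "normal_tree r" and s: "s \<in> r"
  obtains w where "splits r w" "s \<subseteq>\<^sub>m w" "\<And>b. len s \<le> b \<Longrightarrow> b < len w \<Longrightarrow> \<not> splits r (w |` {..<b})"
proof -
  note rN = normal_treeD(3)[OF r]
  obtain u where u: "splits r u" "s \<subseteq>\<^sub>m u" using normal_treeD(5)[OF r s] by blast
  have N: "s \<in> N" "u \<in> N" using rN s splits_mem[OF u(1)] by blast+
  let ?Q = "\<lambda>b. len s \<le> b \<and> b \<le> len u \<and> splits r (u |` {..<b})"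
  define b0 where "b0 = (LEAST b. ?Q b)"
  have "?Q (len u)" using u N node_le_len restrict_len by simp
  then have b0: "?Q b0" unfolding b0_def by (rule LeastI)
  have w: "u |` {..<b0} \<in> N" "len (u |` {..<b0}) = b0" using restrict_node[OF N(2)] b0 by blast+
  show ?thesis
  proof (rule that)
    show "splits r (u |` {..<b0})" using b0 by blast
    show "s \<subseteq>\<^sub>m u |` {..<b0}" using nodes_below_comparable[OF N(1) w(1) N(2) u(2) restrict_map_le] b0 w by simp
    fix b assume "len s \<le> b" "b < len (u |` {..<b0})"
    then have b: "len s \<le> b" "b < b0" using w by simp_all
    then have "\<not> ?Q b" using not_less_Least[of b ?Q] unfolding b0_def by blast
    moreover have "b \<le> len u" using b b0 less_le_trans less_imp_le by blast
    ultimately show "\<not> splits r (u |` {..<b0} |` {..<b})" using b b0 restrict_below(1)[of b b0 u] by simp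
  qed
qed

lemma agree_comparable:
  assumes "u \<in> N" "w \<in> N" "\<And>x. x < len u \<Longrightarrow> x < len w \<Longrightarrow> u x = w x"
  shows "u \<subseteq>\<^sub>m w \<or> w \<subseteq>\<^sub>m u"
  using assms(3) nodeD(1)[OF assms(1)] nodeD(1)[OF assms(2)] unfolding map_le_def
  by (metis lessThan_iff less_le_trans linear)

text \<open>Between \<open>s\<close> and the first splitting node \<open>w\<close> above it the tree
  does not branch, so a node above \<open>s\<close> lies on the way to \<open>w\<close> or extends
  \<open>w\<close>.\<close>

lemma minimal_split_comparable:
  assumes r: "normal_tree r" and w: "w \<in> r" "s \<subseteq>\<^sub>m w" "\<And>b. len s \<le> b \<Longrightarrow> b < len w \<Longrightarrow> \<not> splits r (w |` {..<b})"
    and u: "u \<in> r" "s \<subseteq>\<^sub>m u" and s: "s \<in> N"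
  shows "u \<subseteq>\<^sub>m w \<or> w \<subseteq>\<^sub>m u"
proof (rule agree_comparable)
  note T = normal_treeD(1)[OF r] and rN = normal_treeD(3)[OF r]
  show N: "u \<in> N" "w \<in> N" using rN u w by blast+
  show "x < len u \<Longrightarrow> x < len w \<Longrightarrow> u x = w x" for x
  proof (induction x rule: less_induct)
    case (less x)
    show ?case
    proof (cases "x < len s")
      case True
      then have "x \<in> dom s" using nodeD(1)[OF s] by simp
      then show ?thesis using w(2) u(2) unfolding map_le_def by metis
    next
      case False
      have eq: "u |` {..<x} = w |` {..<x}"
      proof
        fix y show "(u |` {..<x}) y = (w |` {..<x}) y"
          using less.IH[of y] less.prems less_trans[of y x] by (auto simp: restrict_map_def)
      qed
      have len: "len (w |` {..<x}) = x" using restrict_node(2)[OF N(2)] less.prems by simp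
      have "the (u x) \<in> OSucc r (w |` {..<x})"
        using treeD(5)[OF T u(1), of x] restrict_upto(1)[OF N(1) less.prems(1)] len eq
        unfolding OSucc_def by simp
      moreover have "the (w x) \<in> OSucc r (w |` {..<x})"
        using treeD(5)[OF T w(1), of x] restrict_upto(1)[OF N(2) less.prems(2)] len
        unfolding OSucc_def by simp
      moreover have "\<exists>!c. c \<in> OSucc r (w |` {..<x})"
        using normal_treeD(4)[OF r treeD(4)[OF T w(1)]] w(3) less.prems False by simp
      ultimately have "the (u x) = the (w x)" by blast
      then show ?thesis using nodeD(3)[OF N(1) less.prems(1)] nodeD(3)[OF N(2) less.prems(2)] by auto
    qed
  qed
qed

section \<open>Intersections of chains of normal trees\<close>

lemma OSucc_Inter: "OSucc (\<Inter>F) t = (\<Inter>r\<in>F. OSucc r t)"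
  unfolding OSucc_def by blast

lemma splits_Inter:
  assumes F: "F \<noteq> {}" "|F| <o |{..<lam}|" and s: "\<And>r. r \<in> F \<Longrightarrow> splits r t" and t: "t \<in> N"
  shows "splits (\<Inter>F) t"
proof -
  obtain r0 where r0: "r0 \<in> F" using F by blast
  have l: "a0 \<le> len t" "len t < lam" using s[OF r0] nodeD(2)[OF t] unfolding splits_def by blast+
  have "\<forall>r\<in>F. \<exists>C. club_in C (ks (len t)) \<and> C \<subseteq> OSucc r t"
    using s unfolding splits_def club_splitting_def by blast
  then obtain C where C: "\<And>r. r \<in> F \<Longrightarrow> club_in (C r) (ks (len t))" "\<And>r. r \<in> F \<Longrightarrow> C r \<subseteq> OSucc r t" by metis
  have "|C ` F| <o |{..<ks (len t)}|"
    using card_of_image F(2) card_lam_less_ks[OF l] ordLeq_ordLess_trans ordLess_transitive by meson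
  then have "club_in (\<Inter>(C ` F)) (ks (len t))"
    using F(1) C(1) ks_regular l uncountable_large_ks[OF l] by (intro club_Inter) auto
  moreover have "\<Inter>(C ` F) \<subseteq> OSucc (\<Inter>F) t" using C(2) unfolding OSucc_Inter by blast
  ultimately have "club_splitting ks (\<Inter>F) (len t) t" unfolding club_splitting_def by blast
  moreover have "t \<in> \<Inter>F" using s splits_mem by blast
  moreover have "\<forall>c\<in>OSucc (\<Inter>F) t. \<forall>b<len t. ks b \<le> c"
    using s[OF r0] r0 unfolding OSucc_Inter splits_def by blast
  ultimately show ?thesis using l unfolding splits_def by blast
qed

lemma limit_ordinal_join:
  assumes u: "u \<in> N" and C: "C \<subseteq> N" "C \<noteq> {}" "u \<notin> C" "\<And>t. t \<in> C \<Longrightarrow> t \<subseteq>\<^sub>m u"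
    "\<And>b. b < len u \<Longrightarrow> \<exists>t\<in>C. b < len t"
  shows "limit_ordinal (len u)" "\<And>t. t \<in> C \<Longrightarrow> len t < len u"
proof -
  show less: "len t < len u" if "t \<in> C" for t
    using node_le_less[of t u] that u C by blast
  show "limit_ordinal (len u)"
    unfolding limit_ordinal_def using C(2,5) less by blast
qed

lemma splits_join:
  assumes r: "normal_tree r" and C: "C \<noteq> {}" "\<And>t. t \<in> C \<Longrightarrow> splits r t"
    "\<And>s t. s \<in> C \<Longrightarrow> t \<in> C \<Longrightarrow> s \<subseteq>\<^sub>m t \<or> t \<subseteq>\<^sub>m s" "|C| <o |{..<lam}|"
  obtains u where "splits r u" "\<And>t. t \<in> C \<Longrightarrow> t \<subseteq>\<^sub>m u"
proof -
  have CN: "C \<subseteq> N" using C(2) splits_mem normal_treeD(3)[OF r] by blast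
  obtain u where u: "u \<in> N" "\<And>t. t \<in> C \<Longrightarrow> t \<subseteq>\<^sub>m u" "\<And>b. b < len u \<Longrightarrow> \<exists>t\<in>C. b < len t"
    using join_exists[OF CN C(1,3,4)] by blast
  show ?thesis
  proof (cases "u \<in> C")
    case True then show ?thesis using that u C(2) by blast
  next
    case False
    have lim: "limit_ordinal (len u)" "\<And>t. t \<in> C \<Longrightarrow> len t < len u"
      using limit_ordinal_join[OF u(1) CN C(1) False] u(2,3) by blast+
    have "unbounded_in {b. splits r (u |` {..<b})} (len u)"
      unfolding unbounded_in_def
    proof (intro allI impI)
      fix b assume "b < len u"
      then obtain t where t: "t \<in> C" "b < len t" using u(3) by blast
      then have "t = u |` {..<len t}" using node_le_restrict[of t u] u CN by blast
      then have "splits r (u |` {..<len t})" using C(2)[OF t(1)] by metis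
      then show "\<exists>c\<in>{b. splits r (u |` {..<b})}. b \<le> c \<and> c < len u"
        using t lim(2)[OF t(1)] by (intro bexI[of _ "len t"]) auto
    qed
    then have "splits r u" using normal_treeD(6)[OF r u(1) lim(1)] by blast
    then show ?thesis using that u(2) by blast
  qed
qed

lemma normal_tree_Inter:
  assumes F: "F \<noteq> {}" "|F| <o |{..<lam}|" "\<And>r. r \<in> F \<Longrightarrow> normal_tree r"
    and chain: "\<And>r r'. r \<in> F \<Longrightarrow> r' \<in> F \<Longrightarrow> r \<subseteq> r' \<or> r' \<subseteq> r"
  shows "normal_tree (\<Inter>F)"
proof -
  note T = normal_treeD(1)[OF F(3)]
  obtain r0 where r0: "r0 \<in> F" using F by blast
  have RN: "\<Inter>F \<subseteq> N" using treeD(1)[OF T[OF r0]] r0 by blast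
  have tree: "is_tree lam ks (\<Inter>F)"
    unfolding is_tree_def
  proof (intro conjI ballI impI)
    show "\<Inter>F \<noteq> {}" using treeD(6)[OF T] by blast
    show "\<Inter>F \<subseteq> N" by (rule RN)
    show "s \<in> \<Inter>F" if "t \<in> \<Inter>F" "s \<in> N" "s \<subseteq>\<^sub>m t" for s t
      using that treeD(2)[OF T] by blast
  qed
  have succ: "splits (\<Inter>F) t \<or> (\<exists>!c. c \<in> OSucc (\<Inter>F) t)" if t: "t \<in> \<Inter>F" for t
  proof (cases "\<forall>r\<in>F. splits r t")
    case True then show ?thesis using splits_Inter[OF F(1,2)] t RN by blast
  next
    case False
    then obtain r1 where r1: "r1 \<in> F" "\<not> splits r1 t" by blast
    then obtain c where c: "c \<in> OSucc r1 t" "\<And>c'. c' \<in> OSucc r1 t \<Longrightarrow> c' = c"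
      using normal_treeD(4)[OF F(3)[OF r1(1)], of t] t by blast
    \<comment> \<open>The only successor in \<open>r1\<close> survives everywhere: larger trees
      contain it, and a smaller tree has some successor of \<open>t\<close>, which must be this
      one.\<close>
    have "c \<in> OSucc r t" if r: "r \<in> F" for r
    proof (cases "r \<subseteq> r1")
      case True
      then show ?thesis
        using OSucc_nonempty[OF T[OF r] normal_treeD(2)[OF F(3)[OF r]], of t] t r c(2) OSucc_mono[OF True] by blast
    next
      case False
      then show ?thesis using chain[OF r r1(1)] c(1) OSucc_mono by blast
    qed
    then have "OSucc (\<Inter>F) t = {c}" using c r1(1) unfolding OSucc_Inter by blast
    then show ?thesis by simp
  qed
  have closed: "lt_closed lam (\<Inter>F)"
  proof (rule lt_closedI[OF RN])
    show "OSucc (\<Inter>F) t \<noteq> {}" if "t \<in> \<Inter>F" for t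
      using succ[OF that] splits_other[of "\<Inter>F" t] RN by blast
    show "u \<in> \<Inter>F" if "u \<in> N" "limit_ordinal (len u)" "\<And>b. b < len u \<Longrightarrow> u |` {..<b} \<in> \<Inter>F" for u
      using that limit_closed[OF normal_treeD(2)[OF F(3)]] by blast
  qed
  have ext: "\<exists>u. splits (\<Inter>F) u \<and> s \<subseteq>\<^sub>m u" if s: "s \<in> \<Inter>F" for s
  proof -
    have sN: "s \<in> N" using s RN by blast
    have "\<forall>r\<in>F. \<exists>w. splits r w \<and> s \<subseteq>\<^sub>m w \<and> (\<forall>b. len s \<le> b \<longrightarrow> b < len w \<longrightarrow> \<not> splits r (w |` {..<b}))"
    proof
      fix r assume r: "r \<in> F"
      have sr: "s \<in> r" using s r by blast
      show "\<exists>w. splits r w \<and> s \<subseteq>\<^sub>m w \<and> (\<forall>b. len s \<le> b \<longrightarrow> b < len w \<longrightarrow> \<not> splits r (w |` {..<b}))"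
        by (rule minimal_split[OF F(3)[OF r] sr]) blast
    qed
    then obtain w where w: "\<And>r. r \<in> F \<Longrightarrow> splits r (w r)" "\<And>r. r \<in> F \<Longrightarrow> s \<subseteq>\<^sub>m w r"
      "\<And>r b. r \<in> F \<Longrightarrow> len s \<le> b \<Longrightarrow> b < len (w r) \<Longrightarrow> \<not> splits r (w r |` {..<b})" by metis
    have wr: "w r \<in> r" "w r \<in> N" if "r \<in> F" for r
      using splits_mem[OF w(1)[OF that]] treeD(1)[OF T[OF that]] by blast+
    \<comment> \<open>Splitting in \<open>r\<close> implies splitting in the larger
      \<open>r'\<close>, so the first splitting node of the smaller tree cannot come
      earlier.\<close>
    have mono: "w r' \<subseteq>\<^sub>m w r" if r: "r \<in> F" "r' \<in> F" "r \<subseteq> r'" for r r'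
    proof (rule ccontr)
      assume n: "\<not> w r' \<subseteq>\<^sub>m w r"
      have sp: "splits r' (w r)" using splits_mono[OF F(3)[OF r(2)] r(3) w(1)[OF r(1)]] .
      then have le: "w r \<subseteq>\<^sub>m w r'"
        using minimal_split_comparable[OF F(3)[OF r(2)] wr(1)[OF r(2)] w(2)[OF r(2)] w(3)[OF r(2)]
          splits_mem[OF sp] w(2)[OF r(1)] sN] n by blast
      moreover have "w r \<noteq> w r'" using n by auto
      ultimately have "len (w r) < len (w r')" "w r = w r' |` {..<len (w r)}"
        using node_le_less node_le_restrict wr(2) r by blast+
      then show False using w(3)[OF r(2), of "len (w r)"] sp node_le_len[OF sN wr(2)[OF r(1)] w(2)[OF r(1)]]
        by metis
    qed
    have comp: "w r \<subseteq>\<^sub>m w r' \<or> w r' \<subseteq>\<^sub>m w r" if "r \<in> F" "r' \<in> F" for r r'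
      using chain[OF that] mono that by blast
    have "|w ` F| <o |{..<lam}|" using card_of_image F(2) ordLeq_ordLess_trans by blast
    moreover have WN: "w ` F \<subseteq> N" "w ` F \<noteq> {}" using wr(2) F(1) by blast+
    ultimately obtain u where u: "u \<in> N" "\<And>t. t \<in> w ` F \<Longrightarrow> t \<subseteq>\<^sub>m u" "\<And>b. b < len u \<Longrightarrow> \<exists>t\<in>w ` F. b < len t"
      using join_exists[of "w ` F"] comp by blast
    \<comment> \<open>If the union is attained, it is the first splitting node of \<open>r\<close>
      or of a tree inside \<open>r\<close>. Otherwise it is a proper limit, and the first splitting
      nodes of \<open>r\<close> and of the trees inside \<open>r\<close> are cofinal below
      it.\<close>
    have "splits r u" if r: "r \<in> F" for r
    proof (cases "u \<in> w ` F")
      case True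
      then obtain r1 where r1: "r1 \<in> F" "u = w r1" by blast
      show ?thesis
      proof (cases "r1 \<subseteq> r")
        case True
        then show ?thesis using splits_mono[OF F(3)[OF r] True w(1)[OF r1(1)]] r1(2) by simp
      next
        case False
        then have "u \<subseteq>\<^sub>m w r" using mono[OF r r1(1)] chain[OF r r1(1)] r1(2) by blast
        then have "u = w r" using u(2)[of "w r"] r map_le_antisym by blast
        then show ?thesis using w(1)[OF r] by simp
      qed
    next
      case False
      have lim: "limit_ordinal (len u)" "\<And>t. t \<in> w ` F \<Longrightarrow> len t < len u"
        using limit_ordinal_join[OF u(1) WN False] u(2,3) by blast+
      have "unbounded_in {b. splits r (u |` {..<b})} (len u)"
        unfolding unbounded_in_def
      proof (intro allI impI)
        fix b assume "b < len u"
        then obtain r1 where r1: "r1 \<in> F" "b < len (w r1)" using u(3) by blast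
        have "\<exists>t\<in>w ` F. splits r t \<and> b < len t"
        proof (cases "r1 \<subseteq> r")
          case True
          then show ?thesis using splits_mono[OF F(3)[OF r] True w(1)[OF r1(1)]] r1 by blast
        next
          case False
          then have "w r1 \<subseteq>\<^sub>m w r" using mono[OF r r1(1)] chain[OF r r1(1)] by blast
          then have "b < len (w r)" using node_le_len wr(2) r r1 by (meson less_le_trans)
          then show ?thesis using w(1)[OF r] r by blast
        qed
        then obtain t where t: "t \<in> w ` F" "splits r t" "b < len t" by blast
        then have "t = u |` {..<len t}" using node_le_restrict[of t u] u WN by blast
        then have "splits r (u |` {..<len t})" using t(2) by metis
        then show "\<exists>c\<in>{b. splits r (u |` {..<b})}. b \<le> c \<and> c < len u"
          using t lim(2)[OF t(1)] by (intro bexI[of _ "len t"]) auto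
      qed
      then show ?thesis using normal_treeD(6)[OF F(3)[OF r] u(1) lim(1)] by blast
    qed
    then have "splits (\<Inter>F) u" using splits_Inter[OF F(1,2) _ u(1)] by blast
    moreover have "s \<subseteq>\<^sub>m u" using w(2)[OF r0] u(2)[of "w r0"] r0 map_le_trans by blast
    ultimately show ?thesis by blast
  qed
  have lim: "splits (\<Inter>F) u"
    if u: "u \<in> N" "limit_ordinal (len u)" "unbounded_in {b. splits (\<Inter>F) (u |` {..<b})} (len u)" for u
  proof (rule splits_Inter[OF F(1,2) _ u(1)])
    fix r assume r: "r \<in> F"
    have "splits r t" if "splits (\<Inter>F) t" for t
      using splits_mono[OF F(3)[OF r] _ that] r by blast
    then have "unbounded_in {b. splits r (u |` {..<b})} (len u)" using u(3) unfolding unbounded_in_def by blast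
    then show "splits r u" using normal_treeD(6)[OF F(3)[OF r] u(1,2)] by blast
  qed
  show ?thesis unfolding normal_tree_def using tree closed succ ext lim by blast
qed

text \<open>If \<open>g\<close> stayed below \<open>a\<close>, it would embed every chain of
  splitting nodes above \<open>s\<close> into \<open>{..<a}\<close>, so the chain would have a
  splitting upper bound. Zorn's lemma would give a maximal splitting node, but every splitting node
  has another one properly above it. Applied to the length and to the first undecided
  argument.\<close>

lemma splits_rank_unbounded:
  fixes g :: "'o node \<Rightarrow> 'o"
  assumes r: "normal_tree r" and s: "s \<in> r" and a: "a < lam"
    and g: "\<And>t t'. splits r t \<Longrightarrow> splits r t' \<Longrightarrow> t \<subseteq>\<^sub>m t' \<Longrightarrow> t \<noteq> t' \<Longrightarrow> g t < g t'"
  shows "\<exists>t. splits r t \<and> s \<subseteq>\<^sub>m t \<and> a \<le> g t"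
proof (rule ccontr)
  assume "\<not> ?thesis"
  then have below: "\<And>t. splits r t \<Longrightarrow> s \<subseteq>\<^sub>m t \<Longrightarrow> g t < a" by (meson not_le)
  let ?S = "{t. splits r t \<and> s \<subseteq>\<^sub>m t}"
  have "\<exists>m\<in>?S. \<forall>t\<in>?S. m \<subseteq>\<^sub>m t \<longrightarrow> t = m"
  proof (rule predicate_Zorn)
    show "partial_order_on ?S (relation_of (\<subseteq>\<^sub>m) ?S)"
      by (rule partial_order_on_relation_ofI[OF map_le_refl map_le_trans map_le_antisym])
    fix C assume C: "C \<in> Chains (relation_of (\<subseteq>\<^sub>m) ?S)"
    then have CS: "C \<subseteq> ?S" and comp: "\<And>x y. x \<in> C \<Longrightarrow> y \<in> C \<Longrightarrow> x \<subseteq>\<^sub>m y \<or> y \<subseteq>\<^sub>m x"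
      unfolding Chains_def relation_of_def by blast+
    show "\<exists>u\<in>?S. \<forall>t\<in>C. t \<subseteq>\<^sub>m u"
    proof (cases "C = {}")
      case True then show ?thesis using normal_treeD(5)[OF r s] by blast
    next
      case False
      have "inj_on g C"
      proof (rule inj_onI, rule ccontr)
        fix x y assume xy: "x \<in> C" "y \<in> C" "g x = g y" "x \<noteq> y"
        then have "splits r x" "splits r y" using CS by blast+
        then show False using g[of x y] g[of y x] comp[OF xy(1,2)] xy(3,4) by auto
      qed
      moreover have "g ` C \<subseteq> {..<a}" using below CS by blast
      ultimately have "|C| \<le>o |{..<a}|" using card_of_ordLeq by blast
      then have small: "|C| <o |{..<lam}|" using card_below_lam[OF a] ordLeq_ordLess_trans by blast
      have "splits r t" if "t \<in> C" for t using that CS by blast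
      then obtain u where u: "splits r u" "\<And>t. t \<in> C \<Longrightarrow> t \<subseteq>\<^sub>m u"
        using splits_join[OF r False _ comp small] by metis
      moreover have "s \<subseteq>\<^sub>m u" using False CS u(2) map_le_trans by blast
      ultimately show ?thesis by blast
    qed
  qed
  then obtain m where m: "splits r m" "s \<subseteq>\<^sub>m m" "\<And>t. splits r t \<Longrightarrow> s \<subseteq>\<^sub>m t \<Longrightarrow> m \<subseteq>\<^sub>m t \<Longrightarrow> t = m" by blast
  have mN: "m \<in> N" using splits_mem[OF m(1)] normal_treeD(3)[OF r] by blast
  obtain c where "m(len m \<mapsto> c) \<in> r" using splits_other[OF m(1) normal_treeD(3)[OF r]] unfolding OSucc_def by blast
  then obtain w where w: "splits r w" "m(len m \<mapsto> c) \<subseteq>\<^sub>m w" using normal_treeD(5)[OF r] by blast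
  then have "m \<subseteq>\<^sub>m w" using extend_restrict(4)[OF mN] map_le_trans by blast
  then have "w = m" using m w(1) map_le_trans by blast
  then have "len m \<in> dom m" using map_le_implies_dom_le[OF w(2)] by auto
  then show False using node_None[OF mN] by (metis domIff order_refl)
qed

end


section \<open>Normal trees are dense in the Miller conditions\<close>

context large_sequence
begin

text \<open>Successors of \<open>t\<close> lie below \<open>ks (len t)\<close>, which bounds
  \<open>a\<close> by \<open>len t\<close>; the trimming keeps them above the earlier cardinals,
  which excludes \<open>a < len t\<close>.\<close>

lemma splits_index_unique:
  assumes r: "normal_tree r" and t: "t \<in> r" and a: "a < lam" and s: "club_splitting ks r a t"
  shows "splits r t" "len t = a"
proof -
  note rN = normal_treeD(3)[OF r]
  have tN: "t \<in> N" using t rN by blast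
  show sp: "splits r t"
  proof (rule ccontr)
    assume "\<not> splits r t"
    then obtain c where "\<forall>c'\<in>OSucc r t. c' = c" using normal_treeD(4)[OF r t] by blast
    then show False using club_splitting_other[OF a s, of c] by blast
  qed
  obtain C where C: "club_in C (ks a)" "C \<subseteq> OSucc r t" using s unfolding club_splitting_def by blast
  have reg: "regular_cardinal (ks a)" using ks_regular a by blast
  show "len t = a"
  proof (rule linorder_cases)
    assume l: "len t < a"
    then have "ks (len t) < ks a" using ks_less a by blast
    then obtain c where "c \<in> C" "ks (len t) < c" using club_ex_greater[OF reg C(1)] by blast
    then show ?thesis using C(2) OSucc_subset[OF rN tN] by force
  next
    assume l: "a < len t"
    obtain y where "y < ks a" using reg unfolding regular_cardinal_def
      by (metis finite.emptyI lessThan_iff subset_eq subset_empty)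
    then obtain c where "c \<in> C" using club_ex_greater[OF reg C(1)] by blast
    then have "c < ks a" "ks a \<le> c" using C sp l unfolding splits_def club_in_def by blast+
    then show ?thesis by simp
  qed
qed

text \<open>Lengths of splitting nodes above a given node are unbounded in \<open>lam\<close>, which
  yields successor sets of every required size.\<close>

lemma normal_tree_M_club:
  assumes r: "normal_tree r" shows "r \<in> M_club lam ks"
proof -
  note T = normal_treeD(1)[OF r] and rN = normal_treeD(3)[OF r]
  have "\<exists>t\<in>r. s \<subseteq>\<^sub>m t \<and> |{..<ks a}| \<le>o |Succ r t|" if s: "s \<in> r" and a: "a < lam" for s a
  proof -
    have "\<exists>t. splits r t \<and> s \<subseteq>\<^sub>m t \<and> a \<le> len t"
    proof (rule splits_rank_unbounded[OF r s a])
      fix t t' assume "splits r t" "splits r t'" "t \<subseteq>\<^sub>m t'" "t \<noteq> t'"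
      then show "len t < len t'" using node_le_less splits_mem rN by blast
    qed
    then obtain t where t: "splits r t" "s \<subseteq>\<^sub>m t" "a \<le> len t" by blast
    have tr: "t \<in> r" "t \<in> N" using splits_mem[OF t(1)] rN by blast+
    have "{..<ks a} \<subseteq> {..<ks (len t)}" using ks_mono[OF t(3) nodeD(2)[OF tr(2)]] by auto
    then have "|{..<ks a}| \<le>o |{..<ks (len t)}|" by (rule card_of_mono1)
    moreover have "|Succ r t| =o |{..<ks (len t)}|"
      using card_Succ_club_splitting[OF T tr(1)] t(1) unfolding splits_def by blast
    ultimately have "|{..<ks a}| \<le>o |Succ r t|" using ordIso_symmetric ordLeq_ordIso_trans by blast
    then show ?thesis using tr t by blast
  qed
  moreover have "\<exists>t\<in>r. s \<subseteq>\<^sub>m t \<and> club_splitting ks r (len t) t" if "s \<in> r" for s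
    using normal_treeD(5)[OF r that] unfolding splits_def by blast
  ultimately show ?thesis using T normal_treeD(2)[OF r] unfolding M_club_def by blast
qed

text \<open>As the index of a splitting node is its length, nodes indexed by an unbounded subset of
  \<open>d\<close> have a union of length exactly \<open>d\<close>, and the limit clause of
  normality applies to it.\<close>

lemma normal_tree_scl_M_club:
  assumes r: "normal_tree r" shows "r \<in> scl_M_club lam ks"
proof -
  note T = normal_treeD(1)[OF r] and rN = normal_treeD(3)[OF r]
  have "\<exists>u\<in>r. Map.graph u = (\<Union>a\<in>I. Map.graph (t a)) \<and> club_splitting ks r d u"
    if d: "d < lam" "limit_ordinal d" and I: "I \<subseteq> {..<d}" "unbounded_in I d"
      and t: "\<And>a. a \<in> I \<Longrightarrow> t a \<in> r" "\<And>a. a \<in> I \<Longrightarrow> club_splitting ks r a (t a)"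
      and mono: "\<And>a b. a \<in> I \<Longrightarrow> b \<in> I \<Longrightarrow> a < b \<Longrightarrow> t a \<subseteq>\<^sub>m t b" for d I t
  proof -
    have above: "\<exists>a\<in>I. b < a" if b: "b < d" for b
    proof -
      obtain b' where "b < b'" "b' < d" using d(2) b unfolding limit_ordinal_def by blast
      then show ?thesis using I(2) unfolding unbounded_in_def by (meson less_le_trans)
    qed
    have Il: "a < d" "a < lam" if "a \<in> I" for a using that I(1) d(1) less_trans by blast+
    have sp: "splits r (t a)" "len (t a) = a" if a: "a \<in> I" for a
      using splits_index_unique[OF r t(1)[OF a] Il(2)[OF a] t(2)[OF a]] by blast+
    have tN: "t ` I \<subseteq> N" "t ` I \<noteq> {}"
      using t(1) rN above d(2) unfolding limit_ordinal_def by blast+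
    have "|t ` I| <o |{..<lam}|"
      using card_of_image card_of_mono1[OF I(1)] card_below_lam[OF d(1)] ordLeq_ordLess_trans ordLeq_transitive
      by meson
    moreover have "x \<subseteq>\<^sub>m y \<or> y \<subseteq>\<^sub>m x" if xy: "x \<in> t ` I" "y \<in> t ` I" for x y
    proof -
      obtain a b where "a \<in> I" "b \<in> I" "x = t a" "y = t b" using xy by blast
      then show ?thesis using mono[of a b] mono[of b a] by (cases a b rule: linorder_cases) auto
    qed
    ultimately obtain u where u: "u \<in> N" "\<And>x. x \<in> t ` I \<Longrightarrow> x \<subseteq>\<^sub>m u" "\<And>b. b < len u \<Longrightarrow> \<exists>x\<in>t ` I. b < len x"
      using join_exists[OF tN] by blast
    have ur: "t a = u |` {..<a}" "a \<le> len u" if a: "a \<in> I" for a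
      using node_le_restrict[of "t a" u] node_le_len[of "t a" u] tN u a sp(2)[OF a] by auto
    have len: "len u = d"
    proof (rule linorder_cases)
      assume "len u < d" then show ?thesis using above ur(2) by (meson leD)
    next
      assume "d < len u"
      then obtain a where "a \<in> I" "d < a" using u(3) sp(2) by auto
      then show ?thesis using Il(1) by (meson less_asym)
    qed
    have "unbounded_in {b. splits r (u |` {..<b})} (len u)"
      unfolding unbounded_in_def
    proof (intro allI impI)
      fix b assume "b < len u"
      then obtain a where a: "a \<in> I" "b < a" using above len by blast
      then have "splits r (u |` {..<a})" using sp(1)[OF a(1)] ur(1)[OF a(1)] by simp
      then show "\<exists>c\<in>{b. splits r (u |` {..<b})}. b \<le> c \<and> c < len u"
        using a Il(1)[OF a(1)] len by (intro bexI[of _ a]) auto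
    qed
    then have su: "splits r u" using normal_treeD(6)[OF r u(1)] d(2) len by simp
    have "Map.graph u = (\<Union>a\<in>I. Map.graph (t a))"
    proof (intro equalityI subsetI)
      fix x assume "x \<in> Map.graph u"
      then obtain b c where x: "x = (b, c)" "u b = Some c" unfolding Map.graph_def by blast
      have "b \<in> dom u" using x by blast
      then have "b < d" using nodeD(1)[OF u(1)] len by simp
      then obtain a where a: "a \<in> I" "b < a" using above by blast
      then have "t a b = Some c" using ur(1)[OF a(1)] x by simp
      then show "x \<in> (\<Union>a\<in>I. Map.graph (t a))" using x a unfolding Map.graph_def by blast
    next
      fix x assume "x \<in> (\<Union>a\<in>I. Map.graph (t a))"
      then obtain a b c where x: "x = (b, c)" "a \<in> I" "t a b = Some c" unfolding Map.graph_def by blast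
      then have "u b = Some c" using u(2)[of "t a"] unfolding map_le_def by (metis domI imageI)
      then show "x \<in> Map.graph u" using x unfolding Map.graph_def by blast
    qed
    then show ?thesis using su len unfolding splits_def by blast
  qed
  then show ?thesis using normal_tree_M_club[OF r] unfolding scl_M_club_def by simp
qed

text \<open>A condition is thinned to a normal tree by following, at every node that does not split, one fixed
  splitting node above it. Taking the least one in a well-order of all nodes makes these choices
  coherent: the target does not change on the way to it.\<close>

lemma coherent_choice:
  obtains W :: "('o node \<Rightarrow> bool) \<Rightarrow> 'o node \<Rightarrow> 'o node" where
    "\<And>Q u w. Q w \<Longrightarrow> u \<subseteq>\<^sub>m w \<Longrightarrow> Q (W Q u) \<and> u \<subseteq>\<^sub>m W Q u"
    "\<And>Q u v. Q (W Q u) \<Longrightarrow> u \<subseteq>\<^sub>m v \<Longrightarrow> v \<subseteq>\<^sub>m W Q u \<Longrightarrow> W Q v = W Q u"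
proof -
  obtain R :: "'o node rel" where R: "well_order_on UNIV R" using well_order_on by blast
  then have wf: "wf (R - Id)" and tot: "total_on UNIV R" and anti: "antisym R" and refl: "refl_on UNIV R"
    unfolding well_order_on_def linear_order_on_def partial_order_on_def preorder_on_def by blast+
  define W where "W Q u = (SOME m. Q m \<and> u \<subseteq>\<^sub>m m \<and> (\<forall>y. Q y \<and> u \<subseteq>\<^sub>m y \<longrightarrow> (m, y) \<in> R))" for Q and u :: "'o node"
  have W: "Q (W Q u) \<and> u \<subseteq>\<^sub>m W Q u \<and> (\<forall>y. Q y \<and> u \<subseteq>\<^sub>m y \<longrightarrow> (W Q u, y) \<in> R)"
    if w: "Q w" "u \<subseteq>\<^sub>m w" for Q u w
  proof -
    have "w \<in> {m. Q m \<and> u \<subseteq>\<^sub>m m}" using w by blast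
    then obtain m where m: "m \<in> {m. Q m \<and> u \<subseteq>\<^sub>m m}" "\<And>y. (y, m) \<in> R - Id \<Longrightarrow> y \<notin> {m. Q m \<and> u \<subseteq>\<^sub>m m}"
      using wfE_min[OF wf] by metis
    have "(m, y) \<in> R" if y: "Q y \<and> u \<subseteq>\<^sub>m y" for y
    proof (cases "m = y")
      case True then show ?thesis using refl unfolding refl_on_def by blast
    next
      case False
      then have "(y, m) \<notin> R" using m(2)[of y] y by blast
      then show ?thesis using tot False unfolding total_on_def by blast
    qed
    then have "\<exists>m. Q m \<and> u \<subseteq>\<^sub>m m \<and> (\<forall>y. Q y \<and> u \<subseteq>\<^sub>m y \<longrightarrow> (m, y) \<in> R)" using m(1) by blast
    from someI_ex[OF this] show ?thesis unfolding W_def .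
  qed
  show ?thesis
  proof (rule that)
    show "Q (W Q u) \<and> u \<subseteq>\<^sub>m W Q u" if "Q w" "u \<subseteq>\<^sub>m w" for Q u w using W[of Q w u] that by blast
    fix Q u v assume a: "Q (W Q u)" "u \<subseteq>\<^sub>m v" "v \<subseteq>\<^sub>m W Q u"
    have v: "Q (W Q v)" "v \<subseteq>\<^sub>m W Q v" "(W Q v, W Q u) \<in> R" using W[of Q "W Q u" v] a by blast+
    have "(W Q u, W Q v) \<in> R" using W[of Q "W Q u" u] a v map_le_trans by blast
    then show "W Q v = W Q u" using v(3) anti unfolding antisym_def by blast
  qed
qed

lemma normal_subtree:
  assumes r: "r \<in> scl_M_club lam ks"
  shows "\<exists>r'. normal_tree r' \<and> r' \<subseteq> r"
proof -
  have M: "is_tree lam ks r" "lt_closed lam r"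
    and M1: "\<And>s a. s \<in> r \<Longrightarrow> a < lam \<Longrightarrow> \<exists>t\<in>r. s \<subseteq>\<^sub>m t \<and> |{..<ks a}| \<le>o |Succ r t|"
    and M2: "\<And>s. s \<in> r \<Longrightarrow> \<exists>t\<in>r. s \<subseteq>\<^sub>m t \<and> club_splitting ks r (len t) t"
    using r unfolding scl_M_club_def M_club_def by blast+
  have scl: "\<exists>u\<in>r. Map.graph u = (\<Union>a\<in>I. Map.graph (t a)) \<and> club_splitting ks r d u"
    if "d < lam" "limit_ordinal d" "I \<subseteq> {..<d}" "unbounded_in I d"
      "\<forall>a\<in>I. t a \<in> r \<and> club_splitting ks r a (t a)" "\<forall>a\<in>I. \<forall>b\<in>I. a < b \<longrightarrow> t a \<subseteq>\<^sub>m t b" for d I t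
    using r that unfolding scl_M_club_def mem_Collect_eq by blast
  note rN = treeD(1)[OF M(1)]
  define sp where "sp t \<longleftrightarrow> t \<in> r \<and> a0 \<le> len t \<and> club_splitting ks r (len t) t" for t
  have sp_ext: "\<exists>u. sp u \<and> s \<subseteq>\<^sub>m u" if s: "s \<in> r" for s
  proof -
    obtain t where t: "t \<in> r" "s \<subseteq>\<^sub>m t" "|{..<ks a0}| \<le>o |Succ r t|" using M1[OF s a0(1)] by blast
    have tN: "t \<in> N" using t rN by blast
    have "|Succ r t| \<le>o |{..<ks (len t)}|"
      using card_Succ[OF M(1) t(1)] card_of_mono1[OF OSucc_subset[OF rN tN]] ordIso_ordLeq_trans by blast
    then have "|{..<ks a0}| \<le>o |{..<ks (len t)}|" using t(3) ordLeq_transitive by blast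
    \<comment> \<open>So many successors are possible only from level \<open>a0\<close> on; a
      splitting node above \<open>t\<close> is then high enough to count.\<close>
    then have "\<not> len t < a0"
      using card_less_ks[OF a0(1) ks_less[OF _ a0(1)], of "len t"] not_ordLess_ordLeq by blast
    then have l: "a0 \<le> len t" by simp
    obtain u where u: "u \<in> r" "t \<subseteq>\<^sub>m u" "club_splitting ks r (len u) u" using M2[OF t(1)] by blast
    have "len t \<le> len u" using node_le_len[OF tN _ u(2)] u(1) rN by blast
    then have "sp u" using u l unfolding sp_def by simp
    moreover have "s \<subseteq>\<^sub>m u" using t(2) u(2) map_le_trans by blast
    ultimately show ?thesis by blast
  qed
  obtain W' :: "('o node \<Rightarrow> bool) \<Rightarrow> 'o node \<Rightarrow> 'o node" where
    W': "\<And>Q u w. Q w \<Longrightarrow> u \<subseteq>\<^sub>m w \<Longrightarrow> Q (W' Q u) \<and> u \<subseteq>\<^sub>m W' Q u"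
    "\<And>Q u v. Q (W' Q u) \<Longrightarrow> u \<subseteq>\<^sub>m v \<Longrightarrow> v \<subseteq>\<^sub>m W' Q u \<Longrightarrow> W' Q v = W' Q u"
    using coherent_choice by blast
  define W where "W = W' sp"
  have W: "sp (W s)" "s \<subseteq>\<^sub>m W s" if "s \<in> r" for s
    using sp_ext[OF that] W'(1)[of sp _ s] unfolding W_def by blast+
  have W_eq: "W v = W s" if "s \<in> r" "s \<subseteq>\<^sub>m v" "v \<subseteq>\<^sub>m W s" for s v
    using W'(2)[of sp s v] W(1)[OF that(1)] that(2,3) unfolding W_def by blast
  \<comment> \<open>The thinning rule, tested one step at a time so that it passes to initial
    segments and to limits: a splitting node keeps its large successors, any other node only the one
    leading to its target.\<close>
  define ok where "ok t b \<longleftrightarrow> (sp (t |` {..<b}) \<longrightarrow> (\<forall>b'<b. ks b' \<le> the (t b))) \<and>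
    (\<not> sp (t |` {..<b}) \<longrightarrow> t |` {..b} \<subseteq>\<^sub>m W (t |` {..<b}))" for t b
  have ok_restrict: "ok (t |` {..<a}) b \<longleftrightarrow> ok t b" if "b < a" for t a b
    using that restrict_below[of b a t] unfolding ok_def by simp
  define r' where "r' = {t \<in> r. \<forall>b<len t. ok t b}"
  have sub: "r' \<subseteq> r" and r'N: "r' \<subseteq> N" using rN unfolding r'_def by blast+
  have tree: "is_tree lam ks r'"
    unfolding is_tree_def
  proof (intro conjI ballI impI)
    have e: "Map.empty \<in> r" using treeD(6)[OF M(1)] .
    obtain z :: 'o where "\<forall>a. z \<le> a" using zero_less_lam by blast
    then have z: "dom (Map.empty :: 'o node) = {..<z}" using not_less by auto
    then have "len (Map.empty :: 'o node) = z" using len_eq by blast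
    then have "Map.empty \<in> r'" using e z unfolding r'_def by auto
    then show "r' \<noteq> {}" by blast
    show "r' \<subseteq> N" by (rule r'N)
    fix t s assume t: "t \<in> r'" and s: "s \<in> N" "s \<subseteq>\<^sub>m t"
    have tN: "t \<in> N" using t r'N by blast
    have eq: "s = t |` {..<len s}" "len s \<le> len t" using node_le_restrict[OF s(1) tN s(2)] node_le_len[OF s(1) tN s(2)] by blast+
    have "ok s b" if b: "b < len s" for b
      using ok_restrict[OF b, of t] eq t less_le_trans[OF b eq(2)] unfolding r'_def by simp
    moreover have "s \<in> r" using treeD(2)[OF M(1) _ s] t sub by blast
    ultimately show "s \<in> r'" unfolding r'_def by blast
  qed
  have OS: "c \<in> OSucc r' t \<longleftrightarrow> c \<in> OSucc r t \<and> (sp t \<longrightarrow> (\<forall>b<len t. ks b \<le> c)) \<and> (\<not> sp t \<longrightarrow> t(len t \<mapsto> c) \<subseteq>\<^sub>m W t)"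
    if t: "t \<in> r'" for t c
  proof -
    have tN: "t \<in> N" using t r'N by blast
    let ?u = "t(len t \<mapsto> c)"
    have okl: "ok ?u (len t) \<longleftrightarrow> (sp t \<longrightarrow> (\<forall>b<len t. ks b \<le> c)) \<and> (\<not> sp t \<longrightarrow> ?u \<subseteq>\<^sub>m W t)"
      using extend_restrict(1)[OF tN order_refl, of c] extend_restrict(3)[OF tN, of c] restrict_len[OF tN order_refl]
      unfolding ok_def by simp
    have okb: "ok ?u b" if b: "b < len t" for b
    proof -
      have "ok t b" using t b unfolding r'_def by blast
      then show ?thesis using extend_restrict(1)[OF tN less_imp_le[OF b], of c] extend_restrict(2)[OF tN b, of c] b
        unfolding ok_def by (auto simp: less_imp_neq)
    qed
    show ?thesis
    proof (cases "?u \<in> r")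
      case True
      then have "c < ks (len t)" using OSucc_subset[OF rN tN] unfolding OSucc_def by blast
      then have "len ?u = next_ord (len t)" using extend_node(2)[OF tN] by blast
      then have "(\<forall>b<len ?u. ok ?u b) \<longleftrightarrow> ok ?u (len t)"
        using okb less_next(3)[OF nodeD(2)[OF tN]] by (metis order_le_less order_refl)
      then show ?thesis using True okl unfolding OSucc_def r'_def by simp
    next
      case False then show ?thesis unfolding OSucc_def r'_def by simp
    qed
  qed
  have split: "splits r' t" if t: "t \<in> r'" "sp t" for t
  proof -
    have tN: "t \<in> N" using t r'N by blast
    have l: "a0 \<le> len t" "len t < lam" using t(2) nodeD(2)[OF tN] unfolding sp_def by blast+
    have reg: "regular_cardinal (ks (len t))" using ks_regular l by blast
    obtain C where C: "club_in C (ks (len t))" "C \<subseteq> OSucc r t" using t(2) unfolding sp_def club_splitting_def by blast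
    have "|ks ` {..<len t}| <o |{..<ks (len t)}|"
      using card_of_image card_below_lam[OF l(2)] card_lam_less_ks[OF l] ordLeq_ordLess_trans ordLess_transitive by meson
    moreover have "ks ` {..<len t} \<subseteq> {..<ks (len t)}" using ks_less l(2) by blast
    \<comment> \<open>Trimming costs only an initial segment of the club: there are fewer than
      \<open>ks (len t)\<close> earlier cardinals, so regularity bounds them below
      \<open>ks (len t)\<close>.\<close>
    ultimately obtain e where e: "e < ks (len t)" "\<forall>x\<in>ks ` {..<len t}. x < e" using regular_bounded[OF reg] by blast
    have "club_in (C \<inter> {e..}) (ks (len t))" using club_Int_atLeast[OF reg C(1) e(1)] .
    moreover have "C \<inter> {e..} \<subseteq> OSucc r' t"
    proof
      fix c assume c: "c \<in> C \<inter> {e..}"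
      have "ks b \<le> c" if "b < len t" for b
      proof -
        have "ks b < e" using e(2) that by blast
        moreover have "e \<le> c" using c by simp
        ultimately show ?thesis by simp
      qed
      then show "c \<in> OSucc r' t" using OS[OF t(1)] t(2) c C(2) by blast
    qed
    ultimately have "club_splitting ks r' (len t) t" unfolding club_splitting_def by blast
    moreover have "\<forall>c\<in>OSucc r' t. \<forall>b<len t. ks b \<le> c" using OS[OF t(1)] t(2) by blast
    ultimately show ?thesis using t(1) l(1) unfolding splits_def by blast
  qed
  have unsplit: "OSucc r' t = {the (W t (len t))}" if t: "t \<in> r'" "\<not> sp t" for t
  proof -
    have tr: "t \<in> r" "t \<in> N" using t sub rN by blast+
    have ne: "t \<noteq> W t" using W(1)[OF tr(1)] t(2) by metis
    have Wr: "W t \<in> r" using W(1)[OF tr(1)] unfolding sp_def by blast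
    note tow = OSucc_toward[OF M(1) Wr tr(2) W(2)[OF tr(1)] ne]
    have "c = the (W t (len t))" if "t(len t \<mapsto> c) \<subseteq>\<^sub>m W t" for c
    proof -
      have "len t \<in> dom (t(len t \<mapsto> c))" by simp
      then have "(t(len t \<mapsto> c)) (len t) = W t (len t)" using that unfolding map_le_def by blast
      then show ?thesis by (metis fun_upd_same option.sel)
    qed
    then show ?thesis using OS[OF t(1)] t(2) tow(1,3) by blast
  qed
  have splits_sp: "sp t" if t: "splits r' t" for t
  proof (rule ccontr)
    assume "\<not> sp t"
    then have "OSucc r' t = {the (W t (len t))}" using unsplit splits_mem[OF t] by blast
    then show False using splits_other[OF t r'N, of "the (W t (len t))"] by blast
  qed
  have lim: "u \<in> r'" if u: "u \<in> N" "limit_ordinal (len u)" "\<And>b. b < len u \<Longrightarrow> u |` {..<b} \<in> r'" for u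
  proof -
    have "u \<in> r" using limit_closed[OF M(2) u(1,2)] u(3) sub by blast
    moreover have "ok u b" if b: "b < len u" for b
    proof -
      obtain b' where b': "b < b'" "b' < len u" using u(2) b unfolding limit_ordinal_def by blast
      then have "len (u |` {..<b'}) = b'" using restrict_node(2)[OF u(1)] by simp
      then have "ok (u |` {..<b'}) b" using u(3)[OF b'(2)] b'(1) unfolding r'_def by simp
      then show ?thesis using ok_restrict[OF b'(1)] by blast
    qed
    ultimately show ?thesis unfolding r'_def by blast
  qed
  have closed: "lt_closed lam r'"
  proof (rule lt_closedI[OF r'N _ lim])
    show "OSucc r' t \<noteq> {}" if t: "t \<in> r'" for t
    proof (cases "sp t")
      case True
      then show ?thesis using splits_other[OF split[OF t True] r'N] by blast
    next
      case False then show ?thesis using unsplit[OF t] by blast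
    qed
  qed
  have ext: "\<exists>u. splits r' u \<and> t \<subseteq>\<^sub>m u" if t: "t \<in> r'" for t
  proof -
    have tr: "t \<in> r" "t \<in> N" using t sub rN by blast+
    define X where "X = W t"
    have X: "sp X" "t \<subseteq>\<^sub>m X" "X \<in> r" using W[OF tr(1)] unfolding X_def sp_def by blast+
    have XN: "X \<in> N" using X rN by blast
    let ?Q = "\<lambda>b. len t \<le> b \<and> b \<le> len X \<and> sp (X |` {..<b})"
    define b0 where "b0 = (LEAST b. ?Q b)"
    have "?Q (len X)" using X XN node_le_len[OF tr(2) XN X(2)] restrict_len[OF XN] by simp
    then have b0: "?Q b0" unfolding b0_def by (rule LeastI)
    let ?w = "X |` {..<b0}"
    have w: "?w \<in> N" "len ?w = b0" using restrict_node[OF XN] b0 by blast+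
    have tw: "t \<subseteq>\<^sub>m ?w" using nodes_below_comparable[OF tr(2) w(1) XN X(2) restrict_map_le] b0 w(2) by simp
    have "ok ?w b" if b: "b < b0" for b
    proof (cases "b < len t")
      case True
      have "t = ?w |` {..<len t}" using node_le_restrict[OF tr(2) w(1) tw] .
      moreover have "ok t b" using t True unfolding r'_def by blast
      ultimately show ?thesis using ok_restrict[OF True, of ?w] by simp
    next
      case False
      then have nq: "\<not> ?Q b" using not_less_Least[of b ?Q] b unfolding b0_def by blast
      have bX: "b \<le> len X" using b b0 less_le_trans less_imp_le by blast
      then have nsp: "\<not> sp (X |` {..<b})" using nq False by simp
      have Xb: "X |` {..<b} \<in> N" "len (X |` {..<b}) = b" using restrict_node[OF XN bX] by blast+
      have "t \<subseteq>\<^sub>m X |` {..<b}"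
        using nodes_below_comparable[OF tr(2) Xb(1) XN X(2) restrict_map_le] Xb(2) False by simp
      \<comment> \<open>Coherence of the choice: every node between \<open>t\<close> and its target
        \<open>X\<close> still has the target \<open>X\<close>, so following targets really leads
        along \<open>X\<close>.\<close>
      then have "W (X |` {..<b}) = X" using W_eq[OF tr(1)] restrict_map_le[of X] unfolding X_def by blast
      then have "ok X b" using nsp restrict_map_le[of X] unfolding ok_def by simp
      then show ?thesis using ok_restrict[OF b] by blast
    qed
    moreover have "?w \<in> r" using treeD(4)[OF M(1) X(3)] .
    ultimately have "?w \<in> r'" using w(2) unfolding r'_def by simp
    then have "splits r' ?w" using split b0 by blast
    then show ?thesis using tw by blast
  qed
  have lims: "splits r' u"
    if u: "u \<in> N" "limit_ordinal (len u)" "unbounded_in {b. splits r' (u |` {..<b})} (len u)" for u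
  proof -
    have "u |` {..<b} \<in> r'" if b: "b < len u" for b
    proof -
      obtain b' where b': "b \<le> b'" "splits r' (u |` {..<b'})" using u(3) b unfolding unbounded_in_def by blast
      have "u |` {..<b'} |` {..<b} \<in> r'" using treeD(4)[OF tree splits_mem[OF b'(2)]] .
      then show ?thesis using restrict_below(1)[OF b'(1), of u] by simp
    qed
    then have ur': "u \<in> r'" using lim u by blast
    \<comment> \<open>The splitting restrictions of \<open>u\<close>, indexed by their lengths, form
      a sequence as in the closure condition on \<open>r\<close>. The indices have gaps, so the
      condition is needed for unbounded index sets.\<close>
    let ?I = "{b. b < len u \<and> splits r' (u |` {..<b})}"
    have I: "?I \<subseteq> {..<len u}" "unbounded_in ?I (len u)" using u(3) unfolding unbounded_in_def by blast+
    have I1: "\<forall>a\<in>?I. u |` {..<a} \<in> r \<and> club_splitting ks r a (u |` {..<a})"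
    proof
      fix a assume a: "a \<in> ?I"
      then have "sp (u |` {..<a})" "len (u |` {..<a}) = a" using splits_sp restrict_node(2)[OF u(1)] by auto
      then show "u |` {..<a} \<in> r \<and> club_splitting ks r a (u |` {..<a})" unfolding sp_def by simp
    qed
    have I2: "\<forall>a\<in>?I. \<forall>b\<in>?I. a < b \<longrightarrow> u |` {..<a} \<subseteq>\<^sub>m u |` {..<b}"
      by (auto simp: map_le_def)
    obtain u' where u': "u' \<in> r" "Map.graph u' = (\<Union>a\<in>?I. Map.graph (u |` {..<a}))" "club_splitting ks r (len u) u'"
      using scl[OF nodeD(2)[OF u(1)] u(2) I I1 I2] by blast
    have "Map.graph u = (\<Union>a\<in>?I. Map.graph (u |` {..<a}))"
    proof (intro equalityI subsetI)
      fix x assume "x \<in> Map.graph u"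
      then obtain b c where x: "x = (b, c)" "u b = Some c" unfolding Map.graph_def by blast
      have "b \<in> dom u" using x by blast
      then have "b < len u" using nodeD(1)[OF u(1)] by simp
      then obtain b' where b': "b < b'" "b' < len u" using u(2) unfolding limit_ordinal_def by blast
      then obtain a where a: "a \<in> ?I" "b' \<le> a" using I(2) unfolding unbounded_in_def by blast
      have "b < a" using b' a by simp
      then have "(b, c) \<in> Map.graph (u |` {..<a})" using x unfolding Map.graph_def by simp
      then show "x \<in> (\<Union>a\<in>?I. Map.graph (u |` {..<a}))" using a(1) x(1) by blast
    next
      fix x assume "x \<in> (\<Union>a\<in>?I. Map.graph (u |` {..<a}))"
      then show "x \<in> Map.graph u" by (auto simp: Map.graph_def restrict_map_def split: if_splits)
    qed
    then have graph: "Map.graph u' = Map.graph u" using u'(2) by simp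
    have "u' b = Some c \<longleftrightarrow> u b = Some c" for b c
      using arg_cong[OF graph, of "\<lambda>G. (b, c) \<in> G"] unfolding Map.graph_def by simp
    then have "u' b = u b" for b by (metis not_None_eq)
    then have "u' = u" by blast
    moreover obtain b where "b \<in> ?I" using I(2) u(2) unfolding limit_ordinal_def unbounded_in_def by blast
    then have "a0 \<le> len u"
      using splits_sp[of "u |` {..<b}"] restrict_node(2)[OF u(1), of b] unfolding sp_def by auto
    ultimately have "sp u" using u' unfolding sp_def by simp
    then show ?thesis using split ur' by blast
  qed
  have "\<exists>!c. c \<in> OSucc r' t" if t: "t \<in> r'" "\<not> splits r' t" for t
  proof -
    have "\<not> sp t" using split t by blast
    then show ?thesis using unsplit[OF t(1)] by simp
  qed
  then have "normal_tree r'" unfolding normal_tree_def using tree closed ext lims by blast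
  then show ?thesis using sub by blast
qed

end


section \<open>Fusion\<close>

text \<open>One formula covers successor and limit steps: as the refinements by \<open>S\<close> decrease, the
  intersection at a successor is the last refinement.\<close>

function fusion ::
    "('o node set \<Rightarrow> 'o node \<Rightarrow> 'o node \<Rightarrow> 'o node set) \<Rightarrow> 'o node set \<Rightarrow> 'o node \<Rightarrow> 'o::wellorder \<Rightarrow> 'o node set"
  where
  "fusion S p t a = p \<inter> (\<Inter>b\<in>{..<a}. S (fusion S p t b) (t |` {..<b}) (t |` {..b}))"
  by pat_completeness auto
termination
  by (relation "inv_image {(b, a). b < a} (\<lambda>(S, p, t, a). a)") (auto simp: wf wf_inv_image)

declare fusion.simps [simp del]

lemma fusion_antimono: "b \<le> a \<Longrightarrow> fusion S p t a \<subseteq> fusion S p t b"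
  by (subst (1 2) fusion.simps) auto

lemma fusion_subset: "fusion S p t a \<subseteq> p"
  by (subst fusion.simps) auto

lemma fusion_step: "b < a \<Longrightarrow> fusion S p t a \<subseteq> S (fusion S p t b) (t |` {..<b}) (t |` {..b})"
  by (subst fusion.simps) auto

lemma fusion_cong: "t |` {..<a} = t' |` {..<a} \<Longrightarrow> fusion S p t a = fusion S p t' a"
proof (induction a rule: less_induct)
  case (less a)
  have "t |` {..<b} = t' |` {..<b}" "t |` {..b} = t' |` {..b}" if b: "b < a" for b
    using restrict_below[of b a t] restrict_below[of b a t'] less.prems b by simp_all
  then have "(\<Inter>b\<in>{..<a}. S (fusion S p t b) (t |` {..<b}) (t |` {..b})) =
      (\<Inter>b\<in>{..<a}. S (fusion S p t' b) (t' |` {..<b}) (t' |` {..b}))"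
    using less.IH by (intro INF_cong) auto
  then show ?case by (subst (1 2) fusion.simps) simp
qed

locale miller_fusion = large_sequence kap lam ks a0
  for kap lam :: "'o::wellorder" and ks a0 +
  fixes p0 :: "'o node set" and D :: "'o \<Rightarrow> 'o \<Rightarrow> 'o node set \<Rightarrow> bool"
  assumes p0: "normal_tree p0"
    and D_mono: "D \<alpha> \<nu> r \<Longrightarrow> r' \<subseteq> r \<Longrightarrow> D \<alpha> \<nu> r'"
    and D_dense: "\<alpha> < lam \<Longrightarrow> normal_tree r \<Longrightarrow> r \<subseteq> p0 \<Longrightarrow> \<exists>r'. normal_tree r' \<and> r' \<subseteq> r \<and> (\<exists>\<nu>. D \<alpha> \<nu> r')"
begin

section \<open>Refinement at splitting nodes\<close>

definition decided :: "'o \<Rightarrow> 'o node set \<Rightarrow> bool" where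
  "decided \<alpha> r \<longleftrightarrow> (\<exists>\<nu>. D \<alpha> \<nu> r)"

text \<open>The conjunct \<open>\<alpha> < lam\<close> gives the default value \<open>lam\<close>
  once every argument is decided.\<close>

definition first_undecided :: "'o node set \<Rightarrow> 'o" where
  "first_undecided r = (LEAST \<alpha>. \<not> (\<alpha> < lam \<and> decided \<alpha> r))"

definition decide :: "'o \<Rightarrow> 'o node set \<Rightarrow> 'o node set" where
  "decide \<alpha> r = (SOME r'. normal_tree r' \<and> r' \<subseteq> r \<and> decided \<alpha> r')"

text \<open>Here \<open>v\<close> is the node after \<open>u\<close> on the branch being followed.
  Passing to its cone first guarantees that \<open>v\<close> survives the decision and lets
  different successors of \<open>u\<close> be refined independently.\<close>

definition refine :: "'o node set \<Rightarrow> 'o node \<Rightarrow> 'o node \<Rightarrow> 'o node set" where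
  "refine r u v = (if splits r u
     then if first_undecided r < lam then decide (first_undecided r) (cone r v) else cone r v
     else r)"

abbreviation "R \<equiv> fusion refine p0"

text \<open>The tree consulted at \<open>b\<close> depends only on \<open>t\<close> below
  \<open>b\<close>, whereas the node tested in it is one step longer.\<close>

definition fused :: "'o node set" where
  "fused = {t \<in> N. \<forall>b<len t. t |` {..b} \<in> R t b}"

lemma decided_mono: "decided \<alpha> r \<Longrightarrow> r' \<subseteq> r \<Longrightarrow> decided \<alpha> r'"
  unfolding decided_def using D_mono by blast

lemma decide:
  assumes "\<alpha> < lam" "normal_tree r" "r \<subseteq> p0"
  shows "normal_tree (decide \<alpha> r)" "decide \<alpha> r \<subseteq> r" "decided \<alpha> (decide \<alpha> r)"
proof -
  have "\<exists>r'. normal_tree r' \<and> r' \<subseteq> r \<and> decided \<alpha> r'" using D_dense[OF assms] unfolding decided_def .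
  from someI_ex[OF this] show "normal_tree (decide \<alpha> r)" "decide \<alpha> r \<subseteq> r" "decided \<alpha> (decide \<alpha> r)"
    unfolding decide_def by blast+
qed

text \<open>A splitting node of \<open>r'\<close> also splits in the cone, hence lies above
  \<open>v\<close>; downward closure then puts \<open>v\<close> into \<open>r'\<close>.\<close>

lemma root_mem_subcone:
  assumes r: "normal_tree r" and v: "v \<in> r" and r': "normal_tree r'" "r' \<subseteq> cone r v"
  shows "v \<in> r'"
proof -
  obtain w where w: "splits r' w" using normal_treeD(5)[OF r'(1) treeD(6)[OF normal_treeD(1)[OF r'(1)]]] by blast
  then have "splits (cone r v) w" using splits_mono[OF normal_tree_cone[OF r v] r'(2)] by blast
  then have "v \<subseteq>\<^sub>m w" using splits_cone_iff[OF r v] by blast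
  moreover have "v \<in> N" using v normal_treeD(3)[OF r] by blast
  ultimately show ?thesis using treeD(2)[OF normal_treeD(1)[OF r'(1)] splits_mem[OF w]] by blast
qed

lemma refine:
  assumes r: "normal_tree r" "r \<subseteq> p0" and v: "v \<in> r"
  shows "normal_tree (refine r u v)" "refine r u v \<subseteq> r" "v \<in> refine r u v"
proof -
  have c: "normal_tree (cone r v)" "cone r v \<subseteq> p0" "cone r v \<subseteq> r"
    using normal_tree_cone[OF r(1) v] cone_subset r(2) by blast+
  note d = decide[OF _ c(1,2)]
  show "normal_tree (refine r u v)" using c(1) d(1) r(1) unfolding refine_def by simp
  have "refine r u v = r \<or> refine r u v \<subseteq> cone r v" using d(2) unfolding refine_def by simp
  then show "refine r u v \<subseteq> r" using c(3) by blast
  show "v \<in> refine r u v"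
    using \<open>refine r u v = r \<or> refine r u v \<subseteq> cone r v\<close>
      root_mem_subcone[OF r(1) v \<open>normal_tree (refine r u v)\<close>] v by blast
qed

text \<open>Both conclusions are proved together: refining at \<open>b\<close> requires a normal
  tree containing the next node of \<open>t\<close>, and limit membership uses closure of the
  earlier trees.\<close>

lemma fusion_normal:
  assumes t: "t \<in> N"
  shows "a \<le> len t \<Longrightarrow> (\<And>b. b < a \<Longrightarrow> t |` {..b} \<in> R t b) \<Longrightarrow> normal_tree (R t a) \<and> t |` {..<a} \<in> R t a"
proof (induction a rule: less_induct)
  case (less a)
  have al: "a < lam" using less.prems(1) nodeD(2)[OF t] by simp
  have IH: "normal_tree (R t b)" "t |` {..<b} \<in> R t b" if b: "b < a" for b
  proof -
    have "b \<le> len t" using b less.prems(1) by simp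
    moreover have "t |` {..c} \<in> R t c" if "c < b" for c using less.prems(2) that b less_trans by blast
    ultimately show "normal_tree (R t b)" "t |` {..<b} \<in> R t b" using less.IH[OF b] by blast+
  qed
  define S where "S b = refine (R t b) (t |` {..<b}) (t |` {..b})" for b
  have S: "normal_tree (S b)" "S b \<subseteq> R t b" "t |` {..b} \<in> S b" if b: "b < a" for b
    unfolding S_def using refine[OF IH(1)[OF b] fusion_subset less.prems(2)[OF b]] by blast+
  have SR: "R t c \<subseteq> S b" if "b < c" for b c
    unfolding S_def using fusion_step[OF that] .
  \<comment> \<open>Including \<open>p0\<close> keeps the family nonempty when \<open>a\<close> is
    the least ordinal.\<close>
  let ?F = "insert p0 (S ` {..<a})"
  have Ra: "R t a = \<Inter>?F" by (subst fusion.simps) (auto simp: S_def)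
  have normal: "normal_tree (\<Inter>?F)"
  proof (rule normal_tree_Inter)
    have "|S ` {..<a}| <o |{..<lam}|" using card_of_image card_below_lam[OF al] ordLeq_ordLess_trans by blast
    moreover have "|{p0}| <o |{..<lam}|" using infinite_lam by (simp add: card_of_finite_ordLess_infinite)
    ultimately have "|{p0} \<union> S ` {..<a}| <o |{..<lam}|"
      using card_of_Un_ordLess_infinite[OF infinite_lam] by blast
    then show "|?F| <o |{..<lam}|" by simp
    show "normal_tree r" if "r \<in> ?F" for r using that p0 S(1) by blast
    have Sp: "S b \<subseteq> p0" if "b < a" for b using S(2)[OF that] fusion_subset by blast
    have SS: "S c \<subseteq> S b" if "b < c" "c < a" for b c using S(2)[OF that(2)] SR[OF that(1)] by blast
    show "r \<subseteq> r' \<or> r' \<subseteq> r" if rr: "r \<in> ?F" "r' \<in> ?F" for r r'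
    proof (cases "r = p0 \<or> r' = p0")
      case True then show ?thesis using rr Sp by auto
    next
      case False
      then obtain b c where "b < a" "c < a" "r = S b" "r' = S c" using rr by blast
      then show ?thesis using SS[of b c] SS[of c b] by (cases b c rule: linorder_cases) auto
    qed
  qed simp
  have "t |` {..<a} \<in> R t a"
  proof (cases a rule: next_ord_or_limit)
    case 1
    then have "t |` {..<a} = Map.empty" by (simp add: lessThan_def)
    then show ?thesis using treeD(6)[OF normal_treeD(1)[OF normal]] Ra by simp
  next
    case (2 b)
    have eq: "t |` {..<a} = t |` {..b}" using 2 lessThan_next_ord by metis
    have "t |` {..b} \<in> S c" if c: "c < a" for c
    proof (cases "c = b")
      case True then show ?thesis using S(3)[OF c] by simp
    next
      case False
      then have "c < b" using c 2 less_next_ord_iff[OF 2(1)] by (metis order_le_less)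
      then show ?thesis using SR less.prems(2)[OF 2(1)] by blast
    qed
    moreover have "t |` {..b} \<in> p0" using less.prems(2)[OF 2(1)] fusion_subset by blast
    ultimately show ?thesis unfolding eq Ra by blast
  next
    case 3
    have u: "t |` {..<a} \<in> N" "len (t |` {..<a}) = a" using restrict_node[OF t less.prems(1)] by blast+
    \<comment> \<open>A tail of the attached trees lies inside \<open>r\<close>, hence so does a
      tail of the restrictions of \<open>t\<close>, and \<open>r\<close> is closed under
      limits.\<close>
    have mem: "t |` {..<a} \<in> r" if r: "normal_tree r" and b: "b < a" and sub: "\<And>c. b < c \<Longrightarrow> R t c \<subseteq> r" for r b
    proof (rule limit_closed[OF normal_treeD(2)[OF r] u(1)])
      show "limit_ordinal (len (t |` {..<a}))" using 3 u(2) by simp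
      fix c assume "c < len (t |` {..<a})"
      then have c: "c < a" using u(2) by simp
      then have "max b c < a" using b by simp
      then obtain e where e: "max b c < e" "e < a" using 3 unfolding limit_ordinal_def by blast
      then have ce: "b < e" "c < e" by simp_all
      then have "t |` {..<e} \<in> r" using IH(2)[OF e(2)] sub by blast
      then have "t |` {..<e} |` {..<c} \<in> r" using treeD(4)[OF normal_treeD(1)[OF r]] by blast
      then show "t |` {..<a} |` {..<c} \<in> r"
        using restrict_below(1)[of c e t] restrict_below(1)[of c a t] ce c by simp
    qed
    obtain b where b: "b < a" using 3 unfolding limit_ordinal_def by blast
    have "t |` {..<a} \<in> p0" using mem[OF p0 b fusion_subset] .
    moreover have "t |` {..<a} \<in> S c" if c: "c < a" for c using mem[OF S(1)[OF c] c SR] .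
    ultimately show ?thesis unfolding Ra by blast
  qed
  then show ?case using normal Ra by simp
qed

section \<open>The fused tree is normal\<close>

lemma fused_fusion:
  assumes "t \<in> fused"
  shows "t \<in> N" "normal_tree (R t (len t))" "t \<in> R t (len t)" "b \<le> len t \<Longrightarrow> normal_tree (R t b)"
proof -
  show t: "t \<in> N" using assms unfolding fused_def by blast
  have v: "t |` {..b} \<in> R t b" if "b < len t" for b using assms that unfolding fused_def by blast
  show "normal_tree (R t (len t))" "t \<in> R t (len t)"
    using fusion_normal[OF t order_refl v] restrict_len[OF t order_refl] by simp_all
  show "b \<le> len t \<Longrightarrow> normal_tree (R t b)"
    using fusion_normal[OF t, of b] v less_le_trans by blast
qed

lemma R_initial: "s \<in> N \<Longrightarrow> t \<in> N \<Longrightarrow> s \<subseteq>\<^sub>m t \<Longrightarrow> b \<le> len s \<Longrightarrow> R t b = R s b"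
  using node_le_restrict[of s t] restrict_below(1)[of b "len s" t] by (intro fusion_cong) metis

lemma fused_subset_N: "fused \<subseteq> N"
  unfolding fused_def by blast

text \<open>A one-step extension of \<open>t\<close> has to pass only one new test, that of the tree
  attached to \<open>t\<close>; the earlier tests concern initial segments of \<open>t\<close>. So
  splitting in \<open>fused\<close> at \<open>t\<close> is splitting in that tree.\<close>

lemma OSucc_fused:
  assumes t: "t \<in> fused" shows "OSucc fused t = OSucc (R t (len t)) t"
proof (intro equalityI subsetI)
  note F = fused_fusion[OF t]
  fix c assume "c \<in> OSucc fused t"
  then have u: "t(len t \<mapsto> c) \<in> fused" unfolding OSucc_def by blast
  then have uN: "t(len t \<mapsto> c) \<in> N" using fused_subset_N by blast
  have "t(len t \<mapsto> c) \<noteq> t" using node_None[OF F(1)] by (metis fun_upd_same option.distinct(1) order_refl)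
  then have "len t < len (t(len t \<mapsto> c))" using node_le_less[OF F(1) uN extend_restrict(4)[OF F(1)]] by metis
  then have "(t(len t \<mapsto> c)) |` {..len t} \<in> R (t(len t \<mapsto> c)) (len t)" using u unfolding fused_def by blast
  then show "c \<in> OSucc (R t (len t)) t"
    using extend_restrict(3)[OF F(1), of c] R_initial[OF F(1) uN extend_restrict(4)[OF F(1)] order_refl]
    unfolding OSucc_def by simp
next
  note F = fused_fusion[OF t]
  fix c assume "c \<in> OSucc (R t (len t)) t"
  then have u: "t(len t \<mapsto> c) \<in> R t (len t)" unfolding OSucc_def by blast
  then have uN: "t(len t \<mapsto> c) \<in> N" using normal_treeD(3)[OF F(2)] by blast
  have "c < ks (len t)" using u OSucc_subset[OF normal_treeD(3)[OF F(2)] F(1)] unfolding OSucc_def by blast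
  then have len: "len (t(len t \<mapsto> c)) = next_ord (len t)" using extend_node(2)[OF F(1)] by blast
  note Ri = R_initial[OF F(1) uN extend_restrict(4)[OF F(1)]]
  have "(t(len t \<mapsto> c)) |` {..b} \<in> R (t(len t \<mapsto> c)) b" if b: "b < len (t(len t \<mapsto> c))" for b
  proof (cases "b = len t")
    case True
    then show ?thesis using u extend_restrict(3)[OF F(1), of c] Ri[OF order_refl] by simp
  next
    case False
    then have b': "b < len t" using b len less_next(3)[OF nodeD(2)[OF F(1)]] by (metis order_le_less)
    then have "t |` {..b} \<in> R t b" using t unfolding fused_def by blast
    then show ?thesis using extend_restrict(2)[OF F(1) b', of c] Ri[OF less_imp_le[OF b']] by metis
  qed
  then show "c \<in> OSucc fused t" using uN unfolding OSucc_def fused_def by blast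
qed

lemma splits_fused_iff: "t \<in> fused \<Longrightarrow> splits fused t \<longleftrightarrow> splits (R t (len t)) t"
  using splits_cong[of fused t "R t (len t)"] splits_cong[of "R t (len t)" t fused]
    OSucc_fused[of t] fused_fusion(3)[of t] by metis

lemma fused_tree: "is_tree lam ks fused"
  unfolding is_tree_def
proof (intro conjI ballI impI)
  show "fused \<subseteq> N" by (rule fused_subset_N)
  obtain z :: 'o where "\<forall>a. z \<le> a" using zero_less_lam by blast
  then have z: "dom (Map.empty :: 'o node) = {..<z}" using not_less by auto
  then have "len (Map.empty :: 'o node) = z" using len_eq by blast
  moreover have "Map.empty \<in> N" using treeD(6)[OF normal_treeD(1)[OF p0]] normal_treeD(3)[OF p0] by blast
  ultimately have "Map.empty \<in> fused" using z unfolding fused_def by auto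
  then show "fused \<noteq> {}" by blast
  fix t s assume t: "t \<in> fused" and s: "s \<in> N" "s \<subseteq>\<^sub>m t"
  have tN: "t \<in> N" using t fused_subset_N by blast
  have "s |` {..b} \<in> R s b" if b: "b < len s" for b
  proof -
    have "t |` {..b} \<in> R t b" using t b node_le_len[OF s(1) tN s(2)] unfolding fused_def by simp
    moreover have "s |` {..b} = t |` {..b}"
      using node_le_restrict[OF s(1) tN s(2)] restrict_below(2)[OF b, of t] by metis
    ultimately show ?thesis using R_initial[OF s(1) tN s(2) less_imp_le[OF b]] by simp
  qed
  then show "s \<in> fused" using s(1) unfolding fused_def by blast
qed

lemma fused_limit:
  assumes u: "u \<in> N" "limit_ordinal (len u)" "\<And>b. b < len u \<Longrightarrow> u |` {..<b} \<in> fused"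
  shows "u \<in> fused"
proof -
  have "u |` {..b} \<in> R u b" if b: "b < len u" for b
  proof -
    obtain b' where b': "b < b'" "b' < len u" using u(2) b unfolding limit_ordinal_def by blast
    have v: "u |` {..<b'} \<in> N" "len (u |` {..<b'}) = b'" using restrict_node[OF u(1)] b'(2) by simp_all
    then have "u |` {..<b'} |` {..b} \<in> R (u |` {..<b'}) b" using u(3)[OF b'(2)] b'(1) unfolding fused_def by simp
    moreover have "R u b = R (u |` {..<b'}) b"
      using R_initial[OF v(1) u(1) restrict_map_le, of b] v(2) b'(1) by simp
    ultimately show ?thesis using restrict_below(2)[OF b'(1), of u] by simp
  qed
  then show ?thesis using u(1) unfolding fused_def by blast
qed

text \<open>Refinement is idle at nodes that do not split. Up to the first splitting node
  \<open>w\<close> of the tree attached to \<open>t\<close> the attached tree stays the same, so the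
  whole path to \<open>w\<close> passes the tests.\<close>

lemma fused_extend:
  assumes t: "t \<in> fused" shows "\<exists>u. splits fused u \<and> t \<subseteq>\<^sub>m u"
proof -
  define r where "r = R t (len t)"
  note F = fused_fusion(1-3)[OF t, folded r_def]
  obtain w where w: "splits r w" "t \<subseteq>\<^sub>m w" "\<And>b. len t \<le> b \<Longrightarrow> b < len w \<Longrightarrow> \<not> splits r (w |` {..<b})"
    using minimal_split[OF F(2,3)] by blast
  have wN: "w \<in> N" using splits_mem[OF w(1)] normal_treeD(3)[OF F(2)] by blast
  have Rt: "R w b = R t b" if "b \<le> len t" for b using R_initial[OF F(1) wN w(2) that] .
  have Rw: "len t \<le> b \<Longrightarrow> b \<le> len w \<Longrightarrow> R w b = r" for b
  proof (induction b rule: less_induct)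
    case (less b)
    have "R w b \<subseteq> r" using fusion_antimono[OF less.prems(1), of refine p0 w] Rt[OF order_refl] unfolding r_def by simp
    moreover have "r \<subseteq> R w b"
    proof -
      have "r \<subseteq> refine (R w c) (w |` {..<c}) (w |` {..c})" if c: "c < b" for c
      proof (cases "c < len t")
        case True
        then show ?thesis using fusion_step[OF True, of refine p0 w] Rt[OF order_refl] unfolding r_def by simp
      next
        case False
        then have c': "len t \<le> c" "c < len w" using c less.prems(2) by simp_all
        then have "R w c = r" using less.IH[OF c] by simp
        then show ?thesis using w(3)[OF c'] unfolding refine_def by simp
      qed
      moreover have "r \<subseteq> p0" using fusion_subset unfolding r_def .
      ultimately show ?thesis by (subst fusion.simps) blast
    qed
    ultimately show ?case by blast
  qed
  have "w |` {..b} \<in> R w b" if b: "b < len w" for b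
  proof (cases "b < len t")
    case True
    then have "t |` {..b} \<in> R t b" using t unfolding fused_def by blast
    moreover have "t |` {..b} = w |` {..b}"
      using node_le_restrict[OF F(1) wN w(2)] restrict_below(2)[OF True, of w] by metis
    ultimately show ?thesis using Rt[OF less_imp_le[OF True]] by simp
  next
    case False
    then have "R w b = r" using Rw b by simp
    then show ?thesis using treeD(5)[OF normal_treeD(1)[OF F(2)] splits_mem[OF w(1)]] by simp
  qed
  then have wf: "w \<in> fused" using wN unfolding fused_def by blast
  have "R w (len w) = r" using Rw node_le_len[OF F(1) wN w(2)] by simp
  then have "splits fused w" using splits_fused_iff[OF wf] w(1) by simp
  then show ?thesis using w(2) by blast
qed

text \<open>At a limit the attached tree is the intersection of the earlier attached trees. Each of
  these contains the later ones, so splitting nodes of \<open>fused\<close> are cofinal below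
  \<open>u\<close> in it, and \<open>u\<close> splits there. Fewer than \<open>lam\<close> many
  trees are involved.\<close>

lemma fused_splits_limit:
  assumes u: "u \<in> N" "limit_ordinal (len u)" "unbounded_in {b. splits fused (u |` {..<b})} (len u)"
  shows "splits fused u"
proof -
  have "u |` {..<b} \<in> fused" if b: "b < len u" for b
  proof -
    obtain b' where b': "b \<le> b'" "splits fused (u |` {..<b'})" using u(3) b unfolding unbounded_in_def by blast
    have "u |` {..<b'} |` {..<b} \<in> fused" using treeD(4)[OF fused_tree splits_mem[OF b'(2)]] .
    then show ?thesis using restrict_below(1)[OF b'(1), of u] by simp
  qed
  then have uf: "u \<in> fused" using fused_limit u by blast
  let ?F = "R u ` {..<len u}"
  have "R u (len u) = \<Inter>?F"
  proof
    show "R u (len u) \<subseteq> \<Inter>?F" using fusion_antimono[of _ "len u" refine p0 u] by (auto dest: less_imp_le)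
    have "\<Inter>?F \<subseteq> refine (R u b) (u |` {..<b}) (u |` {..b})" if b: "b < len u" for b
    proof -
      obtain b' where b': "b < b'" "b' < len u" using u(2) b unfolding limit_ordinal_def by blast
      then have "\<Inter>?F \<subseteq> R u b'" by blast
      then show ?thesis using fusion_step[OF b'(1), of refine p0 u] by blast
    qed
    moreover obtain b where "b < len u" using u(2) unfolding limit_ordinal_def by blast
    then have "\<Inter>?F \<subseteq> p0" using fusion_subset[of refine p0 u b] by auto
    ultimately show "\<Inter>?F \<subseteq> R u (len u)"
      unfolding fusion.simps[of refine p0 u "len u"] by blast
  qed
  moreover have "splits (\<Inter>?F) u"
  proof (rule splits_Inter[OF _ _ _ u(1)])
    show "?F \<noteq> {}" using u(2) unfolding limit_ordinal_def by blast
    show "|?F| <o |{..<lam}|"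
      using card_of_image card_below_lam[OF nodeD(2)[OF u(1)]] ordLeq_ordLess_trans by blast
    fix r assume "r \<in> ?F"
    then obtain b where b: "b < len u" "r = R u b" by blast
    then have normal: "normal_tree r" using fused_fusion(4)[OF uf, of b] by simp
    have "unbounded_in {c. splits r (u |` {..<c})} (len u)"
      unfolding unbounded_in_def
    proof (intro allI impI)
      fix x assume "x < len u"
      then have "max x b < len u" using b(1) by simp
      then obtain c where c: "max x b \<le> c" "c < len u" "splits fused (u |` {..<c})"
        using u(3) unfolding unbounded_in_def by blast
      have v: "u |` {..<c} \<in> N" "len (u |` {..<c}) = c" using restrict_node[OF u(1)] c(2) by simp_all
      have "splits (R (u |` {..<c}) c) (u |` {..<c})"
        using c(3) splits_fused_iff[OF splits_mem[OF c(3)]] v(2) by simp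
      moreover have "R u c = R (u |` {..<c}) c" using R_initial[OF v(1) u(1) restrict_map_le, of c] v(2) by simp
      ultimately have "splits (R u c) (u |` {..<c})" by simp
      moreover have "R u c \<subseteq> r" using fusion_antimono[of b c refine p0 u] c(1) b(2) by simp
      ultimately have "splits r (u |` {..<c})" using splits_mono[OF normal] by blast
      then show "\<exists>c\<in>{c. splits r (u |` {..<c})}. x \<le> c \<and> c < len u"
        using c by (intro bexI[of _ c]) auto
    qed
    then show "splits r u" using normal_treeD(6)[OF normal u(1,2)] by blast
  qed
  ultimately show ?thesis using splits_fused_iff[OF uf] by simp
qed

lemma fused_normal: "normal_tree fused"
proof -
  have succ: "splits fused t \<or> (\<exists>!c. c \<in> OSucc fused t)" if t: "t \<in> fused" for t
    using normal_treeD(4)[OF fused_fusion(2,3)[OF t]] splits_fused_iff[OF t] OSucc_fused[OF t] by metis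
  have "lt_closed lam fused"
  proof (rule lt_closedI[OF fused_subset_N _ fused_limit])
    show "OSucc fused t \<noteq> {}" if t: "t \<in> fused" for t
      using succ[OF t] splits_other[OF _ fused_subset_N] by blast
  qed
  then show ?thesis
    unfolding normal_tree_def using fused_tree succ fused_extend fused_splits_limit by blast
qed

lemma fused_subset: "fused \<subseteq> p0"
  using fused_fusion(3) fusion_subset by blast

text \<open>Whatever the tree attached to \<open>t\<close> decides is thereby decided by
  \<open>fused\<close> restricted to the cone of \<open>t\<close>.\<close>

lemma fused_cone_subset:
  assumes t: "t \<in> fused" shows "cone fused t \<subseteq> R t (len t)"
proof
  note F = fused_fusion[OF t]
  fix u assume "u \<in> cone fused t"
  then have u: "u \<in> fused" "u \<subseteq>\<^sub>m t \<or> t \<subseteq>\<^sub>m u" unfolding cone_def by blast+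
  note G = fused_fusion[OF u(1)]
  show "u \<in> R t (len t)"
  proof (cases "t \<subseteq>\<^sub>m u")
    case True
    then have "R u (len t) = R t (len t)" "len t \<le> len u"
      using R_initial[OF F(1) G(1) True order_refl] node_le_len[OF F(1) G(1)] by blast+
    then show ?thesis using G(3) fusion_antimono[of "len t" "len u" refine p0 u] by blast
  next
    case False
    then show ?thesis using treeD(2)[OF normal_treeD(1)[OF F(2)] F(3) G(1)] u(2) by blast
  qed
qed

text \<open>The first undecided argument grows strictly along the splitting nodes.\<close>

lemma fused_decides:
  assumes r: "normal_tree r" "r \<subseteq> fused" and \<alpha>: "\<alpha> < lam"
  shows "\<exists>t. splits r t \<and> decided \<alpha> (R t (len t))"
proof (rule ccontr)
  assume none: "\<not> ?thesis"
  \<comment> \<open>If no tree attached to a splitting node of \<open>r\<close> decided \<alpha>,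
    this rank would never exceed \<alpha>, against its strict growth along splitting nodes.\<close>
  define g where "g t = first_undecided (R t (len t))" for t
  have g_le: "g t \<le> \<alpha>" if "splits r t" for t
    unfolding g_def first_undecided_def using none that by (intro Least_le) blast
  have "\<exists>t. splits r t \<and> Map.empty \<subseteq>\<^sub>m t \<and> next_ord \<alpha> \<le> g t"
  proof (rule splits_rank_unbounded[OF r(1) treeD(6)[OF normal_treeD(1)[OF r(1)]] less_next(2)[OF \<alpha>]])
    fix t t' assume t: "splits r t" "splits r t'" "t \<subseteq>\<^sub>m t'" "t \<noteq> t'"
    have q: "t \<in> fused" "t' \<in> fused" using splits_mem t(1,2) r(2) by blast+
    note F = fused_fusion[OF q(1)] and F' = fused_fusion[OF q(2)]
    define \<rho> where "\<rho> = R t (len t)"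
    have l: "len t < len t'" using node_le_less[OF F(1) F'(1) t(3,4)] .
    have eq: "R t' (len t) = \<rho>" unfolding \<rho>_def using R_initial[OF F(1) F'(1) t(3) order_refl] .
    have "splits fused t" using splits_mono[OF fused_normal r(2) t(1)] .
    then have sp: "splits \<rho> t" using splits_fused_iff[OF q(1)] unfolding \<rho>_def by blast
    have lt: "first_undecided \<rho> < lam" using g_le[OF t(1)] \<alpha> unfolding g_def \<rho>_def by simp
    let ?v = "t' |` {..len t}"
    have v: "?v \<in> \<rho>" using q(2) l eq unfolding fused_def by auto
    \<comment> \<open>The refinement made when leaving \<open>t\<close> towards \<open>t'\<close>
      decides the argument that was the first undecided one at \<open>t\<close>.\<close>
    have "R t' (len t') \<subseteq> refine \<rho> t ?v"
      using fusion_step[OF l, of refine p0 t'] node_le_restrict[OF F(1) F'(1) t(3)] eq by simp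
    moreover have "refine \<rho> t ?v = decide (first_undecided \<rho>) (cone \<rho> ?v)"
      using sp lt unfolding refine_def by simp
    moreover have "normal_tree \<rho>" using F(2) unfolding \<rho>_def .
    then have "normal_tree (cone \<rho> ?v)" using normal_tree_cone v by blast
    moreover have "cone \<rho> ?v \<subseteq> p0" using cone_subset fusion_subset unfolding \<rho>_def by blast
    ultimately have "decided (first_undecided \<rho>) (R t' (len t'))"
      using decide(3)[OF lt] decided_mono by metis
    moreover have "decided \<beta> (R t' (len t'))" "\<beta> < lam" if \<beta>: "\<beta> < first_undecided \<rho>" for \<beta>
    proof -
      have d: "\<beta> < lam \<and> decided \<beta> \<rho>"
        using not_less_Least[of \<beta> "\<lambda>\<alpha>. \<not> (\<alpha> < lam \<and> decided \<alpha> \<rho>)"] \<beta> unfolding first_undecided_def by blast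
      have "R t' (len t') \<subseteq> \<rho>" using fusion_antimono[OF less_imp_le[OF l], of refine p0 t'] eq by simp
      then show "decided \<beta> (R t' (len t'))" "\<beta> < lam" using d decided_mono by blast+
    qed
    ultimately have all: "\<beta> < lam \<and> decided \<beta> (R t' (len t'))" if "\<beta> \<le> first_undecided \<rho>" for \<beta>
      using lt that by (metis order_le_less)
    have "\<not> (g t' < lam \<and> decided (g t') (R t' (len t')))"
      unfolding g_def first_undecided_def by (rule LeastI[of _ lam]) simp
    then have "\<not> g t' \<le> first_undecided \<rho>" using all by blast
    then show "g t < g t'" unfolding g_def[of t] \<rho>_def[symmetric] by simp
  qed
  then obtain t where "splits r t" "next_ord \<alpha> \<le> g t" by blast
  then show False using g_le less_next(1)[OF \<alpha>] by (meson leD order_trans)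
qed

text \<open>For a normal tree \<open>r\<close> inside \<open>fused\<close>, its cone at a suitable
  splitting node lies inside the tree attached to that node and so decides the value chosen there,
  which does not depend on \<open>r\<close>.\<close>

lemma fused_values:
  obtains X where "|X| \<le>o |{..<kap}|"
    "\<forall>r \<alpha>. normal_tree r \<longrightarrow> r \<subseteq> fused \<longrightarrow> \<alpha> < lam \<longrightarrow>
      (\<exists>r'. normal_tree r' \<and> r' \<subseteq> r \<and> (\<exists>\<nu>\<in>X. D \<alpha> \<nu> r'))"
proof -
  define v where "v \<alpha> t = (SOME \<nu>. D \<alpha> \<nu> (R t (len t)))" for \<alpha> t
  let ?X = "\<Union>\<alpha>\<in>{..<lam}. v \<alpha> ` N"
  have "\<exists>r'. normal_tree r' \<and> r' \<subseteq> r \<and> (\<exists>\<nu>\<in>?X. D \<alpha> \<nu> r')"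
    if r: "normal_tree r" "r \<subseteq> fused" and \<alpha>: "\<alpha> < lam" for r \<alpha>
  proof -
    obtain t where t: "splits r t" "decided \<alpha> (R t (len t))" using fused_decides[OF r \<alpha>] by blast
    have tr: "t \<in> r" "t \<in> fused" "t \<in> N" using splits_mem[OF t(1)] r(2) fused_subset_N by blast+
    have "D \<alpha> (v \<alpha> t) (R t (len t))" using someI_ex[OF t(2)[unfolded decided_def]] unfolding v_def .
    moreover have "cone r t \<subseteq> R t (len t)"
      using fused_cone_subset[OF tr(2)] r(2) unfolding cone_def by blast
    ultimately have "D \<alpha> (v \<alpha> t) (cone r t)" using D_mono by blast
    then show ?thesis
      using normal_tree_cone[OF r(1) tr(1)] cone_subset[of r t] tr(3) \<alpha> by blast
  qed
  then show ?thesis using that[of ?X] card_node_values[of v] by simp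
qed

end


theorem theorem3p8:
  fixes kap lam kap_plus :: "'o::wellorder"
    and ks :: "'o \<Rightarrow> 'o"
    and P :: "'o node set set"
    and p :: "'o node set"
    and f :: "('o + 'i, 'o node set) pname"
  assumes "singular_cardinal kap"
    and "lam = cof kap"
    and "natLeq <o |{..<lam}|"
    and "\<forall>tau<kap. is_cardinal tau \<longrightarrow> |{..<tau}| ^c |{..<lam}| <o |{..<kap}|"
    and "\<forall>a b. a < b \<and> b < lam \<longrightarrow> ks a < ks b"
    and "\<forall>a<lam. regular_cardinal (ks a)"
    and "\<forall>a<lam. ks a \<le> kap"
    and "\<forall>u. (\<forall>a<lam. ks a \<le> u) \<longrightarrow> kap \<le> u"
    and "is_card_succ kap kap_plus"
    and "P = scl_M_club lam ks \<or> P = L_club lam ks"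
    and "p \<in> P"
    and "is_name P f"
    and "forces P (\<subseteq>)
           (FFunction f (check (all_nodes lam ks) lam) (check (all_nodes lam ks) kap_plus)) p"
  shows "\<exists>x q. |x| \<le>o |{..<kap}| \<and> q \<in> P \<and> q \<subseteq> p \<and>
           forces P (\<subseteq>) (FRangeSubset f (check_set (all_nodes lam ks) x)) q"
proof -
  let ?one = "all_nodes lam ks"
  interpret forcing_order P "(\<subseteq>)" by unfold_locales auto
  interpret singular_sequence kap lam ks using assms(1-8) by unfold_locales
  have one: "\<forall>r\<in>P. r \<subseteq> ?one"
    using assms(10) unfolding scl_M_club_def M_club_def L_club_def is_tree_def by blast
  \<comment> \<open>Two distinct indices for the names of pairs, provided by the summand
    \<open>'o\<close>.\<close>
  have ij: "(Inl kap :: 'o + 'i) \<noteq> Inl lam" using lam_less_kap by simp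
  note dense = decides_dense[OF ij one assms(13)]
  note range = forces_range_subset[OF ij one assms(13)]
  from assms(10) show ?thesis
  proof
    assume P: "P = L_club lam ks"
    have "\<exists>X. |X| \<le>o |{..<kap}| \<and> (\<forall>r\<in>L_club lam ks. r \<subseteq> p \<longrightarrow> (\<forall>\<alpha><lam.
      \<exists>r'\<in>L_club lam ks. r' \<subseteq> r \<and> (\<exists>\<nu>\<in>X. decides f ?one \<alpha> \<nu> r')))"
    proof (rule laver_values)
      show "decides f ?one \<alpha> \<nu> r \<Longrightarrow> r' \<subseteq> r \<Longrightarrow> decides f ?one \<alpha> \<nu> r'" for \<alpha> \<nu> r r'
        by (rule decides_mono)
      show "\<alpha> < lam \<Longrightarrow> r \<in> L_club lam ks \<Longrightarrow> r \<subseteq> p \<Longrightarrow>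
          \<exists>r'\<in>L_club lam ks. r' \<subseteq> r \<and> (\<exists>\<nu>. decides f ?one \<alpha> \<nu> r')" for \<alpha> r
        using dense[of r \<alpha>] P by simp
    qed
    then obtain X where X: "|X| \<le>o |{..<kap}|"
      "\<And>r \<alpha>. r \<in> P \<Longrightarrow> r \<subseteq> p \<Longrightarrow> \<alpha> < lam \<Longrightarrow> \<exists>r'\<in>P. r' \<subseteq> r \<and> (\<exists>\<nu>\<in>X. decides f ?one \<alpha> \<nu> r')"
      using P by auto
    have "forces P (\<subseteq>) (FRangeSubset f (check_set ?one X)) p"
      by (rule range[OF assms(11) order_refl]) (rule X(2))
    then show ?thesis using X(1) assms(11) by blast
  next
    assume P: "P = scl_M_club lam ks"
    obtain a0 where "a0 < lam" "lam < ks a0" using ks_eventually_greater by blast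
    then interpret large_sequence kap lam ks a0 by unfold_locales
    have normal_P: "r \<in> P" if "normal_tree r" for r using normal_tree_scl_M_club[OF that] P by simp
    obtain p0 where base: "normal_tree p0" "p0 \<subseteq> p" using normal_subtree[of p] assms(11) P by blast
    interpret miller_fusion kap lam ks a0 p0 "decides f ?one"
    proof
      show "normal_tree p0" by (rule base(1))
      show "decides f ?one \<alpha> \<nu> r \<Longrightarrow> r' \<subseteq> r \<Longrightarrow> decides f ?one \<alpha> \<nu> r'" for \<alpha> \<nu> r r'
        by (rule decides_mono)
      fix \<alpha> r assume r: "\<alpha> < lam" "normal_tree r" "r \<subseteq> p0"
      have "r \<subseteq> p" using r(3) base(2) by blast
      \<comment> \<open>Decisions are dense among all conditions; thinning the result brings them
        back to normal trees.\<close>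
      then obtain r1 \<nu> where r1: "r1 \<in> P" "r1 \<subseteq> r" "decides f ?one \<alpha> \<nu> r1"
        using dense[OF normal_P[OF r(2)] _ r(1)] by blast
      obtain r2 where r2: "normal_tree r2" "r2 \<subseteq> r1" using normal_subtree[of r1] r1(1) P by blast
      have "decides f ?one \<alpha> \<nu> r2" using decides_mono[OF r1(3) r2(2)] .
      then show "\<exists>r'. normal_tree r' \<and> r' \<subseteq> r \<and> (\<exists>\<nu>. decides f ?one \<alpha> \<nu> r')"
        using r1(2) r2 by blast
    qed
    obtain X where X: "|X| \<le>o |{..<kap}|"
      "\<forall>r \<alpha>. normal_tree r \<longrightarrow> r \<subseteq> fused \<longrightarrow> \<alpha> < lam \<longrightarrow>
        (\<exists>r'. normal_tree r' \<and> r' \<subseteq> r \<and> (\<exists>\<nu>\<in>X. decides f ?one \<alpha> \<nu> r'))"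
      using fused_values .
    have q: "fused \<in> P" "fused \<subseteq> p" using normal_P[OF fused_normal] fused_subset base(2) by blast+
    have "forces P (\<subseteq>) (FRangeSubset f (check_set ?one X)) fused"
    proof (rule range[OF q])
      fix r \<alpha> assume r: "r \<in> P" "r \<subseteq> fused" "\<alpha> < lam"
      \<comment> \<open>An arbitrary condition below \<open>fused\<close> has to be thinned before
        the values found for normal trees apply.\<close>
      obtain r1 where r1: "normal_tree r1" "r1 \<subseteq> r" using normal_subtree[of r] r(1) P by blast
      have sub: "r1 \<subseteq> fused" using r1(2) r(2) by blast
      obtain r2 where r2: "normal_tree r2" "r2 \<subseteq> r1" "\<exists>\<nu>\<in>X. decides f ?one \<alpha> \<nu> r2"
        using X(2)[rule_format, OF r1(1) sub r(3)] by (elim exE conjE)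
      have "r2 \<in> P" "r2 \<subseteq> r" using normal_P[OF r2(1)] r2(2) r1(2) by blast+
      then show "\<exists>r'\<in>P. r' \<subseteq> r \<and> (\<exists>\<nu>\<in>X. decides f ?one \<alpha> \<nu> r')" using r2(3) by blast
    qed
    then show ?thesis using X(1) q by blast
  qed
qed

end
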